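(* Assume that $\rho$ and $\log M$ are bounded, i.e. there are constants $\rho_{\max}\ge0$ and $L_{\max}<\infty$ with $\rho(x,y)\le\rho_{\max}$ and $|\log M(y)|\le L_{\max}$ for all $x\in A$, $y\in\hat A$, and that $\mathbb P$ is stationary and ergodic. Then for any $D>D_{\min}$ and any $\epsilon>0$ there is a sequence of finite sets $C_n\subset\hat A^n$ such that (i) $\frac1n\log M^n(C_n)\leq R(D)+\epsilon$ for all $n\ge1$; and (ii) $P_n([C_n]_D)\to1$ as $n\to\infty$. If moreover $\mathbb P$ is ergodic in blocks, there are sets $C_n$ satisfying (i) and (iii) $\mathbb P$-almost surely, $\rho_n(X_1^n,C_n)\leq D$ for all sufficiently large $n$.
   Context: General setting: $A$ and $\hat A$ are Polish spaces with Borel $\sigma$-algebras; $\mathbb P$ is a probability measure on $A^{\mathbb N}$, $\{X_n\}$ a process with law $\mathbb P$, $P_n$ the law of $X_1^n$. $\mathbb P$ is stationary if $X_1^n$ and $X_{1+k}^{n+k}$ have the same law for all $n,k$. For $k\ge1$, $\mathbb P$ is ergodic in $k$-blocks if the process $\{X_{nk+1}^{(n+1)k}:n\ge0\}$ is ergodic, and ergodic in blocks if it is ergodic in $k$-blocks for every $k\ge1$. $\rho:A\times\hat A\to[0,\infty)$ is measurable, $\rho_n(x_1^n,y_1^n)=\frac1n\sum_{i=1}^n\rho(x_i,y_i)$, $\rho_n(x_1^n,C)=\min_{y_1^n\in C}\rho_n(x_1^n,y_1^n)$, and $[C]_D=\{x_1^n\in A^n:\rho_n(x_1^n,y_1^n)\le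 D\text{ for some }y_1^n\in C\}$. $M:\hat A\to(0,\infty)$ is measurable, $M^n(C)=\sum_{y_1^n\in C}\prod_iM(y_i)$. Relative entropy $H(\mu\|\nu)=\int\log\frac{d\mu}{d\nu}d\mu$ if $\mu\ll\nu$, else $+\infty$. ${\cal M}_n(P_n,Q_n,D)$ is the set of probability measures $W_n$ on $A^n\times\hat A^n$ with marginals $P_n$ and $Q_n$ and $\int\rho_n\,dW_n\le D$; $I_n(P_n,Q_n,D)=\inf_{W_n\in{\cal M}_n(P_n,Q_n,D)}H(W_n\|P_n\times Q_n)$ ($+\infty$ if empty); $R_n(D)=\inf_{Q_n}\{I_n(P_n,Q_n,D)+E_{Q_n}[\log M^n(Y_1^n)]\}$; $R(D)=\lim_n\frac1nR_n(D)$ (which exists for stationary $\mathbb P$); $D_{\min}=\inf\{D\ge0:R(D)<+\infty\}$. Logarithms are natural. *)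

theory Defs
  imports "HOL-Probability.Probability"
begin

(* Finite blocks x_1^n are represented as extensional functions on {..<n}
   (index i corresponds to coordinate i+1). *)

definition blk_space :: "nat \<Rightarrow> ('a::topological_space) measure \<Rightarrow> (nat \<Rightarrow> 'a) measure" where
  "blk_space n M = Pi\<^sub>M {..<n} (\<lambda>_. M)"

definition path_space :: "('a::topological_space) measure \<Rightarrow> (nat \<Rightarrow> 'a) measure" where
  "path_space M = Pi\<^sub>M UNIV (\<lambda>_. M)"

definition marg :: "nat \<Rightarrow> (nat \<Rightarrow> 'a::topological_space) measure \<Rightarrow> (nat \<Rightarrow> 'a) measure" where
  "marg n P = distr P (blk_space n borel) (\<lambda>x. restrict x {..<n})"

definition stationary :: "(nat \<Rightarrow> 'a::topological_space) measure \<Rightarrow> bool" where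
  "stationary P \<longleftrightarrow> (\<forall>n k. distr P (blk_space n borel) (\<lambda>x. \<lambda>i\<in>{..<n}. x (i + k)) = marg n P)"

definition shift :: "(nat \<Rightarrow> 'c) \<Rightarrow> (nat \<Rightarrow> 'c)" where
  "shift x = (\<lambda>i. x (Suc i))"

definition ergodic_proc :: "(nat \<Rightarrow> 'c) measure \<Rightarrow> bool" where
  "ergodic_proc Q \<longleftrightarrow> (\<forall>S\<in>sets Q. {x\<in>space Q. shift x \<in> S} = S \<longrightarrow>
      measure Q S = 0 \<or> measure Q S = 1)"

definition block_law :: "nat \<Rightarrow> (nat \<Rightarrow> 'a::topological_space) measure \<Rightarrow> (nat \<Rightarrow> nat \<Rightarrow> 'a) measure" where
  "block_law k P = distr P (Pi\<^sub>M UNIV (\<lambda>_. blk_space k borel))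
      (\<lambda>x. \<lambda>m. \<lambda>i\<in>{..<k}. x (m * k + i))"

definition ergodic_blocks_k :: "nat \<Rightarrow> (nat \<Rightarrow> 'a::topological_space) measure \<Rightarrow> bool" where
  "ergodic_blocks_k k P \<longleftrightarrow> ergodic_proc (block_law k P)"

definition ergodic_in_blocks :: "(nat \<Rightarrow> 'a::topological_space) measure \<Rightarrow> bool" where
  "ergodic_in_blocks P \<longleftrightarrow> (\<forall>k\<ge>1. ergodic_blocks_k k P)"

definition rho_n :: "('a \<Rightarrow> 'b \<Rightarrow> real) \<Rightarrow> nat \<Rightarrow> (nat \<Rightarrow> 'a) \<Rightarrow> (nat \<Rightarrow> 'b) \<Rightarrow> real" where
  "rho_n \<rho> n x y = (1 / real n) * (\<Sum>i<n. \<rho> (x i) (y i))"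

(* rho_n(x, C) = min over C (+\<infinity> if C is empty) *)
definition rho_n_set :: "('a \<Rightarrow> 'b \<Rightarrow> real) \<Rightarrow> nat \<Rightarrow> (nat \<Rightarrow> 'a) \<Rightarrow> (nat \<Rightarrow> 'b) set \<Rightarrow> ereal" where
  "rho_n_set \<rho> n x C = (INF y\<in>C. ereal (rho_n \<rho> n x y))"

definition blowup :: "('a::topological_space \<Rightarrow> 'b \<Rightarrow> real) \<Rightarrow> nat \<Rightarrow> (nat \<Rightarrow> 'b) set \<Rightarrow> real \<Rightarrow> (nat \<Rightarrow> 'a) set" where
  "blowup \<rho> n C D = {x \<in> space (blk_space n (borel :: 'a measure)).
      \<exists>y\<in>C. rho_n \<rho> n x y \<le> D}"

definition Mn :: "('b \<Rightarrow> real) \<Rightarrow> nat \<Rightarrow> (nat \<Rightarrow> 'b) set \<Rightarrow> real" where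
  "Mn M n C = (\<Sum>y\<in>C. \<Prod>i<n. M (y i))"

definition eln :: "real \<Rightarrow> ereal" where
  "eln t = (if t = 0 then -\<infinity> else ereal (ln t))"

definition rel_entropy :: "'c measure \<Rightarrow> 'c measure \<Rightarrow> ereal" where
  "rel_entropy \<mu> \<nu> =
     (if sets \<mu> = sets \<nu> \<and> absolutely_continuous \<nu> \<mu> then
        enn2ereal (\<integral>\<^sup>+ x. ennreal (ln (enn2real (RN_deriv \<nu> \<mu> x))) \<partial>\<mu>)
        - enn2ereal (\<integral>\<^sup>+ x. ennreal (- ln (enn2real (RN_deriv \<nu> \<mu> x))) \<partial>\<mu>)
      else \<infinity>)"

definition couplings :: "('a::topological_space \<Rightarrow> 'b::topological_space \<Rightarrow> real) \<Rightarrow> nat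
    \<Rightarrow> (nat \<Rightarrow> 'a) measure \<Rightarrow> (nat \<Rightarrow> 'b) measure \<Rightarrow> real
    \<Rightarrow> ((nat \<Rightarrow> 'a) \<times> (nat \<Rightarrow> 'b)) measure set" where
  "couplings \<rho> n Pn Qn D = {W. prob_space W
      \<and> sets W = sets (blk_space n (borel :: 'a measure) \<Otimes>\<^sub>M blk_space n (borel :: 'b measure))
      \<and> distr W (blk_space n borel) fst = Pn
      \<and> distr W (blk_space n borel) snd = Qn
      \<and> (\<integral>\<^sup>+ w. ennreal (rho_n \<rho> n (fst w) (snd w)) \<partial>W) \<le> ennreal D}"

definition I_n :: "('a::topological_space \<Rightarrow> 'b::topological_space \<Rightarrow> real) \<Rightarrow> nat
    \<Rightarrow> (nat \<Rightarrow> 'a) measure \<Rightarrow> (nat \<Rightarrow> 'b) measure \<Rightarrow> real \<Rightarrow> ereal" where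
  "I_n \<rho> n Pn Qn D = (INF W\<in>couplings \<rho> n Pn Qn D. rel_entropy W (Pn \<Otimes>\<^sub>M Qn))"

definition R_n :: "(nat \<Rightarrow> 'a::topological_space) measure \<Rightarrow> ('a \<Rightarrow> 'b::topological_space \<Rightarrow> real)
    \<Rightarrow> ('b \<Rightarrow> real) \<Rightarrow> nat \<Rightarrow> real \<Rightarrow> ereal" where
  "R_n P \<rho> M n D = (INF Qn\<in>{Q. prob_space Q \<and> sets Q = sets (blk_space n (borel :: 'b measure))}.
      I_n \<rho> n (marg n P) Qn D + ereal (\<integral>y. (\<Sum>i<n. ln (M (y i))) \<partial>Qn))"

definition R :: "(nat \<Rightarrow> 'a::topological_space) measure \<Rightarrow> ('a \<Rightarrow> 'b::topological_space \<Rightarrow> real)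
    \<Rightarrow> ('b \<Rightarrow> real) \<Rightarrow> real \<Rightarrow> ereal" where
  "R P \<rho> M D = lim (\<lambda>n. R_n P \<rho> M n D / ereal (real n))"

definition D_min :: "(nat \<Rightarrow> 'a::topological_space) measure \<Rightarrow> ('a \<Rightarrow> 'b::topological_space \<Rightarrow> real)
    \<Rightarrow> ('b \<Rightarrow> real) \<Rightarrow> ereal" where
  "D_min P \<rho> M = Inf {ereal D | D. D \<ge> 0 \<and> R P \<rho> M D < \<infinity>}"

end

(*
Choose m and a bounded conditional density f(x,y) of reproduction blocks given source m-blocks, with
respect to a reference law Q, whose expected distortion is strictly below m D and whose expected
value of ln f + ln M^m is strictly below m (R(D) + eps).  Concatenating conditional densities of
different block lengths shows that R_n(D)/n converges and that such f exist as soon as D > D_min.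

For a source path x cut into k blocks of length m, let V_x have density prod_i f(x_i, y_i) with
respect to Q^k.  By Chebyshev, distortion, ln M and ln prod f are close to their V_x-means except
on a set of small V_x-probability, and bounding prod f by its typical value gives a lower bound
exp(-k (h + delta))/2 for the Q^k-probability of good codewords.  A greedy choice of about
exp(k (h + delta)) codewords then leaves uncovered only an exponentially small part of the set of x
whose block averages are typical.

P need not be ergodic in m-blocks.  The blocks are therefore laid out in m segments of equal length,
one symbol being skipped between consecutive segments, so that each phase modulo m is used equally
often.  The averages along each phase converge by Birkhoff's theorem, possibly to a random limit, but
the mean over all phases is an ordinary ergodic average.  Hence the almost sure covering (iii) holds
without ergodicity in blocks, and it implies (ii).
*)
theory Submission
  imports Defs "HOL-Real_Asymp.Real_Asymp"
begin

section \<open>Ergodic averages of bounded observables\<close>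

text \<open>Boundedness of the densities is what lets one Chebyshev estimate serve every source
  path: the second moments of distortion, log-mass and log-likelihood are then bounded uniformly in
  the source block. Optimal couplings have no bounded density in general, so they are truncated, at
  an arbitrarily small cost in distortion and rate. The excess distortion is bought back by one code
  for some D' < D, mixed in among many copies of a nearly optimal one; this is where D >
  \<open>D_min\<close> enters. The reference law need not be the output marginal: passing to that
  marginal can only lower the relative entropy. Segment s has phase s and contributes the partial
  sums between s L and (s + 1) L blocks, hence (s + 1) c(s) - s c(s) = c(s) in the limit, whatever
  the phase limit c(s) is. So only the sum of the c(s), an ergodic average, has to be controlled. If
  one random codeword covers with probability at least p, then n / p greedy codewords leave at most
  exp(- n) uncovered. This is summable, so Borel-Cantelli applies, and the factor n disappears from
  the rate.\<close>

locale measure_preserving_system = prob_space +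
  fixes T :: "'a \<Rightarrow> 'a"
  assumes T_meas [measurable]: "T \<in> measurable M M" and T_pres: "distr M M T = M"
begin

lemma T_space: "x \<in> space M \<Longrightarrow> T x \<in> space M"
  using T_meas by (auto simp: measurable_def)

lemma T_pow_meas [measurable]: "(T ^^ n) \<in> measurable M M"
  by (induction n) (auto intro: measurable_comp[OF _ T_meas])

lemma integral_T: "f \<in> borel_measurable M \<Longrightarrow> (\<integral>x. f (T x) \<partial>M) = (\<integral>x. f x \<partial>M :: real)"
  using integral_distr[OF T_meas, of f] by (simp add: T_pres)

section \<open>Maximal ergodic inequality\<close>

text \<open>Garsia's argument. \<open>A n\<close> is the largest partial sum of length at most n,
  the empty sum included; wherever \<open>A (Suc n) x\<close> is positive it equals
  \<open>h x + A n (T x)\<close>. Over the invariant set \<open>E\<close> the functions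
  \<open>A n\<close> and \<open>A n\<close> composed with T have the same integral, and
  \<open>A\<close> increases in n.\<close>

lemma maximal_ergodic:
  fixes h :: "'a \<Rightarrow> real"
  assumes h[measurable]: "h \<in> borel_measurable M" and bd: "\<And>x. x \<in> space M \<Longrightarrow> \<bar>h x\<bar> \<le> K"
    and E[measurable]: "E \<in> sets M" and inv: "\<And>x. x \<in> space M \<Longrightarrow> T x \<in> E \<longleftrightarrow> x \<in> E"
    and pos: "\<And>x. x \<in> E \<Longrightarrow> \<exists>k. 0 < (\<Sum>j<k. h ((T ^^ j) x))"
  shows "0 \<le> (\<integral>x. indicator E x * h x \<partial>M)"
proof -
  define A :: "nat \<Rightarrow> 'a \<Rightarrow> real" where "A = rec_nat (\<lambda>_. 0) (\<lambda>_ a x. max 0 (h x + a (T x)))"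
  have A0: "A 0 x = 0" and AS: "A (Suc n) x = max 0 (h x + A n (T x))" for n x
    by (simp_all add: A_def)
  have [measurable]: "A n \<in> borel_measurable M" for n
  proof (induction n)
    case 0 then show ?case by (simp add: A_def)
  next
    case (Suc n)
    have [measurable]: "A n \<in> borel_measurable M" by fact
    have "A (Suc n) = (\<lambda>x. max 0 (h x + A n (T x)))" by (rule ext) (rule AS)
    then show ?case by simp
  qed
  have A_nonneg: "0 \<le> A n x" for n x by (cases n) (auto simp: A0 AS)
  have A_mono: "A n x \<le> A (Suc n) x" for n x
  proof (induction n arbitrary: x)
    case 0 show ?case using A_nonneg[of "Suc 0" x] by (simp add: A0)
  next
    case (Suc n) show ?case using Suc[of "T x"] unfolding AS[of "Suc n" x] AS[of n x] by linarith
  qed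
  have A_bd: "x \<in> space M \<Longrightarrow> A n x \<le> real n * \<bar>K\<bar>" for n x
  proof (induction n arbitrary: x)
    case (Suc n)
    have "h x + A n (T x) \<le> \<bar>K\<bar> + real n * \<bar>K\<bar>"
      using bd[OF Suc.prems] Suc.IH[OF T_space[OF Suc.prems]] by linarith
    then show ?case by (auto simp: AS algebra_simps)
  qed (simp add: A0)
  have A_ge: "(\<Sum>j<n. h ((T ^^ j) x)) \<le> A n x" for n x
  proof (induction n arbitrary: x)
    case (Suc n)
    have "(\<Sum>j<Suc n. h ((T ^^ j) x)) = h x + (\<Sum>j<n. h ((T ^^ j) (T x)))"
      by (subst sum.lessThan_Suc_shift) (simp add: funpow_swap1)
    also have "\<dots> \<le> h x + A n (T x)" using Suc by simp
    finally show ?case by (simp add: AS)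
  qed (simp add: A0)
  have int_A: "integrable M (\<lambda>x. indicator E x * A n x)" for n
    by (rule integrable_const_bound[where B="real n * \<bar>K\<bar>"])
      (use A_nonneg A_bd in \<open>auto intro!: AE_I2 simp: abs_mult split: split_indicator\<close>)
  have int_AT: "integrable M (\<lambda>x. indicator E x * A n (T x))" for n
    by (rule integrable_const_bound[where B="real n * \<bar>K\<bar>"])
      (use A_nonneg A_bd T_space in \<open>auto intro!: AE_I2 simp: abs_mult split: split_indicator\<close>)
  have int_h: "integrable M (\<lambda>x. indicator E x * h x * indicator {x\<in>space M. 0 < A n x} x)" for n
    by (rule integrable_const_bound[where B="\<bar>K\<bar>"])
      (use bd in \<open>force intro!: AE_I2 simp: abs_mult split: split_indicator\<close>)+
  have inv': "(\<integral>x. indicator E x * A n (T x) \<partial>M) = (\<integral>x. indicator E x * A n x \<partial>M)" for n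
  proof -
    have "(\<integral>x. indicator E x * A n (T x) \<partial>M) = (\<integral>x. indicator E (T x) * A n (T x) \<partial>M)"
      by (rule Bochner_Integration.integral_cong) (auto simp: inv split: split_indicator)
    also have "\<dots> = (\<integral>x. indicator E x * A n x \<partial>M)"
      by (rule integral_T) measurable
    finally show ?thesis .
  qed
  have ge0: "0 \<le> (\<integral>x. indicator E x * h x * indicator {x\<in>space M. 0 < A (Suc n) x} x \<partial>M)" for n
  proof -
    have "0 \<le> (\<integral>x. indicator E x * A (Suc n) x \<partial>M) - (\<integral>x. indicator E x * A n x \<partial>M)"
      using integral_mono[OF int_A[of n] int_A[of "Suc n"]] A_mono[of n]
      by (auto simp: mult_left_mono)
    also have "\<dots> = (\<integral>x. indicator E x * A (Suc n) x - indicator E x * A n (T x) \<partial>M)"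
      by (subst Bochner_Integration.integral_diff) (auto simp: int_A int_AT inv')
    \<comment> \<open>Where \<open>A (Suc n) x\<close> is positive the integrands agree on
      \<open>E\<close>; elsewhere it is 0 and the left integrand is at most 0 because
      \<open>A n\<close> is nonnegative.\<close>
    also have "\<dots> \<le> (\<integral>x. indicator E x * h x * indicator {x\<in>space M. 0 < A (Suc n) x} x \<partial>M)"
    proof (rule integral_mono[OF Bochner_Integration.integrable_diff[OF int_A int_AT] int_h])
      fix x assume "x \<in> space M"
      then show "indicator E x * A (Suc n) x - indicator E x * A n (T x)
          \<le> indicator E x * h x * indicator {x\<in>space M. 0 < A (Suc n) x} x"
        using A_nonneg[of n "T x"] AS[of n x] by (auto split: split_indicator)
    qed
    finally show ?thesis .
  qed
  \<comment> \<open>At each point of \<open>E\<close> some partial sum is positive, so the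
    increasing \<open>A n x\<close> is eventually positive and the cut-off indicator tends to
    1.\<close>
  have "(\<lambda>n. \<integral>x. indicator E x * h x * indicator {x\<in>space M. 0 < A (Suc n) x} x \<partial>M)
      \<longlonglongrightarrow> (\<integral>x. indicator E x * h x \<partial>M)"
  proof (rule integral_dominated_convergence[where w="\<lambda>_. \<bar>K\<bar>"])
    show "AE x in M. (\<lambda>n. indicator E x * h x * indicator {x\<in>space M. 0 < A (Suc n) x} x)
        \<longlonglongrightarrow> indicator E x * h x"
    proof (rule AE_I2)
      fix x assume x: "x \<in> space M"
      show "(\<lambda>n. indicator E x * h x * indicator {x\<in>space M. 0 < A (Suc n) x} x)
        \<longlonglongrightarrow> indicator E x * h x"
      proof (cases "x \<in> E")
        case True
        obtain k where "0 < (\<Sum>j<k. h ((T ^^ j) x))" using pos[OF True] by blast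
        then have "0 < A k x" by (rule less_le_trans) (rule A_ge)
        moreover have "incseq (\<lambda>n. A n x)" by (rule incseq_SucI) (rule A_mono)
        ultimately have "0 < A (Suc n) x" if "n \<ge> k" for n
          using incseqD[of "\<lambda>n. A n x" k "Suc n"] that by simp
        then have "eventually (\<lambda>n. indicator E x * h x * indicator {x\<in>space M. 0 < A (Suc n) x} x
            = indicator E x * h x) sequentially"
          using x unfolding eventually_sequentially by (intro exI[of _ k]) (auto simp: indicator_def)
        then show ?thesis by (rule tendsto_eventually)
      qed simp
    qed
  qed (use bd in \<open>force intro!: AE_I2 simp: abs_mult split: split_indicator\<close>)+
  then show ?thesis
    by (rule LIMSEQ_le_const) (use ge0 in auto)
qed

definition avg :: "('a \<Rightarrow> real) \<Rightarrow> nat \<Rightarrow> 'a \<Rightarrow> real" where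
  "avg g k x = (\<Sum>j<k. g ((T ^^ j) x)) / real k"

lemma avg_meas [measurable]: "g \<in> borel_measurable M \<Longrightarrow> avg g k \<in> borel_measurable M"
  unfolding avg_def[abs_def] divide_inverse
  by (intro borel_measurable_times borel_measurable_const borel_measurable_sum measurable_compose[OF T_pow_meas])

context
  fixes g :: "'a \<Rightarrow> real" and K :: real
  assumes g[measurable]: "g \<in> borel_measurable M" and bd: "\<And>x. x \<in> space M \<Longrightarrow> \<bar>g x\<bar> \<le> K"
begin

lemma T_pow_space: "x \<in> space M \<Longrightarrow> (T ^^ n) x \<in> space M"
  by (induction n) (auto simp: T_space)

text \<open>The two sums telescope to the boundary term \<open>g ((T ^^ k) x) - g x\<close>, which
  division by k sends to 0. Hence limsup and liminf of the averages are T-invariant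
  functions.\<close>

lemma avg_T_diff:
  assumes x: "x \<in> space M" shows "(\<lambda>k. avg g k (T x) - avg g k x) \<longlonglongrightarrow> 0"
proof (rule Lim_null_comparison)
  have eq: "(\<Sum>j<k. g ((T ^^ j) (T x))) - (\<Sum>j<k. g ((T ^^ j) x)) = g ((T ^^ k) x) - g x" for k
    by (induction k) (auto simp: funpow_swap1)
  show "eventually (\<lambda>k. norm (avg g k (T x) - avg g k x) \<le> 2 * K * inverse (real k)) sequentially"
  proof (intro always_eventually allI)
    fix k
    have "avg g k (T x) - avg g k x = (g ((T ^^ k) x) - g x) / real k"
      by (simp add: avg_def diff_divide_distrib[symmetric] eq)
    also have "\<bar>\<dots>\<bar> \<le> 2 * K / real k"
      using bd[OF x] bd[OF T_pow_space[OF x, of k]] by (simp add: abs_divide divide_right_mono)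
    finally show "norm (avg g k (T x) - avg g k x) \<le> 2 * K * inverse (real k)"
      by (simp add: divide_inverse)
  qed
  show "(\<lambda>k. 2 * K * inverse (real k)) \<longlonglongrightarrow> 0"
    by real_asymp
qed

lemma limsup_avg_T:
  assumes x: "x \<in> space M"
  shows "limsup (\<lambda>k. ereal (avg g k (T x))) = limsup (\<lambda>k. ereal (avg g k x))"
proof -
  have "(\<lambda>k. ereal (avg g k (T x) - avg g k x)) \<longlonglongrightarrow> 0"
    using avg_T_diff[OF x] by (simp add: zero_ereal_def)
  from ereal_limsup_lim_add[OF this, of "\<lambda>k. ereal (avg g k x)"] show ?thesis by simp
qed

lemma liminf_avg_T:
  assumes x: "x \<in> space M"
  shows "liminf (\<lambda>k. ereal (avg g k (T x))) = liminf (\<lambda>k. ereal (avg g k x))"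
proof -
  have "(\<lambda>k. ereal (avg g k (T x) - avg g k x)) \<longlonglongrightarrow> 0"
    using avg_T_diff[OF x] by (simp add: zero_ereal_def)
  from ereal_liminf_lim_add[OF this, of "\<lambda>k. ereal (avg g k x)"] show ?thesis by simp
qed

text \<open>The maximal inequality applied to \<open>g - b\<close>: a limsup above b makes some
  partial sum of \<open>g - b\<close> positive at every point of \<open>E\<close>.\<close>

lemma integral_ge_on_invariant:
  assumes E[measurable]: "E \<in> sets M" and inv: "\<And>x. x \<in> space M \<Longrightarrow> T x \<in> E \<longleftrightarrow> x \<in> E"
    and big: "\<And>x. x \<in> E \<Longrightarrow> limsup (\<lambda>k. ereal (avg g k x)) > ereal b"
  shows "b * prob E \<le> (\<integral>x. indicator E x * g x \<partial>M)"
proof -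
  have int: "integrable M (\<lambda>x. indicator E x * g x)"
    by (rule integrable_const_bound[where B="\<bar>K\<bar>"])
      (use bd in \<open>force intro!: AE_I2 simp: abs_mult split: split_indicator\<close>)+
  have "0 \<le> (\<integral>x. indicator E x * (g x - b) \<partial>M)"
  proof (rule maximal_ergodic[where K="\<bar>K\<bar> + \<bar>b\<bar>", OF _ _ E inv])
    fix x assume x: "x \<in> E"
    have "\<exists>\<^sub>F k in sequentially. avg g k x > b"
    proof (rule ccontr)
      assume "\<not> (\<exists>\<^sub>F k in sequentially. avg g k x > b)"
      then have "\<forall>\<^sub>F k in sequentially. ereal (avg g k x) \<le> ereal b"
        by (simp add: frequently_def not_less)
      from Limsup_bounded[OF this] big[OF x] show False by simp
    qed
    \<comment> \<open>\<open>k \<ge> 1\<close> excludes \<open>avg g 0 x\<close>, which is 0 through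
      division by zero and carries no information.\<close>
    then obtain k where k: "k \<ge> 1" "avg g k x > b" unfolding frequently_sequentially by blast
    then have "(\<Sum>j<k. g ((T ^^ j) x)) > b * real k" by (simp add: avg_def field_simps)
    then show "\<exists>k. 0 < (\<Sum>j<k. g ((T ^^ j) x) - b)"
      by (intro exI[of _ k]) (simp add: sum_subtractf algebra_simps)
  qed (use bd in \<open>force+\<close>)
  also have "\<dots> = (\<integral>x. indicator E x * g x - b * indicator E x \<partial>M)"
    by (intro Bochner_Integration.integral_cong) (auto simp: algebra_simps)
  also have "\<dots> = (\<integral>x. indicator E x * g x \<partial>M) - b * prob E"
    by (subst Bochner_Integration.integral_diff)
      (use int in \<open>auto simp: emeasure_eq_measure less_top[symmetric]\<close>)
  finally show ?thesis by simp
qed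

end

section \<open>Pointwise ergodic theorem\<close>

text \<open>On the invariant set \<open>E\<close> where the averages oscillate across a gap a < b,
  the bounds for g and for -g give b prob E \<le> \<integral> g over E \<le> a prob E, so
  \<open>E\<close> is null; countably many rational gaps suffice. The limit is left unidentified,
  because powers of the shift need not be ergodic.\<close>

lemma birkhoff_convergent:
  fixes g :: "'a \<Rightarrow> real"
  assumes g[measurable]: "g \<in> borel_measurable M" and bd: "\<And>x. x \<in> space M \<Longrightarrow> \<bar>g x\<bar> \<le> K"
  shows "AE x in M. convergent (\<lambda>k. avg g k x)"
proof -
  let ?lo = "\<lambda>x. liminf (\<lambda>k. ereal (avg g k x))" and ?up = "\<lambda>x. limsup (\<lambda>k. ereal (avg g k x))"
  have null: "AE x in M. \<not> (?lo x < ereal a \<and> ereal b < ?up x)"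
    if ab: "a < b" for a b :: real
  proof -
    define E where "E = {x\<in>space M. ?lo x < ereal a \<and> ereal b < ?up x}"
    have E[measurable]: "E \<in> sets M" unfolding E_def by measurable
    have inv: "T x \<in> E \<longleftrightarrow> x \<in> E" if "x \<in> space M" for x
      unfolding E_def using limsup_avg_T[OF g bd that] liminf_avg_T[OF g bd that] that T_space by auto
    have 1: "b * prob E \<le> (\<integral>x. indicator E x * g x \<partial>M)"
      by (rule integral_ge_on_invariant[OF g bd E inv]) (auto simp: E_def)
    have eq: "limsup (\<lambda>k. ereal (avg (\<lambda>x. - g x) k x)) = - ?lo x" for x
      by (simp add: avg_def sum_negf flip: ereal_Limsup_uminus)
    have 2: "(-a) * prob E \<le> (\<integral>x. indicator E x * - g x \<partial>M)"
    proof (rule integral_ge_on_invariant[OF _ _ E inv])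
      fix x assume "x \<in> E"
      then have "- ereal a < - ?lo x"
        unfolding E_def ereal_minus_less_minus by simp
      then show "ereal (- a) < limsup (\<lambda>k. ereal (avg (\<lambda>x. - g x) k x))"
        by (simp add: eq ereal_Limsup_uminus)
    qed (use bd in auto)
    have "(\<integral>x. indicator E x * - g x \<partial>M) = - (\<integral>x. indicator E x * g x \<partial>M)" by simp
    with 1 2 have "(b - a) * prob E \<le> 0" by (simp add: algebra_simps)
    then have "prob E = 0" using ab measure_nonneg[of M E] by (simp add: mult_le_0_iff)
    then have "AE x in M. x \<notin> E" using prob_eq_0[OF E] by simp
    then show ?thesis using AE_space by eventually_elim (auto simp: E_def)
  qed
  have "AE x in M. \<forall>a\<in>\<rat>. \<forall>b\<in>\<rat>. a < b \<longrightarrow> \<not> (?lo x < ereal a \<and> ereal b < ?up x)"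
    using null by (auto simp: AE_ball_countable countable_rat)
  then show ?thesis using AE_space
  proof eventually_elim
    fix x assume *: "\<forall>a\<in>\<rat>. \<forall>b\<in>\<rat>. a < b \<longrightarrow> \<not> (?lo x < ereal a \<and> ereal b < ?up x)"
      and x: "x \<in> space M"
    let ?u = "\<lambda>k. ereal (avg g k x)"
    have K0: "0 \<le> K" using bd[OF x] by linarith
    have avgbd: "\<bar>avg g k x\<bar> \<le> K" for k
    proof (cases "k = 0")
      case False
      have "\<bar>\<Sum>j<k. g ((T ^^ j) x)\<bar> \<le> (\<Sum>j<k. K)"
        by (rule order_trans[OF sum_abs sum_mono]) (use bd T_pow_space[OF g bd x] in auto)
      then show ?thesis using False by (simp add: avg_def abs_divide field_simps)
    qed (use K0 in \<open>simp add: avg_def\<close>)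
    have "limsup ?u \<le> liminf ?u"
    proof (rule ccontr)
      assume "\<not> limsup ?u \<le> liminf ?u"
      then have "liminf ?u < limsup ?u" by simp
      then obtain b where b: "liminf ?u < b" "b < limsup ?u" using dense by blast
      obtain a' where a': "liminf ?u < ereal (real_of_rat a')" "ereal (real_of_rat a') < b"
        using ereal_dense3[OF b(1)] by blast
      obtain b' where b': "b < ereal (real_of_rat b')" "ereal (real_of_rat b') < limsup ?u"
        using ereal_dense3[OF b(2)] by blast
      have "real_of_rat a' < real_of_rat b'" using a' b' by (metis ereal_less_eq(3) less_trans not_le order.strict_trans)
      then show False using * a' b' by (metis Rats_of_rat)
    qed
    then have eq: "liminf ?u = limsup ?u" using Liminf_le_Limsup[of sequentially ?u] by simp
    have "?u \<longlonglongrightarrow> limsup ?u"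
      by (rule iffD2[OF tendsto_iff_Liminf_eq_Limsup]) (auto simp: eq)
    moreover have "\<bar>limsup ?u\<bar> \<noteq> \<infinity>"
    proof -
      have "limsup ?u \<le> ereal K" by (rule Limsup_bounded) (simp add: abs_le_D1[OF avgbd])
      moreover have "ereal (-K) \<le> liminf ?u"
        by (rule Liminf_bounded) (use abs_le_D2[OF avgbd] in \<open>simp add: minus_le_iff\<close>)
      ultimately show ?thesis using eq by (cases "limsup ?u") auto
    qed
    ultimately obtain l where "?u \<longlonglongrightarrow> ereal l" by (cases "limsup ?u") auto
    then have "(\<lambda>k. avg g k x) \<longlonglongrightarrow> l" by simp
    then show "convergent (\<lambda>k. avg g k x)" by (rule convergentI)
  qed
qed

text \<open>The invariant set where the limsup exceeds b has probability 0 or 1, and probability 1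
  would force b \<le> \<open>expectation g\<close>. The upper bound is the only direction the
  covering argument asks for: distortion, mass and entropy are all bounded from above.\<close>

lemma birkhoff_ergodic_le:
  fixes g :: "'a \<Rightarrow> real"
  assumes g[measurable]: "g \<in> borel_measurable M" and bd: "\<And>x. x \<in> space M \<Longrightarrow> \<bar>g x\<bar> \<le> K"
    and erg: "\<And>E. E \<in> sets M \<Longrightarrow> {x\<in>space M. T x \<in> E} = E \<Longrightarrow> prob E = 0 \<or> prob E = 1"
  shows "AE x in M. limsup (\<lambda>k. ereal (avg g k x)) \<le> ereal (expectation g)"
proof -
  have null: "AE x in M. limsup (\<lambda>k. ereal (avg g k x)) \<le> ereal b" if b: "b > expectation g" for b
  proof -
    define E where "E = {x\<in>space M. ereal b < limsup (\<lambda>k. ereal (avg g k x))}"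
    have E[measurable]: "E \<in> sets M" unfolding E_def by measurable
    have inv: "T x \<in> E \<longleftrightarrow> x \<in> E" if "x \<in> space M" for x
      unfolding E_def using limsup_avg_T[OF g bd that] that T_space by auto
    have 1: "b * prob E \<le> (\<integral>x. indicator E x * g x \<partial>M)"
      by (rule integral_ge_on_invariant[OF g bd E inv]) (auto simp: E_def)
    have "{x\<in>space M. T x \<in> E} = E" using inv sets.sets_into_space[OF E] by auto
    then have "prob E = 0 \<or> prob E = 1" using erg E by blast
    moreover have "prob E \<noteq> 1"
    proof
      assume p1: "prob E = 1"
      then have "AE x in M. x \<in> E" using prob_eq_1[OF E] by simp
      then have "(\<integral>x. indicator E x * g x \<partial>M) = expectation g"
        by (intro integral_cong_AE) (auto elim!: eventually_mono)
      with 1 p1 b show False by simp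
    qed
    ultimately have "prob E = 0" by simp
    then have "AE x in M. x \<notin> E" using prob_eq_0[OF E] by simp
    then show ?thesis using AE_space by eventually_elim (auto simp: E_def)
  qed
  have "AE x in M. \<forall>n. limsup (\<lambda>k. ereal (avg g k x)) \<le> ereal (expectation g + inverse (real (Suc n)))"
    unfolding AE_all_countable by (intro allI null) simp
  then show ?thesis
  proof eventually_elim
    fix x assume *: "\<forall>n. limsup (\<lambda>k. ereal (avg g k x)) \<le> ereal (expectation g + inverse (real (Suc n)))"
    have "(\<lambda>n. expectation g + inverse (real (Suc n))) \<longlonglongrightarrow> expectation g + 0"
      by (intro tendsto_intros LIMSEQ_inverse_real_of_nat)
    then have "(\<lambda>n. ereal (expectation g + inverse (real (Suc n)))) \<longlonglongrightarrow> ereal (expectation g)" by simp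
    then show "limsup (\<lambda>k. ereal (avg g k x)) \<le> ereal (expectation g)"
      by (rule LIMSEQ_le_const) (use * in auto)
  qed
qed

end

section \<open>Stationary sources\<close>

text \<open>Extensional like the elements of \<open>blk_space\<close>, so that blocks cut at
  different times are points of one and the same product space.\<close>

definition window :: "nat \<Rightarrow> nat \<Rightarrow> (nat \<Rightarrow> 'a) \<Rightarrow> nat \<Rightarrow> 'a" where
  "window t m x = (\<lambda>i\<in>{..<m}. x (i + t))"

lemma shift_pow: "(shift ^^ n) x = (\<lambda>i. x (i + n))"
  by (induction n arbitrary: x) (auto simp: shift_def funpow_swap1)

lemma window_shift: "window t m x = window 0 m ((shift ^^ t) x)"
  by (simp add: window_def shift_pow)

lemma measurable_window:
  "{t..<t+m} \<subseteq> I \<Longrightarrow> window t m \<in> measurable (Pi\<^sub>M I (\<lambda>_. N)) (blk_space m N)"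
  unfolding window_def[abs_def] blk_space_def
  by (rule measurable_restrict) (auto intro!: measurable_component_singleton)

locale stat_source = prob_space P
  for P :: "(nat \<Rightarrow> 'a::polish_space) measure" +
  assumes P_sets [measurable_cong]: "sets P = sets (path_space (borel :: 'a measure))"
    and stat: "stationary P"
begin

lemma P_space: "space P = UNIV"
  using sets_eq_imp_space_eq[OF P_sets] by (simp add: path_space_def space_PiM)

lemma window_meas [measurable]: "window t m \<in> measurable P (blk_space m borel)"
  using measurable_window[of t m UNIV "borel :: 'a measure"] P_sets
  by (auto simp: path_space_def cong: measurable_cong_sets)

lemma distr_window: "distr P (blk_space m borel) (window t m) = marg m P"
  using stat by (simp add: stationary_def window_def[abs_def])

lemma sets_marg [measurable_cong, simp]: "sets (marg m P) = sets (blk_space m borel)"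
  by (simp add: marg_def)

lemma space_marg [simp]: "space (marg m P) = space (blk_space m (borel :: 'a measure))"
  by (simp add: marg_def)

lemma prob_marg: "prob_space (marg m P)"
  unfolding distr_window[of m 0, symmetric] by (rule prob_space_distr) measurable

lemma integral_window:
  "f \<in> borel_measurable (blk_space m borel) \<Longrightarrow> (\<integral>x. f (window t m x) \<partial>P) = (\<integral>x. f x \<partial>marg m P :: real)"
  by (subst distr_window[of m t, symmetric]) (simp add: integral_distr)

lemma shift_meas [measurable]: "shift \<in> measurable P P"
proof -
  have "shift \<in> measurable (path_space borel) (path_space (borel :: 'a measure))"
    unfolding path_space_def shift_def
    by (rule measurable_PiM_single') (auto intro!: measurable_component_singleton)
  then show ?thesis by simp
qed

text \<open>Stationarity speaks of finite windows. Cylinder sets determine a measure on the path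
  space, and a cylinder over \<open>J\<close> is an event about any window that covers
  \<open>J\<close>.\<close>

lemma shift_pres: "distr P P shift = P"
proof (rule measure_eqI_PiM_infinite[where I=UNIV and M="\<lambda>_. borel"])
  show "sets (distr P P shift) = sets (Pi\<^sub>M UNIV (\<lambda>_. borel))" "sets P = sets (Pi\<^sub>M UNIV (\<lambda>_. borel))"
    using P_sets by (simp_all add: path_space_def)
  show "finite_measure (distr P P shift)"
    by (rule prob_space.finite_measure[OF prob_space_distr]) measurable
next
  fix A :: "nat \<Rightarrow> 'a set" and J :: "nat set"
  assume J: "finite J" and A: "\<And>i. i \<in> J \<Longrightarrow> A i \<in> sets borel"
  obtain n where n: "J \<subseteq> {..<n}" using finite_nat_bounded[OF J] by blast
  define B where "B = {z \<in> space (blk_space n (borel :: 'a measure)). \<forall>j\<in>J. z j \<in> A j}"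
  have B: "B \<in> sets (blk_space n borel)"
    unfolding B_def
  proof (rule sets.sets_Collect_finite_All[OF _ J])
    fix j assume j: "j \<in> J"
    have "(\<lambda>z. z j) \<in> measurable (blk_space n borel) (borel :: 'a measure)"
      unfolding blk_space_def using j n by (intro measurable_component_singleton) auto
    from measurable_sets[OF this A[OF j]]
    show "{z \<in> space (blk_space n borel). z j \<in> A j} \<in> sets (blk_space n borel)"
      by (simp add: vimage_def Int_def conj_commute)
  qed
  have wB: "window t n x \<in> B \<longleftrightarrow> (\<forall>j\<in>J. x (j + t) \<in> A j)" for t x
    using n by (auto simp: B_def window_def blk_space_def space_PiM)
  define E where "E = prod_emb UNIV (\<lambda>_. borel :: 'a measure) J (Pi\<^sub>E J A)"
  have E: "x \<in> E \<longleftrightarrow> (\<forall>j\<in>J. x j \<in> A j)" for x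
    by (auto simp: E_def prod_emb_def PiE_def Pi_def)
  have "emeasure P (window t n -` B \<inter> space P) = emeasure (marg n P) B" for t
    by (subst distr_window[of n t, symmetric], subst emeasure_distr[OF window_meas B]) simp
  from this[of 0] this[of 1] have eq: "emeasure P {x. \<forall>j\<in>J. x j \<in> A j} = emeasure P {x. \<forall>j\<in>J. x (Suc j) \<in> A j}"
    by (simp add: vimage_def wB P_space)
  have "E = window 0 n -` B \<inter> space P" by (auto simp: E wB P_space)
  then have "E \<in> sets P" using measurable_sets[OF window_meas B] by simp
  then have "emeasure (distr P P shift) E = emeasure P (shift -` E \<inter> space P)" by (rule emeasure_distr[OF shift_meas])
  also have "shift -` E \<inter> space P = {x. \<forall>j\<in>J. x (Suc j) \<in> A j}" by (auto simp: E P_space shift_def)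
  also have "emeasure P \<dots> = emeasure P {x. \<forall>j\<in>J. x j \<in> A j}" by (rule eq[symmetric])
  also have "{x. \<forall>j\<in>J. x j \<in> A j} = E" using E by blast
  finally show "emeasure (distr P P shift) (prod_emb UNIV (\<lambda>_. borel) J (Pi\<^sub>E J A)) =
    emeasure P (prod_emb UNIV (\<lambda>_. borel) J (Pi\<^sub>E J A))" by (simp add: E_def)
qed

lemma mps_shift: "measure_preserving_system P shift"
  by unfold_locales (auto simp: shift_pres)

lemma distr_shift_pow: "distr P P (shift ^^ n) = P"
proof (induction n)
  case 0 show ?case by (simp add: id_def)
next
  case (Suc n)
  have m: "shift ^^ n \<in> measurable P P"
    by (rule measure_preserving_system.T_pow_meas[OF mps_shift])
  have "distr P P (shift ^^ Suc n) = distr (distr P P (shift ^^ n)) P shift"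
    by (subst distr_distr[OF shift_meas m]) (simp add: o_def)
  then show ?case by (simp only: Suc shift_pres)
qed

lemma mps_shift_pow: "measure_preserving_system P (shift ^^ n)"
  by unfold_locales (auto simp: distr_shift_pow measure_preserving_system.T_pow_meas[OF mps_shift])

text \<open>\<open>m\<close> is fixed and \<open>L\<close> grows, so each of the m segments is long,
  and segment s is a difference of two Birkhoff sums for the m-th power of the shift, started at
  phase s.\<close>

lemma ergodic_windows:
  fixes \<phi> :: "(nat \<Rightarrow> 'a) \<Rightarrow> real"
  assumes erg: "ergodic_proc P" and m: "m > 0" and \<delta>: "\<delta> > 0"
    and \<phi>[measurable]: "\<phi> \<in> borel_measurable (blk_space m borel)"
    and bd: "\<And>z. z \<in> space (blk_space m borel) \<Longrightarrow> \<bar>\<phi> z\<bar> \<le> K"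
  shows "AE x in P. \<forall>\<^sub>F L in sequentially. (\<Sum>i<m*L. \<phi> (window (i * m + i div L) m x))
           \<le> real (m * L) * ((\<integral>z. \<phi> z \<partial>marg m P) + \<delta>)"
proof -
  define g where "g x = \<phi> (window 0 m x)" for x
  define A where "A k s x = (\<Sum>j<k. g ((shift ^^ (s + m * j)) x))" for k s x
  let ?e = "\<integral>z. \<phi> z \<partial>marg m P"
  interpret T: measure_preserving_system P shift by (rule mps_shift)
  interpret S: measure_preserving_system P "shift ^^ m" by (rule mps_shift_pow)
  have gm[measurable]: "g \<in> borel_measurable P" unfolding g_def[abs_def] by measurable
  have gbd: "\<bar>g x\<bar> \<le> K" for x
    unfolding g_def by (rule bd) (use measurable_space[OF window_meas] in \<open>simp add: P_space\<close>)
  have eg: "expectation g = ?e" unfolding g_def by (rule integral_window) measurable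
  have 1: "AE x in P. limsup (\<lambda>k. ereal (T.avg g k x)) \<le> ereal ?e"
    unfolding eg[symmetric]
  proof (rule T.birkhoff_ergodic_le[OF gm gbd])
    fix E assume "E \<in> sets P" "{x \<in> space P. shift x \<in> E} = E"
    then show "prob E = 0 \<or> prob E = 1" using erg unfolding ergodic_proc_def by blast
  qed
  \<comment> \<open>For the m-th power of the shift each phase has some limit, which may depend on
    x.\<close>
  have "AE x in P. convergent (\<lambda>k. S.avg (\<lambda>x. g ((shift ^^ s) x)) k x)" for s
    by (rule S.birkhoff_convergent[OF measurable_compose[OF T.T_pow_meas gm] gbd])
  moreover have avgS: "S.avg (\<lambda>x. g ((shift ^^ s) x)) k x = A k s x / real k" for s k x
    by (simp add: S.avg_def A_def funpow_mult funpow_add)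
  ultimately have 2: "AE x in P. \<forall>s. convergent (\<lambda>k. A k s x / real k)"
    by (simp add: AE_all_countable)
  from 1 2 show ?thesis
  proof eventually_elim
    fix x assume ls: "limsup (\<lambda>k. ereal (T.avg g k x)) \<le> ereal ?e"
      and cv: "\<forall>s. convergent (\<lambda>k. A k s x / real k)"
    define c where "c s = lim (\<lambda>k. A k s x / real k)" for s
    have c: "(\<lambda>k. A k s x / real k) \<longlonglongrightarrow> c s" for s
      using cv by (simp add: c_def convergent_LIMSEQ_iff[symmetric])
    \<comment> \<open>Interleaving the m phases recovers the plain Birkhoff sum of length m
      k.\<close>
    have sumA: "(\<Sum>s<m. A k s x) = (\<Sum>i<m*k. g ((shift ^^ i) x))" for k
    proof -
      have "(\<Sum>s<m. A k s x) = (\<Sum>j<k. \<Sum>s<m. g ((shift ^^ (s + m * j)) x))"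
        unfolding A_def by (rule sum.swap)
      also have "\<dots> = (\<Sum>j<k. \<Sum>i=j*m..<j*m+m. g ((shift ^^ i) x))"
      proof (rule sum.cong[OF refl])
        fix j
        show "(\<Sum>s<m. g ((shift ^^ (s + m * j)) x)) = (\<Sum>i=j*m..<j*m+m. g ((shift ^^ i) x))"
          by (rule sum.reindex_bij_witness[where i="\<lambda>i. i - j*m" and j="\<lambda>s. s + j*m"])
            (auto simp: mult.commute[of m j])
      qed
      also have "\<dots> = (\<Sum>i<k*m. g ((shift ^^ i) x))" by (rule sum.nat_group)
      finally show ?thesis by (simp add: mult.commute)
    qed
    have csum: "(\<Sum>s<m. c s) \<le> real m * ?e"
    proof -
      have "(\<lambda>k. \<Sum>s<m. A k s x / real k) \<longlonglongrightarrow> (\<Sum>s<m. c s)" by (intro tendsto_sum c)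
      moreover have "(\<Sum>s<m. A k s x / real k) = real m * T.avg g (m * k) x" for k
        using m by (cases "k = 0") (auto simp: T.avg_def sumA sum_divide_distrib[symmetric])
      ultimately have lim: "(\<lambda>k. T.avg g (m * k) x) \<longlonglongrightarrow> (\<Sum>s<m. c s) / real m"
        using m tendsto_divide[of "\<lambda>k. real m * T.avg g (m * k) x" _ sequentially "\<lambda>_. real m" "real m"] by simp
      then have "(\<lambda>k. ereal (T.avg g (m * k) x)) \<longlonglongrightarrow> ereal ((\<Sum>s<m. c s) / real m)"
        by (rule tendsto_ereal)
      then have "ereal ((\<Sum>s<m. c s) / real m) = limsup ((\<lambda>k. ereal (T.avg g k x)) \<circ> (\<lambda>k. m * k))"
        unfolding o_def by (rule lim_imp_Limsup[symmetric, rotated]) simp_all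
      also have "\<dots> \<le> limsup (\<lambda>k. ereal (T.avg g k x))"
        by (rule limsup_subseq_mono) (use m in \<open>auto simp: strict_mono_def\<close>)
      finally have "(\<Sum>s<m. c s) / real m \<le> ?e" using ls by (metis ereal_less_eq(3) order_trans)
      then show ?thesis using m by (simp add: field_simps)
    qed
    \<comment> \<open>Normalised by L, a sum over s L blocks tends to s times the phase limit. The
      case s = 0 is separate because s L then does not tend to infinity.\<close>
    have cs: "(\<lambda>L. A (s * L) s' x / real L) \<longlonglongrightarrow> real s * c s'" for s s'
    proof (cases "s = 0")
      case False
      have "filterlim (\<lambda>L. s * L) at_top sequentially"
        by (rule filterlim_subseq) (use False in \<open>auto simp: strict_mono_def\<close>)
      from tendsto_mult_left[OF filterlim_compose[OF c[of s'] this], of "real s"] show ?thesis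
        using False by simp
    qed (simp add: A_def)
    \<comment> \<open>On the grid of phase s, segment s consists of the blocks numbered s L to (s +
      1) L - 1.\<close>
    have seg: "(\<Sum>i<m*L. \<phi> (window (i * m + i div L) m x)) = (\<Sum>s<m. A (Suc s * L) s x - A (s * L) s x)"
      if L: "L > 0" for L
    proof -
      have "(\<Sum>i<m*L. \<phi> (window (i * m + i div L) m x))
          = (\<Sum>s<m. \<Sum>i=s*L..<s*L+L. \<phi> (window (i * m + i div L) m x))"
        by (rule sum.nat_group[symmetric])
      also have "\<dots> = (\<Sum>s<m. \<Sum>i=s*L..<s*L+L. g ((shift ^^ (s + m * i)) x))"
      proof (intro sum.cong refl)
        fix s i assume "i \<in> {s*L..<s*L+L}"
        then have "i div L = s" using L by (intro div_nat_eqI) (auto simp: mult.commute)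
        then show "\<phi> (window (i * m + i div L) m x) = g ((shift ^^ (s + m * i)) x)"
          by (simp add: g_def window_shift[of "s + i * m"] add.commute mult.commute)
      qed
      also have "\<dots> = (\<Sum>s<m. A (Suc s * L) s x - A (s * L) s x)"
      proof (intro sum.cong refl)
        fix s
        show "(\<Sum>i=s*L..<s*L+L. g ((shift ^^ (s + m * i)) x)) = A (Suc s * L) s x - A (s * L) s x"
          using sum.atLeastLessThan_concat[of 0 "s*L" "s*L+L" "\<lambda>i. g ((shift ^^ (s + m * i)) x)"]
          by (simp add: A_def lessThan_atLeast0 add.commute)
      qed
      finally show ?thesis .
    qed
    have "(\<lambda>L. \<Sum>s<m. A (Suc s * L) s x / real L - A (s * L) s x / real L)
        \<longlonglongrightarrow> (\<Sum>s<m. real (Suc s) * c s - real s * c s)"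
      by (intro tendsto_sum tendsto_diff cs)
    \<comment> \<open>The weights s + 1 and s differ by 1, so all phases count equally.\<close>
    also have "(\<Sum>s<m. real (Suc s) * c s - real s * c s) = (\<Sum>s<m. c s)"
      by (intro sum.cong refl) (simp add: algebra_simps)
    finally have "\<forall>\<^sub>F L in sequentially. (\<Sum>s<m. A (Suc s * L) s x / real L - A (s * L) s x / real L)
        < real m * ?e + real m * \<delta>"
      by (rule order_tendstoD) (use csum m \<delta> in \<open>auto intro: le_less_trans\<close>)
    then show "\<forall>\<^sub>F L in sequentially. (\<Sum>i<m*L. \<phi> (window (i * m + i div L) m x))
           \<le> real (m * L) * (?e + \<delta>)"
      using eventually_gt_at_top[of 0]
    proof eventually_elim
      fix L :: nat assume L: "L > 0" and lt: "(\<Sum>s<m. A (Suc s * L) s x / real L - A (s * L) s x / real L)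
        < real m * ?e + real m * \<delta>"
      have "(\<Sum>i<m*L. \<phi> (window (i * m + i div L) m x)) / real L
          = (\<Sum>s<m. A (Suc s * L) s x / real L - A (s * L) s x / real L)"
        by (subst seg[OF L]) (simp add: sum_divide_distrib diff_divide_distrib)
      with lt have "(\<Sum>i<m*L. \<phi> (window (i * m + i div L) m x)) / real L < real m * ?e + real m * \<delta>" by simp
      with L show "(\<Sum>i<m*L. \<phi> (window (i * m + i div L) m x)) \<le> real (m * L) * (?e + \<delta>)"
        by (simp add: field_simps)
    qed
  qed
qed

end

section \<open>Covering and products of densities\<close>

lemma borel_measurable_coordinate:
  "i \<in> I \<Longrightarrow> g \<in> borel_measurable (M i) \<Longrightarrow> (\<lambda>y. g (y i)) \<in> borel_measurable (PiM I M)"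
  by (rule measurable_compose[OF measurable_component_singleton])

text \<open>Every uncovered x is covered by a \<open>Q\<close>-fraction at least p of the y. By
  Fubini some single y covers at least the fraction p of the uncovered mass, so each choice
  multiplies that mass by at most 1 - p.\<close>

lemma greedy_cover:
  assumes P: "prob_space P" and Q: "prob_space Q"
    and G[measurable]: "G \<in> sets (P \<Otimes>\<^sub>M Q)" and A[measurable]: "A \<in> sets P"
    and p: "0 \<le> p" "p \<le> 1"
    and cov: "\<And>x. x \<in> A \<Longrightarrow> p \<le> measure Q {y\<in>space Q. (x, y) \<in> G}"
  shows "\<exists>Y. finite Y \<and> card Y \<le> N \<and> Y \<subseteq> space Q \<and>
     {x\<in>A. \<forall>y\<in>Y. (x, y) \<notin> G} \<in> sets P \<and> measure P {x\<in>A. \<forall>y\<in>Y. (x, y) \<notin> G} \<le> (1 - p) ^ N"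
proof (induction N)
  case 0
  interpret P: prob_space P by fact
  show ?case by (intro exI[of _ "{}"]) simp
next
  case (Suc N)
  interpret P: prob_space P by fact
  interpret Q: prob_space Q by fact
  interpret PQ: pair_sigma_finite P Q ..
  obtain Y where Y: "finite Y" "card Y \<le> N" "Y \<subseteq> space Q"
    and U[measurable]: "{x\<in>A. \<forall>y\<in>Y. (x, y) \<notin> G} \<in> sets P"
    and le: "measure P {x\<in>A. \<forall>y\<in>Y. (x, y) \<notin> G} \<le> (1 - p) ^ N"
    using Suc by blast
  define U where "U = {x\<in>A. \<forall>y\<in>Y. (x, y) \<notin> G}"
  note U = U[folded U_def] and le = le[folded U_def]
  have U_sub: "U \<subseteq> space P" using sets.sets_into_space[OF U] .
  \<comment> \<open>Restricting to the uncovered set makes \<open>h y\<close> the mass newly covered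
    by y.\<close>
  define H where "H = G \<inter> (U \<times> space Q)"
  have H: "H \<in> sets (P \<Otimes>\<^sub>M Q)" unfolding H_def using U G by auto
  have sec: "(\<lambda>x. (x, y)) -` H \<in> sets P" for y using H by (rule sets_Pair2)
  define h where "h y = measure P ((\<lambda>x. (x, y)) -` H)" for y
  have h_eq: "ennreal (h y) = emeasure P ((\<lambda>x. (x, y)) -` H)" for y
    by (simp add: h_def P.emeasure_eq_measure)
  have hm[measurable]: "h \<in> borel_measurable Q"
    unfolding h_def measure_def using PQ.measurable_emeasure_Pair2[OF H] by measurable
  have hint: "integrable Q h"
    by (rule Q.integrable_const_bound[where B=1]) (auto simp: h_def)
  have "ennreal (p * measure P U) = (\<integral>\<^sup>+x. ennreal p * indicator U x \<partial>P)"
    using U p by (simp add: nn_integral_cmult_indicator P.emeasure_eq_measure ennreal_mult)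
  also have "\<dots> \<le> (\<integral>\<^sup>+x. emeasure Q (Pair x -` H) \<partial>P)"
  proof (rule nn_integral_mono)
    fix x assume "x \<in> space P"
    show "ennreal p * indicator U x \<le> emeasure Q (Pair x -` H)"
    proof (cases "x \<in> U")
      case True
      then have "Pair x -` H = {y\<in>space Q. (x, y) \<in> G}"
        using sets.sets_into_space[OF G] by (auto simp: H_def space_pair_measure)
      then show ?thesis using cov[of x] True
        by (simp add: Q.emeasure_eq_measure U_def ennreal_leI)
    qed simp
  qed
  also have "\<dots> = (\<integral>\<^sup>+y. ennreal (h y) \<partial>Q)"
    by (simp add: h_eq PQ.emeasure_pair_measure_alt2[OF H, symmetric] Q.emeasure_pair_measure_alt[OF H])
  also have "\<dots> = ennreal (integral\<^sup>L Q h)"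
    by (rule nn_integral_eq_integral[OF hint]) (simp add: h_def)
  finally have ge: "p * measure P U \<le> integral\<^sup>L Q h"
    by (rule ennreal_le_iff[THEN iffD1, rotated]) (auto simp: h_def)
  have "\<exists>y\<in>space Q. p * measure P U \<le> h y"
  proof (rule ccontr)
    assume "\<not> ?thesis"
    then have "integral\<^sup>L Q h < p * measure P U"
      by (intro Q.expectation_less hint AE_I2) auto
    with ge show False by simp
  qed
  then obtain y where y: "y \<in> space Q" "p * measure P U \<le> h y" by blast
  have eq: "{x\<in>A. \<forall>y\<in>insert y Y. (x, y) \<notin> G} = U - (\<lambda>x. (x, y)) -` H"
    using y by (auto simp: U_def H_def)
  have "measure P (U - (\<lambda>x. (x, y)) -` H) = measure P U - h y"
    unfolding h_def by (rule P.finite_measure_Diff[OF U sec]) (auto simp: H_def)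
  also have "\<dots> \<le> (1 - p) * measure P U" using y by (simp add: algebra_simps)
  also have "\<dots> \<le> (1 - p) ^ Suc N"
    using le p by (simp add: mult_left_mono)
  finally have "measure P {x\<in>A. \<forall>y\<in>insert y Y. (x, y) \<notin> G} \<le> (1 - p) ^ Suc N"
    by (simp only: eq)
  moreover have "card (insert y Y) \<le> Suc N" using Y card_insert_le_m1[of "Suc N" Y y] by (simp add: card_insert_if)
  ultimately show ?case
    using Y y sets.Diff[OF U sec[of y]] eq by (intro exI[of _ "insert y Y"]) auto
qed

section \<open>Chebyshev bounds and change of measure for product laws\<close>

text \<open>Expand the square and write each \<open>h i (y i) * h j (y j)\<close> as a product over
  all coordinates; the integral then factorises, and the mixed terms vanish because the means
  do.\<close>

lemma (in product_prob_space) sum_second_moment: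
  fixes h :: "'i \<Rightarrow> 'a \<Rightarrow> real"
  assumes I: "finite I" and int: "\<And>i. i \<in> I \<Longrightarrow> integrable (M i) (h i)"
    and int2: "\<And>i. i \<in> I \<Longrightarrow> integrable (M i) (\<lambda>y. (h i y)\<^sup>2)"
    and mean: "\<And>i. i \<in> I \<Longrightarrow> (\<integral>y. h i y \<partial>M i) = 0"
  shows "integrable (PiM I M) (\<lambda>y. (\<Sum>i\<in>I. h i (y i))\<^sup>2)"
    and "(\<integral>y. (\<Sum>i\<in>I. h i (y i))\<^sup>2 \<partial>PiM I M) = (\<Sum>i\<in>I. \<integral>y. (h i y)\<^sup>2 \<partial>M i)"
proof -
  \<comment> \<open>The factor at coordinate l is \<open>h i\<close> if l = i, \<open>h j\<close> if
    l = j, the product of both if i = j = l, and 1 otherwise.\<close>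
  define F where "F i j l y = (if l = i then h i y else 1) * (if l = j then h j y else 1)" for i j l y
  have prodF: "(\<Prod>l\<in>I. F i j l (y l)) = h i (y i) * h j (y j)" if "i \<in> I" "j \<in> I" for i j y
    using that I by (simp add: F_def prod.distrib prod.delta)
  have intF: "integrable (M l) (F i j l)" if "i \<in> I" "j \<in> I" for i j l
  proof -
    interpret M: prob_space "M l" by (rule prob_space)
    show ?thesis using int[of l] int2[of l] that
      by (cases "l = i"; cases "l = j") (auto simp: F_def[abs_def] power2_eq_square)
  qed
  have eq: "(\<Sum>i\<in>I. h i (y i))\<^sup>2 = (\<Sum>i\<in>I. \<Sum>j\<in>I. \<Prod>l\<in>I. F i j l (y l))" for y
    by (simp add: power2_eq_square sum_product prodF)
  show "integrable (PiM I M) (\<lambda>y. (\<Sum>i\<in>I. h i (y i))\<^sup>2)"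
    unfolding eq by (intro Bochner_Integration.integrable_sum product_integrable_prod I intF)
  have "(\<integral>y. (\<Sum>i\<in>I. h i (y i))\<^sup>2 \<partial>PiM I M) = (\<Sum>i\<in>I. \<Sum>j\<in>I. \<integral>y. (\<Prod>l\<in>I. F i j l (y l)) \<partial>PiM I M)"
    unfolding eq
    apply (rule trans[OF Bochner_Integration.integral_sum])
     apply (intro Bochner_Integration.integrable_sum product_integrable_prod I intF; assumption)
    apply (rule sum.cong[OF refl])
    apply (rule Bochner_Integration.integral_sum)
    apply (intro product_integrable_prod I intF; assumption)
    done
  also have "\<dots> = (\<Sum>i\<in>I. \<Sum>j\<in>I. \<Prod>l\<in>I. \<integral>y. F i j l y \<partial>M l)"
    by (intro sum.cong refl product_integral_prod I intF)
  also have "\<dots> = (\<Sum>i\<in>I. \<Sum>j\<in>I. if j = i then \<integral>y. (h i y)\<^sup>2 \<partial>M i else 0)"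
  proof (intro sum.cong refl)
    fix i j assume ij: "i \<in> I" "j \<in> I"
    show "(\<Prod>l\<in>I. \<integral>y. F i j l y \<partial>M l) = (if j = i then \<integral>y. (h i y)\<^sup>2 \<partial>M i else 0)"
    proof (cases "j = i")
      case True
      have "(\<integral>y. F i j l y \<partial>M l) = (if l = i then \<integral>y. (h i y)\<^sup>2 \<partial>M i else 1)" for l
        using True prob_space.prob_space[OF prob_space, of l] by (simp add: F_def power2_eq_square)
      then show ?thesis using True ij I by (simp add: prod.delta)
    next
      case False
      then have "(\<integral>y. F i j i y \<partial>M i) = 0" using mean ij by (simp add: F_def)
      then show ?thesis using False ij I by (auto intro!: prod_zero)
    qed
  qed
  also have "\<dots> = (\<Sum>i\<in>I. \<integral>y. (h i y)\<^sup>2 \<partial>M i)" using I by simp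
  finally show "(\<integral>y. (\<Sum>i\<in>I. h i (y i))\<^sup>2 \<partial>PiM I M) = (\<Sum>i\<in>I. \<integral>y. (h i y)\<^sup>2 \<partial>M i)" .
qed

text \<open>Chebyshev's inequality for independent summands with different laws. A bound on the raw
  second moments is enough, since centring only lowers them.\<close>

lemma (in product_prob_space) weak_law_upper:
  fixes h :: "'i \<Rightarrow> 'a \<Rightarrow> real"
  assumes I: "finite I" and hm[measurable]: "\<And>i. h i \<in> borel_measurable (M i)"
    and int2: "\<And>i. i \<in> I \<Longrightarrow> integrable (M i) (\<lambda>y. (h i y)\<^sup>2)"
    and bd: "\<And>i. i \<in> I \<Longrightarrow> (\<integral>y. (h i y)\<^sup>2 \<partial>M i) \<le> C" and a: "a > 0"
  shows "measure (PiM I M) {y\<in>space (PiM I M). (\<Sum>i\<in>I. h i (y i)) \<ge> (\<Sum>i\<in>I. \<integral>y. h i y \<partial>M i) + a}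
      \<le> real (card I) * C / a\<^sup>2"
proof -
  define e where "e i = (\<integral>y. h i y \<partial>M i)" for i
  have int: "integrable (M i) (h i)" if "i \<in> I" for i
    by (rule finite_measure.square_integrable_imp_integrable[OF prob_space.finite_measure[OF prob_space]])
      (use int2[OF that] in auto)
  have c2: "integrable (M i) (\<lambda>y. (h i y - e i)\<^sup>2) \<and> (\<integral>y. (h i y - e i)\<^sup>2 \<partial>M i) \<le> C"
    if i: "i \<in> I" for i
  proof
    interpret M: prob_space "M i" by (rule prob_space)
    have eq: "(h i y - e i)\<^sup>2 = (h i y)\<^sup>2 - 2 * e i * h i y + (e i)\<^sup>2" for y
      by (simp add: power2_eq_square algebra_simps)
    show "integrable (M i) (\<lambda>y. (h i y - e i)\<^sup>2)" unfolding eq using int[OF i] int2[OF i] by auto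
    have "(\<integral>y. (h i y - e i)\<^sup>2 \<partial>M i) = (\<integral>y. (h i y)\<^sup>2 \<partial>M i) - (e i)\<^sup>2"
      unfolding eq using int[OF i] int2[OF i] by (simp add: M.prob_space e_def power2_eq_square)
    then show "(\<integral>y. (h i y - e i)\<^sup>2 \<partial>M i) \<le> C" using bd[OF i] zero_le_power2[of "e i"] by linarith
  qed
  let ?g = "\<lambda>y. \<Sum>i\<in>I. h i (y i) - e i"
  have gm[measurable]: "?g \<in> borel_measurable (PiM I M)"
    by (intro borel_measurable_sum borel_measurable_diff borel_measurable_const
        borel_measurable_coordinate hm)
  have g2: "integrable (PiM I M) (\<lambda>y. (?g y)\<^sup>2)"
    and g2': "(\<integral>y. (?g y)\<^sup>2 \<partial>PiM I M) = (\<Sum>i\<in>I. \<integral>y. (h i y - e i)\<^sup>2 \<partial>M i)"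
    using sum_second_moment[OF I, of "\<lambda>i y. h i y - e i"] c2 int prob_space.prob_space[OF prob_space]
    by (simp_all add: e_def)
  have sub: "{y\<in>space (PiM I M). (\<Sum>i\<in>I. h i (y i)) \<ge> (\<Sum>i\<in>I. \<integral>y. h i y \<partial>M i) + a}
      \<subseteq> {y\<in>space (PiM I M). \<bar>?g y\<bar> \<ge> a}"
    by (auto simp: sum_subtractf e_def)
  have "measure (PiM I M) {y\<in>space (PiM I M). (\<Sum>i\<in>I. h i (y i)) \<ge> (\<Sum>i\<in>I. \<integral>y. h i y \<partial>M i) + a}
      \<le> measure (PiM I M) {y\<in>space (PiM I M). \<bar>?g y\<bar> \<ge> a}"
    by (rule P.finite_measure_mono[OF sub]) measurable
  also have "\<dots> \<le> (\<integral>y. (?g y)\<^sup>2 \<partial>PiM I M) / a\<^sup>2"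
    by (rule second_moment_method[OF gm g2 a])
  also have "\<dots> \<le> real (card I) * C / a\<^sup>2"
    unfolding g2' using c2 sum_bounded_above[of I "\<lambda>i. \<integral>y. (h i y - e i)\<^sup>2 \<partial>M i" C]
    by (intro divide_right_mono) auto
  finally show ?thesis .
qed

text \<open>Checked on rectangles, where both sides factorise over the coordinates.\<close>

lemma density_PiM:
  assumes Q: "prob_space Q" and I: "finite I"
    and f[measurable]: "\<And>i. f i \<in> borel_measurable Q"
    and f1: "\<And>i. (\<integral>\<^sup>+y. f i y \<partial>Q) = 1"
  shows "density (PiM I (\<lambda>_. Q)) (\<lambda>y. \<Prod>i\<in>I. f i (y i)) = PiM I (\<lambda>i. density Q (f i))"
proof -
  interpret Q: prob_space Q by fact
  have pV: "prob_space (density Q (f i))" for i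
    by (rule prob_spaceI) (simp add: emeasure_density f1 cong: nn_integral_cong)
  interpret V: product_sigma_finite "\<lambda>i. density Q (f i)"
    using pV by (auto simp: product_sigma_finite_def intro: prob_space_imp_sigma_finite)
  interpret QI: product_sigma_finite "\<lambda>_. Q"
    by (simp add: product_sigma_finite_def Q.sigma_finite_measure_axioms)
  show ?thesis
  proof (rule V.PiM_eqI[OF I])
    show "sets (density (PiM I (\<lambda>_. Q)) (\<lambda>y. \<Prod>i\<in>I. f i (y i))) = sets (PiM I (\<lambda>i. density Q (f i)))"
      by (auto intro!: sets_PiM_cong)
    fix A assume "\<And>i. i \<in> I \<Longrightarrow> A i \<in> sets (density Q (f i))"
    then have A: "\<And>i. i \<in> I \<Longrightarrow> A i \<in> sets Q" by simp
    have fm: "(\<lambda>y. \<Prod>i\<in>I. f i (y i)) \<in> borel_measurable (PiM I (\<lambda>_. Q))"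
      by (intro borel_measurable_prod_ennreal borel_measurable_coordinate f)
    have "emeasure (density (PiM I (\<lambda>_. Q)) (\<lambda>y. \<Prod>i\<in>I. f i (y i))) (Pi\<^sub>E I A)
        = (\<integral>\<^sup>+y. (\<Prod>i\<in>I. f i (y i)) * indicator (Pi\<^sub>E I A) y \<partial>PiM I (\<lambda>_. Q))"
      by (rule emeasure_density[OF fm]) (use A I in \<open>auto intro!: sets_PiM_I_finite\<close>)
    also have "\<dots> = (\<integral>\<^sup>+y. (\<Prod>i\<in>I. f i (y i) * indicator (A i) (y i)) \<partial>PiM I (\<lambda>_. Q))"
    proof (rule nn_integral_cong)
      fix y assume y: "y \<in> space (PiM I (\<lambda>_. Q))"
      have "indicator (Pi\<^sub>E I A) y = (\<Prod>i\<in>I. indicator (A i) (y i) :: ennreal)"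
        using y I by (auto simp: indicator_def space_PiM PiE_def Pi_def intro!: prod_zero)
      then show "(\<Prod>i\<in>I. f i (y i)) * indicator (Pi\<^sub>E I A) y = (\<Prod>i\<in>I. f i (y i) * indicator (A i) (y i))"
        by (simp add: prod.distrib)
    qed
    also have "\<dots> = (\<Prod>i\<in>I. \<integral>\<^sup>+y. f i y * indicator (A i) y \<partial>Q)"
      by (rule QI.product_nn_integral_prod[OF I]) (use A in auto)
    also have "\<dots> = (\<Prod>i\<in>I. emeasure (density Q (f i)) (A i))"
      by (intro prod.cong refl emeasure_density[symmetric] f A)
    finally show "emeasure (density (PiM I (\<lambda>_. Q)) (\<lambda>y. \<Prod>i\<in>I. f i (y i))) (Pi\<^sub>E I A)
        = (\<Prod>i\<in>I. emeasure (density Q (f i)) (A i))" .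
  qed
qed

text \<open>Change of measure. Under the product law with densities \<open>f i\<close>, three
  Chebyshev failures of probability at most 1/6 each leave a set of mass at least 1/2. The third
  event caps the log-likelihood on that set by its mean plus k \<delta>, so the set has
  \<open>Q\<close>-mass at least half the reciprocal of that cap's exponential.\<close>

lemma product_ball_lower_bound:
  fixes f u v :: "nat \<Rightarrow> 'y \<Rightarrow> real"
  assumes Q: "prob_space Q" and k: "k > 0" and \<delta>: "\<delta> > 0" and kC: "6 * C \<le> real k * \<delta>\<^sup>2"
    and f[measurable]: "\<And>i. f i \<in> borel_measurable Q" and u[measurable]: "\<And>i. u i \<in> borel_measurable Q"
    and v[measurable]: "\<And>i. v i \<in> borel_measurable Q"
    and f0: "\<And>i y. y \<in> space Q \<Longrightarrow> 0 \<le> f i y" and f1: "\<And>i. (\<integral>\<^sup>+y. ennreal (f i y) \<partial>Q) = 1"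
    and iu: "\<And>i. integrable Q (\<lambda>y. f i y * (u i y)\<^sup>2)" "\<And>i. (\<integral>y. f i y * (u i y)\<^sup>2 \<partial>Q) \<le> C"
    and iv: "\<And>i. integrable Q (\<lambda>y. f i y * (v i y)\<^sup>2)" "\<And>i. (\<integral>y. f i y * (v i y)\<^sup>2 \<partial>Q) \<le> C"
    and iw: "\<And>i. integrable Q (\<lambda>y. f i y * (ln (f i y))\<^sup>2)" "\<And>i. (\<integral>y. f i y * (ln (f i y))\<^sup>2 \<partial>Q) \<le> C"
  shows "exp (- ((\<Sum>i<k. \<integral>y. f i y * ln (f i y) \<partial>Q) + real k * \<delta>)) / 2
    \<le> measure (PiM {..<k} (\<lambda>_. Q)) {y\<in>space (PiM {..<k} (\<lambda>_. Q)).
        (\<Sum>i<k. u i (y i)) \<le> (\<Sum>i<k. \<integral>y. f i y * u i y \<partial>Q) + real k * \<delta> \<and>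
        (\<Sum>i<k. v i (y i)) \<le> (\<Sum>i<k. \<integral>y. f i y * v i y \<partial>Q) + real k * \<delta>}"
proof -
  interpret Q: prob_space Q by fact
  define D where "D i = density Q (\<lambda>y. ennreal (f i y))" for i
  have pD: "prob_space (D i)" for i
    by (rule prob_spaceI) (simp add: D_def emeasure_density f1 cong: nn_integral_cong)
  interpret V: product_prob_space D "{..<k}"
    using pD by (auto simp: product_prob_space_def product_sigma_finite_def product_prob_space_axioms_def
      intro: prob_space_imp_sigma_finite)
  interpret QI: product_prob_space "\<lambda>_. Q" "{..<k}"
    by (simp add: product_prob_space_def product_sigma_finite_def product_prob_space_axioms_def Q
      Q.sigma_finite_measure_axioms)
  let ?V = "PiM {..<k} D" and ?Q = "PiM {..<k} (\<lambda>_. Q)"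
  have V_eq: "density ?Q (\<lambda>y. \<Prod>i<k. ennreal (f i (y i))) = ?V"
    unfolding D_def by (rule density_PiM[OF Q]) (use f1 in auto)
  have spV: "space ?V = space ?Q" and setsV: "sets ?V = sets ?Q"
    unfolding V_eq[symmetric] by simp_all
  have intD: "(\<integral>y. h y \<partial>D i) = (\<integral>y. f i y * h y \<partial>Q)" if "h \<in> borel_measurable Q" for h :: "'y \<Rightarrow> real" and i
    unfolding D_def by (subst integral_density) (use that f0 in auto)
  have intbD: "integrable (D i) h \<longleftrightarrow> integrable Q (\<lambda>y. f i y * h y)" if "h \<in> borel_measurable Q" for h :: "'y \<Rightarrow> real" and i
    unfolding D_def by (subst integrable_density) (use that f0 in auto)
  define bad where "bad h = {y\<in>space ?Q. (\<Sum>i<k. h i (y i)) \<ge> (\<Sum>i<k. \<integral>y. f i y * h i y \<partial>Q) + real k * \<delta>}"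
    for h :: "nat \<Rightarrow> 'y \<Rightarrow> real"
  have C0: "0 \<le> C"
    using Bochner_Integration.integral_nonneg[of Q "\<lambda>y. f 0 y * (u 0 y)\<^sup>2"] iu(2)[of 0] f0 by fastforce
  have bad: "bad h \<in> sets ?Q \<and> measure ?V (bad h) \<le> 1/6"
    if hm: "\<And>i. h i \<in> borel_measurable Q" and i1: "\<And>i. integrable Q (\<lambda>y. f i y * (h i y)\<^sup>2)"
      and i2: "\<And>i. (\<integral>y. f i y * (h i y)\<^sup>2 \<partial>Q) \<le> C" for h
  proof
    have [measurable]: "(\<lambda>y. \<Sum>i<k. h i (y i)) \<in> borel_measurable ?Q"
      by (intro borel_measurable_sum borel_measurable_coordinate hm)
    show "bad h \<in> sets ?Q" unfolding bad_def by measurable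
    have "measure ?V {y\<in>space ?V. (\<Sum>i<k. h i (y i)) \<ge> (\<Sum>i<k. \<integral>y. h i y \<partial>D i) + real k * \<delta>}
        \<le> real (card {..<k}) * C / (real k * \<delta>)\<^sup>2"
    proof (rule V.weak_law_upper)
      show "h i \<in> borel_measurable (D i)" for i using hm by (simp add: D_def)
      show "integrable (D i) (\<lambda>y. (h i y)\<^sup>2)" for i using i1 hm by (subst intbD) auto
      show "(\<integral>y. (h i y)\<^sup>2 \<partial>D i) \<le> C" for i using i2 hm by (subst intD) auto
    qed (use k \<delta> in auto)
    also have "{y\<in>space ?V. (\<Sum>i<k. h i (y i)) \<ge> (\<Sum>i<k. \<integral>y. h i y \<partial>D i) + real k * \<delta>} = bad h"
      by (simp add: bad_def spV intD[OF hm])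
    \<comment> \<open>The left side is C / (k \<delta>^2); the hypothesis 6 C \<le> k \<delta>^2 is
      tuned to this.\<close>
    also have "real (card {..<k}) * C / (real k * \<delta>)\<^sup>2 \<le> 1/6"
      using kC k \<delta> C0 by (simp add: power2_eq_square field_simps)
    finally show "measure ?V (bad h) \<le> 1/6" .
  qed
  define w where "w i y = ln (f i y)" for i y
  have bu: "bad u \<in> sets ?Q" "measure ?V (bad u) \<le> 1/6" using bad[OF u iu] by auto
  have bv: "bad v \<in> sets ?Q" "measure ?V (bad v) \<le> 1/6" using bad[OF v iv] by auto
  have bw: "bad w \<in> sets ?Q" "measure ?V (bad w) \<le> 1/6" using bad[of w] iw unfolding w_def by auto
  define S where "S = space ?Q - (bad u \<union> bad v \<union> bad w)"
  have S: "S \<in> sets ?Q" unfolding S_def using bu bv bw by auto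
  have "measure ?V S = 1 - measure ?V (bad u \<union> bad v \<union> bad w)"
    unfolding S_def spV[symmetric] by (rule V.P.prob_compl) (use bu bv bw setsV in auto)
  moreover have "measure ?V (bad u \<union> bad v \<union> bad w) \<le> measure ?V (bad u) + measure ?V (bad v) + measure ?V (bad w)"
    by (rule order_trans[OF measure_Un_le add_right_mono[OF measure_Un_le]]) (use bu bv bw setsV in auto)
  ultimately have VS: "1/2 \<le> measure ?V S" using bu bv bw by linarith
  let ?c = "(\<Sum>i<k. \<integral>y. f i y * ln (f i y) \<partial>Q) + real k * \<delta>"
  have "emeasure ?V S = (\<integral>\<^sup>+y. (\<Prod>i<k. ennreal (f i (y i))) * indicator S y \<partial>?Q)"
    unfolding V_eq[symmetric]
    by (rule emeasure_density[OF _ S])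
      (intro borel_measurable_prod_ennreal borel_measurable_coordinate measurable_compose[OF f measurable_ennreal])
  also have "\<dots> \<le> (\<integral>\<^sup>+y. ennreal (exp ?c) * indicator S y \<partial>?Q)"
  proof (rule nn_integral_mono)
    fix y assume y: "y \<in> space ?Q"
    show "(\<Prod>i<k. ennreal (f i (y i))) * indicator S y \<le> ennreal (exp ?c) * indicator S y"
    proof (cases "y \<in> S")
      case True
      have yi: "i < k \<Longrightarrow> 0 \<le> f i (y i)" for i using y f0 by (auto simp: space_PiM)
      have "(\<Prod>i<k. f i (y i)) \<le> exp ?c"
      \<comment> \<open>A vanishing factor makes the product 0, a case in which the sum of
        logarithms says nothing about it.\<close>
      proof (cases "\<forall>i<k. f i (y i) \<noteq> 0")
        case True
        then have "(\<Prod>i<k. f i (y i)) = (\<Prod>i<k. exp (w i (y i)))"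
          using yi by (intro prod.cong) (auto simp: w_def order.order_iff_strict)
        also have "\<dots> = exp (\<Sum>i<k. w i (y i))" by (simp add: exp_sum)
        also have "\<dots> \<le> exp ?c" using \<open>y \<in> S\<close> y by (simp add: S_def bad_def w_def)
        finally show ?thesis .
      next
        case False
        then have "(\<Prod>i<k. f i (y i)) = 0" by (auto intro!: prod_zero)
        then show ?thesis by (metis exp_ge_zero)
      qed
      then have "(\<Prod>i<k. ennreal (f i (y i))) \<le> ennreal (exp ?c)"
        by (subst prod_ennreal) (use yi in \<open>auto intro: ennreal_leI\<close>)
      then show ?thesis using True by simp
    qed simp
  qed
  also have "\<dots> = ennreal (exp ?c * measure ?Q S)"
    using S by (simp add: nn_integral_cmult_indicator QI.P.emeasure_eq_measure ennreal_mult)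
  finally have "measure ?V S \<le> exp ?c * measure ?Q S"
    by (simp add: V.P.emeasure_eq_measure)
  with VS have "1/2 \<le> exp ?c * measure ?Q S" by linarith
  then have "exp (- ?c) * (1/2) \<le> exp (- ?c) * (exp ?c * measure ?Q S)" by (rule mult_left_mono) simp
  also have "exp (- ?c) * (exp ?c * measure ?Q S) = measure ?Q S"
    unfolding mult.assoc[symmetric] exp_add[symmetric] by simp
  finally have "exp (- ?c) / 2 \<le> measure ?Q S" by (simp only: mult_1_right times_divide_eq_right)
  also have "\<dots> \<le> measure ?Q {y\<in>space ?Q.
        (\<Sum>i<k. u i (y i)) \<le> (\<Sum>i<k. \<integral>y. f i y * u i y \<partial>Q) + real k * \<delta> \<and>
        (\<Sum>i<k. v i (y i)) \<le> (\<Sum>i<k. \<integral>y. f i y * v i y \<partial>Q) + real k * \<delta>}"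
  proof (rule QI.P.finite_measure_mono)
    have [measurable]: "(\<lambda>y. \<Sum>i<k. u i (y i)) \<in> borel_measurable ?Q" "(\<lambda>y. \<Sum>i<k. v i (y i)) \<in> borel_measurable ?Q"
      by (intro borel_measurable_sum borel_measurable_coordinate u v; simp)+
    show "{y\<in>space ?Q.
        (\<Sum>i<k. u i (y i)) \<le> (\<Sum>i<k. \<integral>y. f i y * u i y \<partial>Q) + real k * \<delta> \<and>
        (\<Sum>i<k. v i (y i)) \<le> (\<Sum>i<k. \<integral>y. f i y * v i y \<partial>Q) + real k * \<delta>} \<in> sets ?Q"
      by measurable
  qed (auto simp: S_def bad_def)
  finally show ?thesis .
qed

section \<open>Relative entropy and densities\<close>

text \<open>Tangent line of the convex function t ln t at t = 1. Integrated against a probability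
  density it gives nonnegativity of relative entropy.\<close>

lemma x_ln_x_ge: "0 \<le> t \<Longrightarrow> t - 1 \<le> t * ln (t::real)"
proof (cases "t = 0")
  case False
  assume "0 \<le> t"
  with False have t: "t > 0" by simp
  have "ln (1 / t) \<le> 1 / t - 1" by (rule ln_le_minus_one) (use t in simp)
  then have "t * (- ln t) \<le> t * (1 / t - 1)" using t by (intro mult_left_mono) (auto simp: ln_div)
  then show ?thesis using t by (simp add: algebra_simps)
qed simp

text \<open>Apply ln s \<le> s - 1 to s = 1 / sqrt t. The bound makes continuity of t ln t at 0
  quantitative.\<close>

lemma abs_x_ln_x_le_sqrt:
  fixes t :: real assumes t: "0 \<le> t" "t \<le> 1" shows "\<bar>t * ln t\<bar> \<le> 2 * sqrt t"
proof (cases "t = 0")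
  case False
  with t have t0: "t > 0" by simp
  have "ln (1 / sqrt t) \<le> 1 / sqrt t - 1" by (rule ln_le_minus_one) (use t0 in simp)
  then have "- ln t \<le> 2 / sqrt t" using t0 by (simp add: ln_div ln_sqrt)
  then have "t * (- ln t) \<le> t * (2 / sqrt t)" using t0 by (intro mult_left_mono) auto
  also have "t * (2 / sqrt t) = 2 * (t / sqrt t)" by simp
  also have "t / sqrt t = sqrt t" by (rule real_div_sqrt[OF t(1)])
  finally show ?thesis using t t0 by (simp add: abs_mult)
qed simp

lemma tendsto_x_ln_x:
  fixes s :: real assumes F: "(f \<longlongrightarrow> s) F" and f0: "\<And>k. 0 \<le> f k"
  shows "((\<lambda>k. f k * ln (f k)) \<longlongrightarrow> s * ln s) F"
proof (cases "s = 0")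
  case False then show ?thesis by (intro tendsto_mult tendsto_ln F)
next
  case True
  have "((\<lambda>k. 2 * sqrt (f k)) \<longlongrightarrow> 2 * sqrt s) F" by (intro tendsto_intros F)
  then have lim: "((\<lambda>k. 2 * sqrt (f k)) \<longlongrightarrow> 0) F" using True by simp
  have "eventually (\<lambda>k. f k < 1) F" by (rule order_tendstoD(2)[OF F]) (simp add: True)
  then have "((\<lambda>k. f k * ln (f k)) \<longlongrightarrow> 0) F"
    by (intro Lim_null_comparison[OF _ lim]) (auto elim!: eventually_mono intro!: abs_x_ln_x_le_sqrt f0)
  then show ?thesis using True by simp
qed

text \<open>The integrable majorant for dominated convergence: a truncated density t exceeds the
  original density s by at most 1.\<close>

lemma abs_x_ln_x_le:
  fixes s t :: real assumes t: "0 \<le> t" "t \<le> s + 1" and s: "0 \<le> s"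
  shows "\<bar>t * ln t\<bar> \<le> 3 + 2 * s + 2 * \<bar>s * ln s\<bar>"
proof (cases "t \<le> 1")
  case True
  then show ?thesis using abs_x_ln_x_le_sqrt[of t] t real_sqrt_le_1_iff[of t] s by linarith
next
  case False
  have ln2: "ln 2 \<le> (1::real)" using ln_le_minus_one[of 2] by simp
  have "\<bar>t * ln t\<bar> \<le> (s + 1) * ln (s + 1)"
    using False t by (simp add: abs_mult mult_mono)
  also have "\<dots> \<le> 3 + 2 * s + 2 * \<bar>s * ln s\<bar>"
  proof (cases "s \<le> 1")
    case True
    have "(s + 1) * ln (s + 1) \<le> 2 * 1" using True s ln_le_minus_one[of "s+1"] by (intro mult_mono) auto
    then show ?thesis using s by linarith
  next
    case False
    then have "(s + 1) * ln (s + 1) \<le> (2 * s) * ln (2 * s)" by (intro mult_mono) auto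
    also have "\<dots> = 2 * s * ln 2 + 2 * (s * ln s)" using False by (simp add: ln_mult algebra_simps)
    also have "\<dots> \<le> 2 * s * 1 + 2 * (s * ln s)" using ln2 False by (intro add_right_mono mult_left_mono) auto
    finally show ?thesis by linarith
  qed
  finally show ?thesis .
qed

text \<open>The preceding majorant with s the absolute value of \<open>B\<close>, as a uniform
  constant for densities bounded by \<open>B\<close>.\<close>

definition x_ln_x_bound :: "real \<Rightarrow> real" where
  "x_ln_x_bound B = 3 + 2 * \<bar>B\<bar> + 2 * \<bar>\<bar>B\<bar> * ln \<bar>B\<bar>\<bar>"

lemma abs_x_ln_x_le_bound: "0 \<le> t \<Longrightarrow> t \<le> B \<Longrightarrow> \<bar>t * ln t\<bar> \<le> x_ln_x_bound B"
  unfolding x_ln_x_bound_def by (rule abs_x_ln_x_le) auto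

text \<open>\<open>rel_entropy\<close> is a difference of two nonnegative integrals. The negative
  part is at most 1 because - t ln t \<le> 1 - t, so infinity minus infinity cannot occur, and
  finiteness is that of the positive part.\<close>

lemma rel_entropy_density:
  assumes N: "prob_space N" and f[measurable]: "f \<in> borel_measurable N" and f0: "\<And>x. 0 \<le> f x"
    and W: "W = density N (\<lambda>x. ennreal (f x))" and pW: "prob_space W"
  shows "rel_entropy W N < \<infinity> \<Longrightarrow> integrable N (\<lambda>x. f x * ln (f x))"
    and "integrable N (\<lambda>x. f x * ln (f x)) \<Longrightarrow> rel_entropy W N = ereal (\<integral>x. f x * ln (f x) \<partial>N)"
proof -
  interpret N: prob_space N by fact
  have AC: "absolutely_continuous N W" unfolding W by (rule absolutely_continuousI_density) simp
  have sets: "sets W = sets N" by (simp add: W)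
  have RN: "AE x in N. RN_deriv N W x = ennreal (f x)"
    using N.RN_deriv_unique[of "\<lambda>x. ennreal (f x)" W] W by (auto elim: eventually_mono)
  \<comment> \<open>c = 1 and c = -1 yield the positive and the negative part.\<close>
  have part: "(\<integral>\<^sup>+x. ennreal (c * ln (enn2real (RN_deriv N W x))) \<partial>W) = (\<integral>\<^sup>+x. ennreal (c * (f x * ln (f x))) \<partial>N)" for c
  proof -
    have "(\<integral>\<^sup>+x. ennreal (c * ln (enn2real (RN_deriv N W x))) \<partial>W)
       = (\<integral>\<^sup>+x. ennreal (f x) * ennreal (c * ln (enn2real (RN_deriv N W x))) \<partial>N)"
      by (subst (1) W, rule nn_integral_density) measurable
    also have "\<dots> = (\<integral>\<^sup>+x. ennreal (c * (f x * ln (f x))) \<partial>N)"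
      by (rule nn_integral_cong_AE) (use RN in \<open>auto elim!: eventually_mono simp: f0 ennreal_mult'[symmetric] ac_simps\<close>)
    finally show ?thesis .
  qed
  have neg: "(\<integral>\<^sup>+x. ennreal (- (f x * ln (f x))) \<partial>N) \<le> 1"
  proof -
    have "- (f x * ln (f x)) \<le> 1" for x using x_ln_x_ge[OF f0[of x]] f0[of x] by linarith
    then have "(\<integral>\<^sup>+x. ennreal (- (f x * ln (f x))) \<partial>N) \<le> (\<integral>\<^sup>+x. 1 \<partial>N)"
      by (intro nn_integral_mono) (simp add: ennreal_le_1)
    then show ?thesis by (simp add: N.emeasure_space_1)
  qed
  have eq: "rel_entropy W N = enn2ereal (\<integral>\<^sup>+x. ennreal (f x * ln (f x)) \<partial>N) - enn2ereal (\<integral>\<^sup>+x. ennreal (- (f x * ln (f x))) \<partial>N)"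
    using part[of 1] part[of "-1"] AC sets by (simp add: rel_entropy_def)
  have negfin: "(\<integral>\<^sup>+x. ennreal (- (f x * ln (f x))) \<partial>N) < \<infinity>"
    using neg by (auto simp: top_unique less_top[symmetric])
  show "integrable N (\<lambda>x. f x * ln (f x))" if "rel_entropy W N < \<infinity>"
  proof -
    have "(\<integral>\<^sup>+x. ennreal (f x * ln (f x)) \<partial>N) < \<infinity>"
    proof (rule ccontr)
      assume "\<not> ?thesis"
      then have "(\<integral>\<^sup>+x. ennreal (f x * ln (f x)) \<partial>N) = \<infinity>" by (simp add: less_top[symmetric])
      then show False using that by (simp add: eq)
    qed
    then show ?thesis using negfin by (simp add: real_integrable_def less_top[symmetric])
  qed
  show "rel_entropy W N = ereal (\<integral>x. f x * ln (f x) \<partial>N)" if int: "integrable N (\<lambda>x. f x * ln (f x))"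
  proof -
    have fin: "(\<integral>\<^sup>+x. ennreal (f x * ln (f x)) \<partial>N) \<noteq> \<infinity>" using int by (simp add: real_integrable_def)
    have "enn2ereal a - enn2ereal b = ereal (enn2real a - enn2real b)" if "a \<noteq> \<infinity>" "b \<noteq> \<infinity>" for a b
      using that by (cases a; cases b) (auto simp: enn2ereal_ennreal)
    then show ?thesis using fin negfin by (simp add: eq real_lebesgue_integral_def[OF int])
  qed
qed

lemma rel_entropy_finite_density:
  assumes N: "prob_space N" and pW: "prob_space W" and fin: "rel_entropy W N < \<infinity>"
  obtains f where "f \<in> borel_measurable N" "\<And>x. 0 \<le> f x" "W = density N (\<lambda>x. ennreal (f x))"
    "integrable N (\<lambda>x. f x * ln (f x))" "rel_entropy W N = ereal (\<integral>x. f x * ln (f x) \<partial>N)"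
proof -
  interpret N: prob_space N by fact
  interpret W: prob_space W by fact
  have sets: "sets W = sets N" and AC: "absolutely_continuous N W"
    using fin by (auto simp: rel_entropy_def split: if_splits)
  define f where "f x = enn2real (RN_deriv N W x)" for x
  have f[measurable]: "f \<in> borel_measurable N" unfolding f_def by measurable
  have "AE x in N. RN_deriv N W x \<noteq> \<infinity>"
    by (rule N.RN_deriv_finite[OF W.sigma_finite_measure_axioms AC sets])
  then have "density N (\<lambda>x. ennreal (f x)) = density N (RN_deriv N W)"
    by (intro density_cong) (auto simp: f_def less_top elim!: eventually_mono)
  also have "\<dots> = W" by (rule N.density_RN_deriv[OF AC sets])
  finally have W: "W = density N (\<lambda>x. ennreal (f x))" by simp
  have f0: "0 \<le> f x" for x by (simp add: f_def)
  show thesis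
    using that[OF f f0 W] rel_entropy_density[OF N f f0 W pW] fin by simp
qed

section \<open>Bounded approximation of conditional densities\<close>

text \<open>Couplings yield densities that may be unbounded and are normalised only for almost every
  x, whereas codes use bounded ones normalised at every x. Clipping at k and spreading the lost mass
  evenly over \<open>Q\<close> changes the integrals of a and b and the entropy by amounts tending
  to 0.\<close>

lemma truncate_density:
  fixes f :: "'x \<Rightarrow> 'y \<Rightarrow> real"
  assumes X: "prob_space X" and Q: "prob_space Q"
    and f[measurable]: "case_prod f \<in> borel_measurable (X \<Otimes>\<^sub>M Q)" and f0: "\<And>x y. 0 \<le> f x y"
    and f1: "AE x in X. (\<integral>\<^sup>+y. ennreal (f x y) \<partial>Q) = 1"
    and flnf: "integrable (X \<Otimes>\<^sub>M Q) (\<lambda>(x, y). f x y * ln (f x y))"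
    and a[measurable]: "case_prod a \<in> borel_measurable (X \<Otimes>\<^sub>M Q)"
    and b[measurable]: "case_prod b \<in> borel_measurable (X \<Otimes>\<^sub>M Q)"
    and abd: "\<And>x y. \<bar>a x y\<bar> \<le> K" and bbd: "\<And>x y. \<bar>b x y\<bar> \<le> K" and \<eta>: "\<eta> > 0"
  shows "\<exists>f' B. case_prod f' \<in> borel_measurable (X \<Otimes>\<^sub>M Q)
    \<and> (\<forall>x\<in>space X. \<forall>y\<in>space Q. 0 \<le> f' x y \<and> f' x y \<le> B) \<and> (\<forall>x\<in>space X. (\<integral>y. f' x y \<partial>Q) = 1)
    \<and> (\<integral>x. \<integral>y. f' x y * a x y \<partial>Q \<partial>X) \<le> (\<integral>(x, y). f x y * a x y \<partial>(X \<Otimes>\<^sub>M Q)) + \<eta>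
    \<and> (\<integral>x. \<integral>y. f' x y * (ln (f' x y) + b x y) \<partial>Q \<partial>X)
       \<le> (\<integral>(x, y). f x y * ln (f x y) \<partial>(X \<Otimes>\<^sub>M Q)) + (\<integral>(x, y). f x y * b x y \<partial>(X \<Otimes>\<^sub>M Q)) + \<eta>"
proof -
  let ?f = "\<lambda>z. f (fst z) (snd z)"
  interpret X: prob_space X by fact
  interpret Q: prob_space Q by fact
  interpret XQ: pair_prob_space X Q ..
  let ?N = "X \<Otimes>\<^sub>M Q"
  \<comment> \<open>For the exceptional x the density becomes the constant 1, so that normalisation
    holds everywhere.\<close>
  define g where "g x y = (if (\<integral>\<^sup>+y. ennreal (f x y) \<partial>Q) = 1 then f x y else 1)" for x y
  let ?g = "\<lambda>z. g (fst z) (snd z)"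
  have [measurable]: "(\<lambda>x. \<integral>\<^sup>+y. ennreal (f x y) \<partial>Q) \<in> borel_measurable X"
    by measurable
  have g[measurable]: "case_prod g \<in> borel_measurable ?N"
    unfolding g_def split_beta' by measurable
  have g0: "0 \<le> g x y" for x y by (simp add: g_def f0)
  have g1: "(\<integral>\<^sup>+y. ennreal (g x y) \<partial>Q) = 1" for x
    by (cases "(\<integral>\<^sup>+y. ennreal (f x y) \<partial>Q) = 1") (auto simp: g_def Q.emeasure_space_1)
  have "AE z in distr ?N X fst. (\<integral>\<^sup>+y. ennreal (f z y) \<partial>Q) = 1"
    unfolding prob_space.distr_pair_fst[OF Q] by (rule f1)
  then have "AE z in ?N. (\<integral>\<^sup>+y. ennreal (f (fst z) y) \<partial>Q) = 1"
    by (rule AE_distrD[rotated]) measurable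
  then have gf: "AE z in ?N. ?g z = ?f z"
    by (rule eventually_mono) (simp add: g_def)
  have gx[measurable]: "g x \<in> borel_measurable Q" if "x \<in> space X" for x
    using measurable_Pair2[OF g that] by simp
  have gint: "integrable Q (g x)" "(\<integral>y. g x y \<partial>Q) = 1" if "x \<in> space X" for x
    using g1[of x] gx[OF that] g0
    by (auto intro!: integrableI_nonneg simp: integral_eq_nn_integral)
  have gN: "integrable ?N (case_prod g)"
  proof (rule integrableI_nonneg[OF g])
    have "(\<integral>\<^sup>+z. ennreal (case_prod g z) \<partial>?N) = (\<integral>\<^sup>+x. \<integral>\<^sup>+y. ennreal (g x y) \<partial>Q \<partial>X)"
      by (subst Q.nn_integral_fst[symmetric]) auto
    then show "(\<integral>\<^sup>+z. ennreal (case_prod g z) \<partial>?N) < \<infinity>" by (simp add: g1 X.emeasure_space_1)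
  qed (auto simp: g0)
  have glng: "integrable ?N (\<lambda>z. ?g z * ln (?g z))"
    by (rule integrable_cong_AE_imp[OF flnf]) (use gf in \<open>auto elim!: eventually_mono simp: split_beta'\<close>)
  define c where "c k x = (\<integral>y. min (g x y) (real k) \<partial>Q)" for k x
  \<comment> \<open>\<open>1 - c k x\<close> is the mass lost by clipping at k, returned as a
    constant in y. Hence \<open>h k\<close> lies between 0 and k + 1 and exceeds \<open>g\<close> by
    at most 1.\<close>
  define h where "h k x y = min (g x y) (real k) + (1 - c k x)" for k x y
  let ?h = "\<lambda>k z. h k (fst z) (snd z)"
  have cm[measurable]: "c k \<in> borel_measurable X" for k unfolding c_def by measurable
  have hm[measurable]: "case_prod (h k) \<in> borel_measurable ?N" for k
    unfolding h_def split_beta' by measurable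
  have mint: "integrable Q (\<lambda>y. min (g x y) (real k))" if "x \<in> space X" for x k
    by (rule Q.integrable_const_bound[where B="real k"]) (use g0 that in auto)
  have c01: "0 \<le> c k x \<and> c k x \<le> 1" if x: "x \<in> space X" for k x
  proof
    show "0 \<le> c k x" unfolding c_def by (rule Bochner_Integration.integral_nonneg) (simp add: g0)
    have "c k x \<le> (\<integral>y. g x y \<partial>Q)"
      unfolding c_def by (rule integral_mono[OF mint gint(1)]) (use x in auto)
    then show "c k x \<le> 1" using gint[OF x] by simp
  qed
  have h0: "0 \<le> h k x y" and hB: "h k x y \<le> real k + 1" and hg: "h k x y \<le> g x y + 1"
    if x: "x \<in> space X" for k x y
    using c01[OF x, of k] g0[of x y] by (auto simp: h_def)
  have h1: "(\<integral>y. h k x y \<partial>Q) = 1" if x: "x \<in> space X" for k x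
    unfolding h_def using mint[OF x, of k] by (simp add: Q.prob_space c_def)
  have clim: "(\<lambda>k. c k x) \<longlonglongrightarrow> 1" if x: "x \<in> space X" for x
  proof -
    have "(\<lambda>k. c k x) \<longlonglongrightarrow> (\<integral>y. g x y \<partial>Q)"
      unfolding c_def
    proof (rule integral_dominated_convergence[where w="g x"])
      show "AE y in Q. (\<lambda>k. min (g x y) (real k)) \<longlonglongrightarrow> g x y"
      proof (rule AE_I2)
        fix y
        obtain n where n: "g x y \<le> real n" using real_arch_simple by blast
        show "(\<lambda>k. min (g x y) (real k)) \<longlonglongrightarrow> g x y"
          by (rule tendsto_eventually) (use n in \<open>auto simp: eventually_sequentially intro!: exI[of _ n]\<close>)
      qed
    qed (use gint x g0 in auto)
    then show ?thesis using gint[OF x] by simp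
  qed
  have hlim: "(\<lambda>k. h k x y) \<longlonglongrightarrow> g x y" if x: "x \<in> space X" for x y
  proof -
    obtain n where n: "g x y \<le> real n" using real_arch_simple by blast
    have "(\<lambda>k. min (g x y) (real k)) \<longlonglongrightarrow> g x y"
      by (rule tendsto_eventually) (use n in \<open>auto simp: eventually_sequentially intro!: exI[of _ n]\<close>)
    from tendsto_add[OF this tendsto_diff[OF tendsto_const clim[OF x]], of 1] show ?thesis
      by (simp add: h_def)
  qed
  have lin: "(\<lambda>k. \<integral>z. ?h k z * e (fst z) (snd z) \<partial>?N) \<longlonglongrightarrow> (\<integral>z. ?f z * e (fst z) (snd z) \<partial>?N)"
    if e[measurable]: "case_prod e \<in> borel_measurable ?N" and ebd: "\<And>x y. \<bar>e x y\<bar> \<le> K" for e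
  proof -
    have "(\<lambda>k. \<integral>z. ?h k z * e (fst z) (snd z) \<partial>?N) \<longlonglongrightarrow> (\<integral>z. ?g z * e (fst z) (snd z) \<partial>?N)"
    proof (rule integral_dominated_convergence[where w="\<lambda>z. (?g z + 1) * K"])
      show "integrable ?N (\<lambda>z. (?g z + 1) * K)"
        using gN by (auto simp: split_beta')
      show "AE z in ?N. (\<lambda>k. ?h k z * e (fst z) (snd z)) \<longlonglongrightarrow> ?g z * e (fst z) (snd z)"
        by (rule AE_I2) (auto intro!: tendsto_mult hlim simp: space_pair_measure)
      show "AE z in ?N. norm (?h k z * e (fst z) (snd z)) \<le> (?g z + 1) * K" for k
        by (rule AE_I2) (use hg h0 ebd g0 in \<open>auto intro!: mult_mono add_nonneg_nonneg simp: space_pair_measure abs_mult\<close>)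
    qed (use g hm e in \<open>auto simp: split_beta'\<close>)
    also have "(\<integral>z. ?g z * e (fst z) (snd z) \<partial>?N) = (\<integral>z. ?f z * e (fst z) (snd z) \<partial>?N)"
      by (rule integral_cong_AE) (use gf f g e in \<open>auto elim!: eventually_mono simp: split_beta'\<close>)
    finally show ?thesis .
  qed
  have ent: "(\<lambda>k. \<integral>z. ?h k z * ln (?h k z) \<partial>?N) \<longlonglongrightarrow> (\<integral>z. ?f z * ln (?f z) \<partial>?N)"
  proof -
    have "(\<lambda>k. \<integral>z. ?h k z * ln (?h k z) \<partial>?N) \<longlonglongrightarrow> (\<integral>z. ?g z * ln (?g z) \<partial>?N)"
    \<comment> \<open>The majorant of t ln t for t \<le> s + 1, taken at s =
      \<open>g\<close>.\<close>
    proof (rule integral_dominated_convergence[where w="\<lambda>z. 3 + 2 * ?g z + 2 * \<bar>?g z * ln (?g z)\<bar>"])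
      show "integrable ?N (\<lambda>z. 3 + 2 * ?g z + 2 * \<bar>?g z * ln (?g z)\<bar>)"
        using gN glng by (auto simp: split_beta')
      show "AE z in ?N. (\<lambda>k. ?h k z * ln (?h k z)) \<longlonglongrightarrow> ?g z * ln (?g z)"
        by (rule AE_I2) (auto intro!: tendsto_x_ln_x hlim h0 simp: space_pair_measure)
      show "AE z in ?N. norm (?h k z * ln (?h k z)) \<le> 3 + 2 * ?g z + 2 * \<bar>?g z * ln (?g z)\<bar>" for k
        unfolding real_norm_def
        by (rule AE_I2, rule abs_x_ln_x_le) (use hg h0 g0 in \<open>auto simp: space_pair_measure\<close>)
    qed (use g hm in \<open>auto simp: split_beta'\<close>)
    also have "(\<integral>z. ?g z * ln (?g z) \<partial>?N) = (\<integral>z. ?f z * ln (?f z) \<partial>?N)"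
      by (rule integral_cong_AE) (use gf f g in \<open>auto elim!: eventually_mono simp: split_beta'\<close>)
    finally show ?thesis .
  qed
  have "\<forall>\<^sub>F k in sequentially. (\<integral>z. ?h k z * a (fst z) (snd z) \<partial>?N) < (\<integral>z. ?f z * a (fst z) (snd z) \<partial>?N) + \<eta>"
    by (rule order_tendstoD(2)[OF lin[OF a abd]]) (use \<eta> in simp)
  moreover have "\<forall>\<^sub>F k in sequentially. (\<integral>z. ?h k z * ln (?h k z) \<partial>?N) + (\<integral>z. ?h k z * b (fst z) (snd z) \<partial>?N)
    < (\<integral>z. ?f z * ln (?f z) \<partial>?N) + (\<integral>z. ?f z * b (fst z) (snd z) \<partial>?N) + \<eta>"
    by (rule order_tendstoD(2)[OF tendsto_add[OF ent lin[OF b bbd]]]) (use \<eta> in simp)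
  ultimately have "\<forall>\<^sub>F k in sequentially. (\<integral>z. ?h k z * a (fst z) (snd z) \<partial>?N) < (\<integral>z. ?f z * a (fst z) (snd z) \<partial>?N) + \<eta> \<and>
    (\<integral>z. ?h k z * ln (?h k z) \<partial>?N) + (\<integral>z. ?h k z * b (fst z) (snd z) \<partial>?N)
    < (\<integral>z. ?f z * ln (?f z) \<partial>?N) + (\<integral>z. ?f z * b (fst z) (snd z) \<partial>?N) + \<eta>"
    by (rule eventually_conj)
  then obtain k where k: "(\<integral>z. ?h k z * a (fst z) (snd z) \<partial>?N) < (\<integral>z. ?f z * a (fst z) (snd z) \<partial>?N) + \<eta>"
    "(\<integral>z. ?h k z * ln (?h k z) \<partial>?N) + (\<integral>z. ?h k z * b (fst z) (snd z) \<partial>?N)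
    < (\<integral>z. ?f z * ln (?f z) \<partial>?N) + (\<integral>z. ?f z * b (fst z) (snd z) \<partial>?N) + \<eta>"
    unfolding eventually_sequentially by blast
  have linint: "integrable ?N (\<lambda>z. ?h k z * e (fst z) (snd z))"
    if e[measurable]: "case_prod e \<in> borel_measurable ?N" and ebd: "\<And>x y. \<bar>e x y\<bar> \<le> K" for e
    by (rule XQ.P.integrable_const_bound[where B="(real k + 1) * K"])
      (use hB h0 ebd e hm in \<open>auto intro!: mult_mono AE_I2 simp: space_pair_measure abs_mult split_beta'\<close>)
  have entint: "integrable ?N (\<lambda>z. ?h k z * ln (?h k z))"
  proof (rule XQ.P.integrable_const_bound[where B="3 + 2 * real k + 2 * \<bar>real k * ln (real k)\<bar>"])
    show "AE z in ?N. norm (?h k z * ln (?h k z)) \<le> 3 + 2 * real k + 2 * \<bar>real k * ln (real k)\<bar>"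
      unfolding real_norm_def
      by (rule AE_I2, rule abs_x_ln_x_le) (use hB h0 in \<open>auto simp: space_pair_measure\<close>)
  qed (use hm in \<open>auto simp: split_beta'\<close>)
  have iter: "(\<integral>x. \<integral>y. F x y \<partial>Q \<partial>X) = (\<integral>z. F (fst z) (snd z) \<partial>?N)" "integrable X (\<lambda>x. \<integral>y. F x y \<partial>Q)"
    if "integrable ?N (\<lambda>z. F (fst z) (snd z))" for F :: "'x \<Rightarrow> 'y \<Rightarrow> real"
    using XQ.integral_fst[of F] XQ.integrable_fst[of F] that by (auto simp: split_beta')
  have "(\<integral>x. \<integral>y. h k x y * a x y \<partial>Q \<partial>X) = (\<integral>z. ?h k z * a (fst z) (snd z) \<partial>?N)"
    by (rule iter(1)[OF linint[OF a abd]])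
  moreover have "(\<integral>x. \<integral>y. h k x y * (ln (h k x y) + b x y) \<partial>Q \<partial>X)
    = (\<integral>z. ?h k z * ln (?h k z) \<partial>?N) + (\<integral>z. ?h k z * b (fst z) (snd z) \<partial>?N)"
    unfolding distrib_left
    by (subst iter) (use entint linint[OF b bbd] in auto)
  ultimately show ?thesis
    using k h0 hB h1 hm by (intro exI[of _ "h k"] exI[of _ "real k + 1"]) (auto simp: split_beta')
qed

section \<open>From a reference law to the output marginal\<close>

text \<open>Chain rule: if Q' is the second marginal of \<open>W\<close>, then H(W || X x Q') = H(W
  || X x Q) - H(Q' || Q), and the subtracted term is nonnegative. The step is needed because
  \<open>I_n\<close> measures a coupling against the product of its own marginals.\<close>

lemma marginal_rel_entropy_le:
  fixes f :: "'x \<Rightarrow> 'y \<Rightarrow> real"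
  assumes X: "prob_space X" and Q: "prob_space Q"
    and f[measurable]: "case_prod f \<in> borel_measurable (X \<Otimes>\<^sub>M Q)"
    and f0: "\<And>x y. x \<in> space X \<Longrightarrow> y \<in> space Q \<Longrightarrow> 0 \<le> f x y" and fB: "\<And>x y. x \<in> space X \<Longrightarrow> y \<in> space Q \<Longrightarrow> f x y \<le> B"
    and f1: "\<And>x. x \<in> space X \<Longrightarrow> (\<integral>y. f x y \<partial>Q) = 1"
  defines "W \<equiv> density (X \<Otimes>\<^sub>M Q) (\<lambda>z. ennreal (f (fst z) (snd z)))"
  shows "prob_space W" "distr W X fst = X" "prob_space (distr W Q snd)"
    "rel_entropy W (X \<Otimes>\<^sub>M distr W Q snd) \<le> ereal (\<integral>z. f (fst z) (snd z) * ln (f (fst z) (snd z)) \<partial>(X \<Otimes>\<^sub>M Q))"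
proof -
  let ?f = "\<lambda>z. f (fst z) (snd z)"
  interpret X: prob_space X by fact
  interpret Q: prob_space Q by fact
  interpret XQ: pair_prob_space X Q ..
  let ?N = "X \<Otimes>\<^sub>M Q"
  have fm[measurable]: "(\<lambda>z. ?f z) \<in> borel_measurable ?N"
    using f by (simp add: split_beta')
  have fx[measurable]: "f x \<in> borel_measurable Q" if "x \<in> space X" for x
    using measurable_Pair2[OF f that] by simp
  have f1': "(\<integral>\<^sup>+y. ennreal (f x y) \<partial>Q) = 1" if x: "x \<in> space X" for x
  proof -
    have "integrable Q (f x)"
      by (rule Q.integrable_const_bound[where B=B]) (use f0 fB x in auto)
    then have "(\<integral>\<^sup>+y. ennreal (f x y) \<partial>Q) = ennreal (\<integral>y. f x y \<partial>Q)"
      by (rule nn_integral_eq_integral) (use f0 x in auto)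
    then show ?thesis by (simp add: f1[OF x])
  qed
  have emW: "emeasure W {z\<in>space ?N. fst z \<in> A} = emeasure X A" if A: "A \<in> sets X" for A
  proof -
    have m: "{z\<in>space ?N. fst z \<in> A} \<in> sets ?N" using A by measurable
    have "emeasure W {z\<in>space ?N. fst z \<in> A} = (\<integral>\<^sup>+z. ennreal (?f z) * indicator {z\<in>space ?N. fst z \<in> A} z \<partial>?N)"
      unfolding W_def by (rule emeasure_density[OF _ m]) measurable
    also have "\<dots> = (\<integral>\<^sup>+z. ennreal (?f z) * indicator A (fst z) \<partial>?N)"
      by (rule nn_integral_cong) (auto split: split_indicator)
    also have "\<dots> = (\<integral>\<^sup>+x. \<integral>\<^sup>+y. ennreal (f x y) * indicator A x \<partial>Q \<partial>X)"
      using A by (subst Q.nn_integral_fst[symmetric]) auto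
    also have "\<dots> = (\<integral>\<^sup>+x. indicator A x \<partial>X)"
      by (rule nn_integral_cong) (simp add: nn_integral_multc f1')
    finally show ?thesis using A by simp
  qed
  show pW: "prob_space W"
  proof (rule prob_spaceI)
    have "emeasure W (space W) = emeasure W {z\<in>space ?N. fst z \<in> space X}"
      by (rule arg_cong[where f="emeasure W"]) (auto simp: W_def space_pair_measure)
    then show "emeasure W (space W) = 1" by (simp add: emW X.emeasure_space_1)
  qed
  interpret W: prob_space W by fact
  have setsW[measurable_cong]: "sets W = sets ?N" by (simp add: W_def)
  have spW: "space W = space ?N" by (simp add: W_def)
  show "distr W X fst = X"
  proof (rule measure_eqI)
    fix A assume "A \<in> sets (distr W X fst)"
    then have A: "A \<in> sets X" by simp
    have "emeasure (distr W X fst) A = emeasure W (fst -` A \<inter> space W)" by (rule emeasure_distr[OF _ A]) measurable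
    also have "fst -` A \<inter> space W = {z\<in>space ?N. fst z \<in> A}" by (auto simp: spW)
    finally show "emeasure (distr W X fst) A = emeasure X A" by (simp add: emW[OF A])
  qed simp
  define Q' where "Q' = distr W Q snd"
  show pQ': "prob_space (distr W Q snd)" by (rule W.prob_space_distr) measurable
  define q where "q y = (\<integral>x. f x y \<partial>X)" for y
  have q[measurable]: "q \<in> borel_measurable Q"
    unfolding q_def using f by measurable
  have fy[measurable]: "(\<lambda>x. f x y) \<in> borel_measurable X" if "y \<in> space Q" for y
    using measurable_Pair1[OF f that] by simp
  have fyint: "integrable X (\<lambda>x. f x y)" if "y \<in> space Q" for y
    by (rule X.integrable_const_bound[where B=B]) (use f0 fB that in auto)
  have q0: "0 \<le> q y" if "y \<in> space Q" for y
    unfolding q_def by (rule Bochner_Integration.integral_nonneg_AE) (use f0 that in auto)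
  have qB: "q y \<le> B" if "y \<in> space Q" for y
    unfolding q_def by (rule X.integral_le_const[OF fyint]) (use fB that in auto)
  have qnn: "(\<integral>\<^sup>+x. ennreal (f x y) \<partial>X) = ennreal (q y)" if "y \<in> space Q" for y
    unfolding q_def by (rule nn_integral_eq_integral[OF fyint]) (use f0 that in auto)
  have swap: "(\<integral>\<^sup>+z. ennreal (?f z) * e (snd z) \<partial>?N) = (\<integral>\<^sup>+y. ennreal (q y) * e y \<partial>Q)"
    if e[measurable]: "e \<in> borel_measurable Q" for e :: "'y \<Rightarrow> ennreal"
  proof -
    have "(\<integral>\<^sup>+z. ennreal (?f z) * e (snd z) \<partial>?N) = (\<integral>\<^sup>+y. \<integral>\<^sup>+x. ennreal (f x y) * e y \<partial>X \<partial>Q)"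
      by (subst XQ.nn_integral_snd[symmetric]) auto
    also have "\<dots> = (\<integral>\<^sup>+y. ennreal (q y) * e y \<partial>Q)"
      by (rule nn_integral_cong) (simp add: nn_integral_multc qnn)
    finally show ?thesis .
  qed
  have Q'_eq: "Q' = density Q (\<lambda>y. ennreal (q y))"
  proof (rule measure_eqI)
    fix A assume "A \<in> sets Q'"
    then have A[measurable]: "A \<in> sets Q" by (simp add: Q'_def)
    have "emeasure Q' A = emeasure W (snd -` A \<inter> space W)" unfolding Q'_def by (rule emeasure_distr[OF _ A]) measurable
    also have "snd -` A \<inter> space W = {z\<in>space ?N. snd z \<in> A}" by (auto simp: spW)
    also have "emeasure W \<dots> = (\<integral>\<^sup>+z. ennreal (?f z) * indicator {z\<in>space ?N. snd z \<in> A} z \<partial>?N)"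
      unfolding W_def by (rule emeasure_density) measurable
    also have "\<dots> = (\<integral>\<^sup>+z. ennreal (?f z) * indicator A (snd z) \<partial>?N)"
      by (rule nn_integral_cong) (auto split: split_indicator)
    also have "\<dots> = emeasure (density Q (\<lambda>y. ennreal (q y))) A"
      by (simp add: swap emeasure_density)
    finally show "emeasure Q' A = emeasure (density Q (\<lambda>y. ennreal (q y))) A" .
  qed (simp add: Q'_def)
  \<comment> \<open>Density of \<open>W\<close> relative to the product of its marginals. Almost
    everywhere f vanishes where q does, so the value of the quotient at q = 0 does no harm.\<close>
  define h where "h z = ?f z / q (snd z)" for z
  have hm[measurable]: "h \<in> borel_measurable ?N" unfolding h_def[abs_def] by measurable
  have N'_eq: "X \<Otimes>\<^sub>M Q' = density ?N (\<lambda>z. ennreal (q (snd z)))"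
  proof -
    have "density X (\<lambda>_. 1) \<Otimes>\<^sub>M density Q (\<lambda>y. ennreal (q y)) = density ?N (\<lambda>(x, y). 1 * ennreal (q y))"
    proof (rule pair_measure_density)
      show "sigma_finite_measure (density Q (\<lambda>y. ennreal (q y)))"
        unfolding Q'_eq[symmetric] Q'_def by (rule prob_space_imp_sigma_finite[OF pQ'])
    qed (use Q.sigma_finite_measure_axioms in auto)
    then show ?thesis by (simp add: Q'_eq density_1 split_beta')
  qed
  have "(\<integral>\<^sup>+z. ennreal (?f z) * indicator {y\<in>space Q. q y = 0} (snd z) \<partial>?N) = 0"
    by (subst swap) (auto intro!: nn_integral_zero' AE_I2 split: split_indicator)
  then have "AE z in ?N. ennreal (?f z) * indicator {y\<in>space Q. q y = 0} (snd z) = 0"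
    by (subst (asm) nn_integral_0_iff_AE) measurable
  then have fq: "AE z in ?N. q (snd z) = 0 \<longrightarrow> ?f z = 0" using AE_space
    by eventually_elim (use f0 in \<open>auto simp: space_pair_measure ennreal_eq_0_iff dest: antisym split: split_indicator_asm\<close>)
  have qh: "AE z in ?N. q (snd z) * h z = ?f z"
    using fq by eventually_elim (auto simp: h_def)
  have h0: "0 \<le> h z" if "z \<in> space ?N" for z
    using f0 q0 that by (auto simp: h_def space_pair_measure)
  \<comment> \<open>Equal to h on the space; the absolute value makes it nonnegative at every point,
    as \<open>rel_entropy_density\<close> asks.\<close>
  define h' where "h' z = \<bar>h z\<bar>" for z
  have h'm[measurable]: "h' \<in> borel_measurable ?N" unfolding h'_def[abs_def] by measurable
  have W_eq: "W = density (X \<Otimes>\<^sub>M Q') (\<lambda>z. ennreal (h' z))"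
  proof -
    have "density (X \<Otimes>\<^sub>M Q') (\<lambda>z. ennreal (h' z)) = density ?N (\<lambda>z. ennreal (q (snd z)) * ennreal (h' z))"
      unfolding N'_eq by (rule density_density_eq) measurable
    also have "\<dots> = W"
      unfolding W_def
    proof (rule density_cong)
      show "AE z in ?N. ennreal (q (snd z)) * ennreal (h' z) = ennreal (?f z)"
        using qh AE_space
        by eventually_elim (use h0 q0 in \<open>auto simp: h'_def space_pair_measure simp flip: ennreal_mult'\<close>)
    qed measurable
    finally show ?thesis by simp
  qed
  have flnf: "integrable ?N (\<lambda>z. ?f z * ln (?f z))"
  proof (rule XQ.P.integrable_const_bound[where B="x_ln_x_bound B"])
    show "AE z in ?N. norm (?f z * ln (?f z)) \<le> x_ln_x_bound B"
      unfolding real_norm_def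
      by (rule AE_I2, rule abs_x_ln_x_le_bound) (use f0 fB in \<open>auto simp: space_pair_measure\<close>)
  qed measurable
  have flnq: "integrable ?N (\<lambda>z. ?f z * ln (q (snd z)))"
  proof (rule integrableI_bounded)
    have "(\<integral>\<^sup>+z. ennreal (norm (?f z * ln (q (snd z)))) \<partial>?N)
      = (\<integral>\<^sup>+z. ennreal (?f z) * ennreal \<bar>ln (q (snd z))\<bar> \<partial>?N)"
      by (rule nn_integral_cong) (use f0 in \<open>auto simp: abs_mult ennreal_mult space_pair_measure\<close>)
    also have "\<dots> = (\<integral>\<^sup>+y. ennreal (q y) * ennreal \<bar>ln (q y)\<bar> \<partial>Q)" by (rule swap) measurable
    also have "\<dots> \<le> (\<integral>\<^sup>+y. ennreal (x_ln_x_bound B) \<partial>Q)"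
    proof (rule nn_integral_mono)
      fix y assume y: "y \<in> space Q"
      have "\<bar>q y * ln (q y)\<bar> \<le> x_ln_x_bound B"
        by (rule abs_x_ln_x_le_bound[OF q0[OF y] qB[OF y]])
      moreover have "ennreal (q y) * ennreal \<bar>ln (q y)\<bar> = ennreal \<bar>q y * ln (q y)\<bar>"
        using q0[OF y] by (simp add: abs_mult ennreal_mult)
      ultimately show "ennreal (q y) * ennreal \<bar>ln (q y)\<bar> \<le> ennreal (x_ln_x_bound B)"
        by (simp only: ennreal_leI)
    qed
    also have "\<dots> < \<infinity>" by (simp add: Q.emeasure_space_1)
    finally show "(\<integral>\<^sup>+z. ennreal (norm (?f z * ln (q (snd z)))) \<partial>?N) < \<infinity>" .
  qed measurable
  \<comment> \<open>This integral is H(Q' || Q); its sign comes from t ln t \<ge> t - 1 and the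
    total mass 1 of q.\<close>
  have flnq0: "0 \<le> (\<integral>z. ?f z * ln (q (snd z)) \<partial>?N)"
  proof -
    have "(\<integral>z. ?f z * ln (q (snd z)) \<partial>?N) = (\<integral>y. \<integral>x. f x y * ln (q y) \<partial>X \<partial>Q)"
      using XQ.integral_snd[of "\<lambda>x y. f x y * ln (q y)"] flnq by (simp add: split_beta')
    also have "\<dots> = (\<integral>y. q y * ln (q y) \<partial>Q)"
      by (rule Bochner_Integration.integral_cong) (auto simp: q_def)
    also have "(\<integral>y. q y - 1 \<partial>Q) \<le> \<dots>"
    proof (rule integral_mono)
      show "integrable Q (\<lambda>y. q y - 1)"
        by (rule Q.integrable_const_bound[where B="\<bar>B\<bar> + 1"]) (use q0 qB in \<open>force intro!: AE_I2\<close>)+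
      show "integrable Q (\<lambda>y. q y * ln (q y))"
        by (rule Q.integrable_const_bound[where B="x_ln_x_bound B"])
          (auto intro!: AE_I2 abs_x_ln_x_le_bound q0 qB simp del: abs_mult)
    qed (use x_ln_x_ge q0 in auto)
    moreover have "(\<integral>y. q y - 1 \<partial>Q) = 0"
    proof -
      have "integrable Q q"
        by (rule Q.integrable_const_bound[where B="\<bar>B\<bar>"]) (use q0 qB in \<open>force intro!: AE_I2\<close>)+
      moreover have "(\<integral>y. q y \<partial>Q) = 1"
      proof -
        have "(\<integral>\<^sup>+y. ennreal (q y) \<partial>Q) = emeasure (distr W Q snd) (space Q)"
          using Q'_eq by (simp add: Q'_def emeasure_density cong: nn_integral_cong)
        also have "\<dots> = 1" using prob_space.emeasure_space_1[OF pQ'] by simp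
        finally show ?thesis using q0 by (subst integral_eq_nn_integral) auto
      qed
      ultimately show ?thesis by (simp add: Q.prob_space)
    qed
    ultimately show ?thesis by simp
  qed
  have key: "AE z in ?N. q (snd z) * (h' z * ln (h' z)) = ?f z * ln (?f z) - ?f z * ln (q (snd z))"
    using qh fq AE_space
  proof eventually_elim
    fix z assume qh: "q (snd z) * h z = ?f z" and fq: "q (snd z) = 0 \<longrightarrow> ?f z = 0"
      and z: "z \<in> space ?N"
    have h': "h' z = h z" using h0[OF z] by (simp add: h'_def)
    have fz: "0 \<le> ?f z" "0 \<le> q (snd z)" using z f0 q0 by (auto simp: space_pair_measure)
    show "q (snd z) * (h' z * ln (h' z)) = ?f z * ln (?f z) - ?f z * ln (q (snd z))"
    proof (cases "?f z = 0")
      case True then show ?thesis by (simp add: h' h_def)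
    next
      case False
      with fz fq have pos: "0 < ?f z" "0 < q (snd z)" by (auto simp: order.order_iff_strict)
      have "q (snd z) * (h' z * ln (h' z)) = ?f z * ln (h z)" by (simp add: h' qh mult.assoc[symmetric])
      also have "ln (h z) = ln (?f z) - ln (q (snd z))" using pos by (simp add: h_def ln_div)
      finally show ?thesis by (simp add: right_diff_distrib)
    qed
  qed
  have qsnd0: "AE z in ?N. 0 \<le> q (snd z)" by (rule AE_I2) (use q0 in \<open>auto simp: space_pair_measure\<close>)
  have int': "integrable (X \<Otimes>\<^sub>M Q') (\<lambda>z. h' z * ln (h' z))"
    unfolding N'_eq
  proof (subst integrable_density)
    show "integrable ?N (\<lambda>z. q (snd z) *\<^sub>R (h' z * ln (h' z)))"
      by (rule integrable_cong_AE_imp[OF Bochner_Integration.integrable_diff[OF flnf flnq]])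
        (use key in \<open>auto elim!: eventually_mono\<close>)
  qed (use qsnd0 in auto)
  have val: "(\<integral>z. h' z * ln (h' z) \<partial>(X \<Otimes>\<^sub>M Q')) = (\<integral>z. ?f z * ln (?f z) \<partial>?N) - (\<integral>z. ?f z * ln (q (snd z)) \<partial>?N)"
  proof -
    have "(\<integral>z. h' z * ln (h' z) \<partial>(X \<Otimes>\<^sub>M Q')) = (\<integral>z. q (snd z) *\<^sub>R (h' z * ln (h' z)) \<partial>?N)"
      unfolding N'_eq by (rule integral_density) (use qsnd0 in auto)
    also have "\<dots> = (\<integral>z. ?f z * ln (?f z) - ?f z * ln (q (snd z)) \<partial>?N)"
      by (rule integral_cong_AE) (use key in \<open>auto elim!: eventually_mono\<close>)
    finally show ?thesis using flnf flnq by simp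
  qed
  have pN': "prob_space (X \<Otimes>\<^sub>M Q')"
  proof -
    interpret Q': prob_space Q' unfolding Q'_def by fact
    interpret XQ': pair_prob_space X Q' ..
    show ?thesis by (rule XQ'.P.prob_space_axioms)
  qed
  have h'm': "h' \<in> borel_measurable (X \<Otimes>\<^sub>M Q')" unfolding N'_eq by simp
  have "rel_entropy W (X \<Otimes>\<^sub>M Q') = ereal (\<integral>z. h' z * ln (h' z) \<partial>(X \<Otimes>\<^sub>M Q'))"
    by (rule rel_entropy_density(2)[OF pN' h'm' _ W_eq pW int']) (simp add: h'_def)
  then show "rel_entropy W (X \<Otimes>\<^sub>M distr W Q snd) \<le> ereal (\<integral>z. ?f z * ln (?f z) \<partial>?N)"
    using flnq0 val unfolding Q'_def by simp
qed

section \<open>Concatenation of coding densities\<close>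

definition merge_blocks :: "nat \<Rightarrow> nat \<Rightarrow> (nat \<Rightarrow> 'a) \<times> (nat \<Rightarrow> 'a) \<Rightarrow> nat \<Rightarrow> 'a" where
  "merge_blocks n m z = (\<lambda>i\<in>{..<n+m}. if i < n then fst z i else snd z (i - n))"

lemma measurable_merge_blocks [measurable]:
  "merge_blocks n m \<in> measurable (blk_space n N \<Otimes>\<^sub>M blk_space m N) (blk_space (n + m) N)"
  unfolding merge_blocks_def[abs_def] blk_space_def
proof (rule measurable_restrict)
  fix i assume i: "i \<in> {..<n+m}"
  show "(\<lambda>z. if i < n then fst z i else snd z (i - n))
    \<in> measurable (Pi\<^sub>M {..<n} (\<lambda>_. N) \<Otimes>\<^sub>M Pi\<^sub>M {..<m} (\<lambda>_. N)) N"
  proof (cases "i < n")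
    case True
    then have "(\<lambda>z. fst z i) \<in> measurable (Pi\<^sub>M {..<n} (\<lambda>_. N) \<Otimes>\<^sub>M Pi\<^sub>M {..<m} (\<lambda>_. N)) N"
      by (intro measurable_compose[OF measurable_fst] measurable_component_singleton) auto
    with True show ?thesis by simp
  next
    case False
    then have "(\<lambda>z. snd z (i - n)) \<in> measurable (Pi\<^sub>M {..<n} (\<lambda>_. N) \<Otimes>\<^sub>M Pi\<^sub>M {..<m} (\<lambda>_. N)) N"
      by (intro measurable_compose[OF measurable_snd] measurable_component_singleton) (use i in auto)
    with False show ?thesis by simp
  qed
qed

lemma window_merge_blocks:
  assumes "z \<in> space (blk_space n N \<Otimes>\<^sub>M blk_space m N)"
  shows "window 0 n (merge_blocks n m z) = fst z" "window n m (merge_blocks n m z) = snd z"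
  using assms by (auto simp: window_def merge_blocks_def blk_space_def space_pair_measure space_PiM
      PiE_def extensional_def fun_eq_iff)

lemma window_window: "t + m \<le> n \<Longrightarrow> window t m (window s n x) = window (t + s) m x"
  by (auto simp: window_def fun_eq_iff ac_simps)

lemma measurable_window_blk:
  assumes "t + m \<le> n" shows "window t m \<in> measurable (blk_space n N) (blk_space m N)"
proof -
  have "{t..<t+m} \<subseteq> {..<n}" using assms by auto
  from measurable_window[OF this] show ?thesis by (simp add: blk_space_def)
qed

lemma sum_lessThan_add:
  fixes g :: "nat \<Rightarrow> real"
  shows "(\<Sum>i<n+m. g i) = (\<Sum>i<n. g i) + (\<Sum>i<m. g (i + n))"
  by (induction m) (simp_all add: add.commute)

text \<open>A family of conditional laws of the codeword given the source block. \<open>Q\<close> is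
  only a reference law, so that concatenation is a plain product: the output marginal of a
  concatenation is in general no product when the source blocks are dependent. Normalisation at
  every x allows every path to be coded.\<close>

definition coding_density :: "nat \<Rightarrow> (nat \<Rightarrow> 'b::topological_space) measure \<Rightarrow>
    ((nat \<Rightarrow> 'a::topological_space) \<Rightarrow> (nat \<Rightarrow> 'b) \<Rightarrow> real) \<Rightarrow> real \<Rightarrow> bool" where
  "coding_density n Q f B \<longleftrightarrow> prob_space Q \<and> sets Q = sets (blk_space n borel)
     \<and> case_prod f \<in> borel_measurable (blk_space n borel \<Otimes>\<^sub>M blk_space n borel)
     \<and> (\<forall>x\<in>space (blk_space n borel). \<forall>y\<in>space (blk_space n borel). 0 \<le> f x y \<and> f x y \<le> B)
     \<and> (\<forall>x\<in>space (blk_space n borel). (\<integral>y. f x y \<partial>Q) = 1)"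

lemma abs_expectation_le:
  assumes "prob_space Q" "h \<in> borel_measurable Q" "\<And>y. y \<in> space Q \<Longrightarrow> \<bar>h y\<bar> \<le> (K::real)"
  shows "\<bar>\<integral>y. h y \<partial>Q\<bar> \<le> K"
proof -
  interpret prob_space Q by fact
  have int: "integrable Q h" by (rule integrable_const_bound[where B=K]) (use assms in auto)
  have "\<bar>\<integral>y. h y \<partial>Q\<bar> \<le> (\<integral>y. \<bar>h y\<bar> \<partial>Q)" using integral_norm_bound[of Q h] by simp
  also have "\<dots> \<le> K" by (rule integral_le_const) (use int assms in auto)
  finally show ?thesis .
qed

text \<open>An additive functional weighted by a product density has the Leibniz shape
  \<open>A g + f B\<close>. Since f and g have mass 1, the two summands decouple.\<close>

lemma split_expectation:
  fixes A f :: "'u \<Rightarrow> real" and B g :: "'v \<Rightarrow> real"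
  assumes Q1: "prob_space Q1" and Q2: "prob_space Q2"
    and m[measurable]: "A \<in> borel_measurable Q1" "f \<in> borel_measurable Q1" "B \<in> borel_measurable Q2" "g \<in> borel_measurable Q2"
    and bd: "\<And>y. y \<in> space Q1 \<Longrightarrow> \<bar>A y\<bar> \<le> K" "\<And>y. y \<in> space Q1 \<Longrightarrow> \<bar>f y\<bar> \<le> K"
      "\<And>y. y \<in> space Q2 \<Longrightarrow> \<bar>B y\<bar> \<le> K" "\<And>y. y \<in> space Q2 \<Longrightarrow> \<bar>g y\<bar> \<le> K"
    and one: "(\<integral>y. f y \<partial>Q1) = 1" "(\<integral>y. g y \<partial>Q2) = 1"
  shows "(\<integral>z. A (fst z) * g (snd z) + f (fst z) * B (snd z) \<partial>(Q1 \<Otimes>\<^sub>M Q2)) = (\<integral>y. A y \<partial>Q1) + (\<integral>y. B y \<partial>Q2)"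
proof -
  interpret Q1: prob_space Q1 by fact
  interpret Q2: prob_space Q2 by fact
  interpret QQ: pair_prob_space Q1 Q2 ..
  have i1: "integrable Q1 A" "integrable Q1 f" "integrable Q2 B" "integrable Q2 g"
    by (rule Q1.integrable_const_bound[where B=K] Q2.integrable_const_bound[where B=K]; use bd in auto)+
  have K0: "0 \<le> K" using bd(1) Q1.not_empty by fastforce
  have i2: "integrable (Q1 \<Otimes>\<^sub>M Q2) (\<lambda>z. a (fst z) * b (snd z))"
    if [measurable]: "a \<in> borel_measurable Q1" "b \<in> borel_measurable Q2" and "\<And>y. y \<in> space Q1 \<Longrightarrow> \<bar>a y\<bar> \<le> K"
      "\<And>y. y \<in> space Q2 \<Longrightarrow> \<bar>b y\<bar> \<le> K" for a b
    by (rule QQ.P.integrable_const_bound[where B="K * K"])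
      (use that K0 in \<open>auto intro!: AE_I2 mult_mono simp: abs_mult space_pair_measure\<close>)
  have i3: "(\<integral>z. a (fst z) * b (snd z) \<partial>(Q1 \<Otimes>\<^sub>M Q2)) = (\<integral>y. a y \<partial>Q1) * (\<integral>y. b y \<partial>Q2)"
    if "integrable (Q1 \<Otimes>\<^sub>M Q2) (\<lambda>z. a (fst z) * b (snd z))" for a b :: "_ \<Rightarrow> real"
    using QQ.integral_fst[of "\<lambda>x y. a x * b y"] that by (simp add: split_beta')
  show ?thesis
    by (subst Bochner_Integration.integral_add)
      (use i2[OF m(1,4) bd(1,4)] i2[OF m(2,3) bd(2,3)] one in \<open>simp_all add: i3\<close>)
qed

context stat_source
begin

lemma integral_marg:
  "f \<in> borel_measurable (blk_space m borel) \<Longrightarrow> (\<integral>x. f x \<partial>marg m P) = (\<integral>x. f (window 0 m x) \<partial>P :: real)"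
  by (simp add: integral_window)

lemma integral_marg_window:
  assumes f: "f \<in> borel_measurable (blk_space m borel)" and tm: "t + m \<le> n"
  shows "(\<integral>x. f (window t m x) \<partial>marg n P) = (\<integral>x. f x \<partial>marg m P :: real)"
proof -
  have w: "window t m \<in> measurable (blk_space n borel) (blk_space m (borel :: 'a measure))"
    using tm by (rule measurable_window_blk)
  have "(\<integral>x. f (window t m x) \<partial>marg n P) = (\<integral>x. f (window t m (window 0 n x)) \<partial>P)"
    by (rule integral_marg) (rule measurable_compose[OF w f])
  also have "\<dots> = (\<integral>x. f (window t m x) \<partial>P)" by (simp add: window_window[OF tm])
  finally show ?thesis by (simp add: integral_window[OF f])
qed

text \<open>The inner integral splits into one function of each window. The outer integral then
  involves only the laws of the single windows, which stationarity identifies with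
  \<open>marg n P\<close> and \<open>marg m P\<close>.\<close>

lemma concat_integral:
  fixes f1 F1 f2 F2 :: "(nat \<Rightarrow> 'a) \<Rightarrow> (nat \<Rightarrow> 'b::polish_space) \<Rightarrow> real"
  assumes c1: "coding_density n Q1 f1 B1" and c2: "coding_density m Q2 f2 B2"
    and F1: "case_prod F1 \<in> borel_measurable (blk_space n borel \<Otimes>\<^sub>M blk_space n borel)"
    and F2: "case_prod F2 \<in> borel_measurable (blk_space m borel \<Otimes>\<^sub>M blk_space m borel)"
    and b1: "\<And>x y. x \<in> space (blk_space n borel) \<Longrightarrow> y \<in> space (blk_space n borel) \<Longrightarrow> \<bar>F1 x y\<bar> \<le> K1"
    and b2: "\<And>x y. x \<in> space (blk_space m borel) \<Longrightarrow> y \<in> space (blk_space m borel) \<Longrightarrow> \<bar>F2 x y\<bar> \<le> K2"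
  defines "Q \<equiv> distr (Q1 \<Otimes>\<^sub>M Q2) (blk_space (n + m) borel) (merge_blocks n m)"
  defines "F \<equiv> \<lambda>x y. F1 (window 0 n x) (window 0 n y) * f2 (window n m x) (window n m y)
      + f1 (window 0 n x) (window 0 n y) * F2 (window n m x) (window n m y)"
  shows "x \<in> space (blk_space (n + m) borel) \<Longrightarrow>
      (\<integral>y. F x y \<partial>Q) = (\<integral>y. F1 (window 0 n x) y \<partial>Q1) + (\<integral>y. F2 (window n m x) y \<partial>Q2)"
    and "(\<integral>x. \<integral>y. F x y \<partial>Q \<partial>marg (n + m) P) = (\<integral>x. \<integral>y. F1 x y \<partial>Q1 \<partial>marg n P) + (\<integral>x. \<integral>y. F2 x y \<partial>Q2 \<partial>marg m P)"
    and "case_prod F \<in> borel_measurable (blk_space (n + m) borel \<Otimes>\<^sub>M blk_space (n + m) borel)"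
    and "prob_space Q"
proof -
  let ?An = "blk_space n (borel :: 'a measure)" and ?Am = "blk_space m (borel :: 'a measure)" and ?A = "blk_space (n + m) (borel :: 'a measure)"
  let ?Bn = "blk_space n (borel :: 'b measure)" and ?Bm = "blk_space m (borel :: 'b measure)" and ?B = "blk_space (n + m) (borel :: 'b measure)"
  note [measurable] = F1 F2
  have [measurable]: "case_prod f1 \<in> borel_measurable (?An \<Otimes>\<^sub>M ?Bn)" "case_prod f2 \<in> borel_measurable (?Am \<Otimes>\<^sub>M ?Bm)"
    and Q1: "prob_space Q1" and Q2: "prob_space Q2" and s1[measurable_cong]: "sets Q1 = sets ?Bn" and s2[measurable_cong]: "sets Q2 = sets ?Bm"
    using c1 c2 by (auto simp: coding_density_def)
  interpret Q1: prob_space Q1 by fact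
  interpret Q2: prob_space Q2 by fact
  interpret QQ: pair_prob_space Q1 Q2 ..
  have sp1: "space Q1 = space ?Bn" and sp2: "space Q2 = space ?Bm" using s1 s2 by (auto dest: sets_eq_imp_space_eq)
  have wA[measurable]: "window 0 n \<in> measurable ?A ?An" "window n m \<in> measurable ?A ?Am"
    by (rule measurable_window_blk; simp)+
  have wB[measurable]: "window 0 n \<in> measurable ?B ?Bn" "window n m \<in> measurable ?B ?Bm"
    by (rule measurable_window_blk; simp)+
  have sp12: "space (Q1 \<Otimes>\<^sub>M Q2) = space (?Bn \<Otimes>\<^sub>M ?Bm)" by (simp add: space_pair_measure sp1 sp2)
  have mm[measurable]: "merge_blocks n m \<in> measurable (Q1 \<Otimes>\<^sub>M Q2) ?B" by measurable
  show pQ: "prob_space Q" unfolding Q_def by (rule QQ.P.prob_space_distr) measurable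
  show Fm[measurable]: "case_prod F \<in> borel_measurable (?A \<Otimes>\<^sub>M ?B)"
    unfolding F_def split_beta' by measurable
  have inner: "(\<integral>y. F x y \<partial>Q) = (\<integral>y. F1 (window 0 n x) y \<partial>Q1) + (\<integral>y. F2 (window n m x) y \<partial>Q2)"
    if x: "x \<in> space ?A" for x
  proof -
    have x1: "window 0 n x \<in> space ?An" and x2: "window n m x \<in> space ?Am"
      using measurable_space[OF wA(1) x] measurable_space[OF wA(2) x] by auto
    have [measurable]: "F x \<in> borel_measurable ?B" using measurable_Pair2[OF Fm x] by simp
    have "(\<integral>y. F x y \<partial>Q) = (\<integral>z. F x (merge_blocks n m z) \<partial>(Q1 \<Otimes>\<^sub>M Q2))"
      unfolding Q_def by (rule integral_distr) measurable
    also have "\<dots> = (\<integral>z. F1 (window 0 n x) (fst z) * f2 (window n m x) (snd z)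
      + f1 (window 0 n x) (fst z) * F2 (window n m x) (snd z) \<partial>(Q1 \<Otimes>\<^sub>M Q2))"
      by (rule Bochner_Integration.integral_cong) (simp_all add: F_def window_merge_blocks sp12)
    also have "\<dots> = (\<integral>y. F1 (window 0 n x) y \<partial>Q1) + (\<integral>y. F2 (window n m x) y \<partial>Q2)"
    proof (rule split_expectation[OF Q1 Q2, where K="max (max K1 K2) (max B1 B2)"])
      show "F1 (window 0 n x) \<in> borel_measurable Q1" "f1 (window 0 n x) \<in> borel_measurable Q1"
         "F2 (window n m x) \<in> borel_measurable Q2" "f2 (window n m x) \<in> borel_measurable Q2"
        using x1 x2 by measurable
      show "(\<integral>y. f1 (window 0 n x) y \<partial>Q1) = 1" "(\<integral>y. f2 (window n m x) y \<partial>Q2) = 1"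
        using x1 x2 c1 c2 by (auto simp: coding_density_def)
    qed (use x1 x2 b1 b2 c1 c2 in \<open>fastforce simp: sp1 sp2 coding_density_def le_max_iff_disj\<close>)+
    finally show ?thesis .
  qed
  then show "x \<in> space ?A \<Longrightarrow> (\<integral>y. F x y \<partial>Q) = (\<integral>y. F1 (window 0 n x) y \<partial>Q1) + (\<integral>y. F2 (window n m x) y \<partial>Q2)" for x .
  have G1[measurable]: "(\<lambda>x. \<integral>y. F1 x y \<partial>Q1) \<in> borel_measurable ?An" and G2[measurable]: "(\<lambda>x. \<integral>y. F2 x y \<partial>Q2) \<in> borel_measurable ?Am"
    by measurable
  interpret PA: prob_space "marg (n + m) P" by (rule prob_marg)
  have bG1: "x \<in> space ?An \<Longrightarrow> \<bar>\<integral>y. F1 x y \<partial>Q1\<bar> \<le> K1" for x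
    by (rule abs_expectation_le[OF Q1]) (auto simp: b1 sp1)
  have bG2: "x \<in> space ?Am \<Longrightarrow> \<bar>\<integral>y. F2 x y \<partial>Q2\<bar> \<le> K2" for x
    by (rule abs_expectation_le[OF Q2]) (auto simp: b2 sp2)
  have "(\<integral>x. \<integral>y. F x y \<partial>Q \<partial>marg (n + m) P)
     = (\<integral>x. (\<integral>y. F1 (window 0 n x) y \<partial>Q1) + (\<integral>y. F2 (window n m x) y \<partial>Q2) \<partial>marg (n + m) P)"
    by (rule Bochner_Integration.integral_cong) (simp_all add: inner)
  also have "\<dots> = (\<integral>x. (\<integral>y. F1 (window 0 n x) y \<partial>Q1) \<partial>marg (n + m) P) + (\<integral>x. (\<integral>y. F2 (window n m x) y \<partial>Q2) \<partial>marg (n + m) P)"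
  proof (rule Bochner_Integration.integral_add)
    show "integrable (marg (n + m) P) (\<lambda>x. \<integral>y. F1 (window 0 n x) y \<partial>Q1)"
      by (rule PA.integrable_const_bound[where B=K1])
        (use bG1 measurable_space[OF wA(1)] measurable_compose[OF wA(1) G1] in auto)
    show "integrable (marg (n + m) P) (\<lambda>x. \<integral>y. F2 (window n m x) y \<partial>Q2)"
      by (rule PA.integrable_const_bound[where B=K2])
        (use bG2 measurable_space[OF wA(2)] measurable_compose[OF wA(2) G2] in auto)
  qed
  also have "\<dots> = (\<integral>x. \<integral>y. F1 x y \<partial>Q1 \<partial>marg n P) + (\<integral>x. \<integral>y. F2 x y \<partial>Q2 \<partial>marg m P)"
    by (intro arg_cong2[where f="(+)"] integral_marg_window G1 G2) auto
  finally show "(\<integral>x. \<integral>y. F x y \<partial>Q \<partial>marg (n + m) P) = (\<integral>x. \<integral>y. F1 x y \<partial>Q1 \<partial>marg n P) + (\<integral>x. \<integral>y. F2 x y \<partial>Q2 \<partial>marg m P)" .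
qed

end

section \<open>Achievable pairs of distortion and rate\<close>

locale coding_problem = stat_source P
  for P :: "(nat \<Rightarrow> 'a::polish_space) measure" +
  fixes \<rho> :: "'a \<Rightarrow> 'b::polish_space \<Rightarrow> real" and M :: "'b \<Rightarrow> real" and \<rho>max Lmax :: real
  assumes rho_meas: "(\<lambda>(x, y). \<rho> x y) \<in> borel_measurable (borel \<Otimes>\<^sub>M borel)"
    and rho_nonneg: "\<And>x y. 0 \<le> \<rho> x y"
    and M_meas: "M \<in> borel_measurable borel"
    and M_pos: "\<And>y. 0 < M y"
    and rho_bdd: "\<And>x y. \<rho> x y \<le> \<rho>max"
    and logM_bdd: "\<And>y. \<bar>ln (M y)\<bar> \<le> Lmax"
begin

definition dsum :: "nat \<Rightarrow> (nat \<Rightarrow> 'a) \<Rightarrow> (nat \<Rightarrow> 'b) \<Rightarrow> real" where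
  "dsum n x y = (\<Sum>i<n. \<rho> (x i) (y i))"

definition lsum :: "nat \<Rightarrow> (nat \<Rightarrow> 'b) \<Rightarrow> real" where
  "lsum n y = (\<Sum>i<n. ln (M (y i)))"

lemma coord_meas: "i < n \<Longrightarrow> (\<lambda>x. x i) \<in> measurable (blk_space n N) N"
  unfolding blk_space_def by (rule measurable_component_singleton) simp

lemma dsum_meas [measurable]: "case_prod (dsum n) \<in> borel_measurable (blk_space n borel \<Otimes>\<^sub>M blk_space n borel)"
  unfolding dsum_def split_beta'
proof (rule borel_measurable_sum)
  fix i assume "i \<in> {..<n}"
  then have "(\<lambda>z. (fst z i, snd z i)) \<in> measurable (blk_space n borel \<Otimes>\<^sub>M blk_space n borel) ((borel :: 'a measure) \<Otimes>\<^sub>M (borel :: 'b measure))"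
    by (intro measurable_Pair measurable_compose[OF measurable_fst] measurable_compose[OF measurable_snd] coord_meas) auto
  from measurable_compose[OF this rho_meas]
  show "(\<lambda>z. \<rho> (fst z i) (snd z i)) \<in> borel_measurable (blk_space n borel \<Otimes>\<^sub>M blk_space n borel)" by simp
qed

lemma lsum_meas [measurable]: "lsum n \<in> borel_measurable (blk_space n borel)"
  unfolding lsum_def
  by (intro borel_measurable_sum borel_measurable_ln measurable_compose[OF coord_meas M_meas]) auto

lemma dsum_nonneg: "0 \<le> dsum n x y"
  unfolding dsum_def by (simp add: sum_nonneg rho_nonneg)

lemma dsum_le: "dsum n x y \<le> real n * \<rho>max"
  unfolding dsum_def using sum_bounded_above[of "{..<n}" "\<lambda>i. \<rho> (x i) (y i)" \<rho>max] rho_bdd by simp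

lemma rhomax_nonneg: "0 \<le> \<rho>max"
  using rho_nonneg rho_bdd order_trans by blast

lemma Lmax_nonneg: "0 \<le> Lmax"
  using logM_bdd[of undefined] by linarith

lemma lsum_abs_le: "\<bar>lsum n y\<bar> \<le> real n * Lmax"
proof -
  have "\<bar>lsum n y\<bar> \<le> (\<Sum>i<n. \<bar>ln (M (y i))\<bar>)" unfolding lsum_def by (rule sum_abs)
  also have "\<dots> \<le> real n * Lmax" using sum_bounded_above[of "{..<n}" "\<lambda>i. \<bar>ln (M (y i))\<bar>" Lmax] logM_bdd by simp
  finally show ?thesis .
qed

lemma rho_n_dsum: "rho_n \<rho> n x y = dsum n x y / real n"
  by (simp add: rho_n_def dsum_def)

lemma dsum_split: "dsum (n + m) x y = dsum n (window 0 n x) (window 0 n y) + dsum m (window n m x) (window n m y)"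
  unfolding dsum_def window_def by (simp add: sum_lessThan_add)

lemma lsum_split: "lsum (n + m) y = lsum n (window 0 n y) + lsum m (window n m y)"
  unfolding lsum_def window_def by (simp add: sum_lessThan_add)

text \<open>Distortion \<open>d\<close> and rate \<open>r\<close> are totals over the block, not per symbol.\<close>
definition achievable :: "nat \<Rightarrow> real \<Rightarrow> real \<Rightarrow> bool" where
  "achievable n d r \<longleftrightarrow> (\<exists>Q f B. coding_density n Q f B
     \<and> (\<integral>x. \<integral>y. f x y * dsum n x y \<partial>Q \<partial>marg n P) \<le> d
     \<and> (\<integral>x. \<integral>y. f x y * (ln (f x y) + lsum n y) \<partial>Q \<partial>marg n P) \<le> r)"

lemma achievable_mono: "achievable n d r \<Longrightarrow> d \<le> d' \<Longrightarrow> r \<le> r' \<Longrightarrow> achievable n d' r'"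
  unfolding achievable_def by (meson order_trans)

lemma abs_rate_integrand_le:
  assumes "0 \<le> t" "t \<le> B"
  shows "\<bar>t * (ln t + lsum n y)\<bar> \<le> x_ln_x_bound B + \<bar>B\<bar> * (real n * Lmax)"
proof -
  have "\<bar>t * (ln t + lsum n y)\<bar> \<le> \<bar>t * ln t\<bar> + \<bar>t * lsum n y\<bar>" by (simp add: distrib_left abs_triangle_ineq)
  moreover have "\<bar>t * ln t\<bar> \<le> x_ln_x_bound B"
    by (rule abs_x_ln_x_le_bound[OF assms])
  moreover have "\<bar>t * lsum n y\<bar> \<le> \<bar>B\<bar> * (real n * Lmax)"
    unfolding abs_mult by (rule mult_mono) (use assms lsum_abs_le in auto)
  ultimately show ?thesis by linarith
qed

text \<open>With reference law \<open>Q1 x Q2\<close> and density \<open>f1 f2\<close>, distortion,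
  log-mass and log-likelihood are all additive, so \<open>concat_integral\<close> applies to each.
  This is the subadditivity behind the existence of the rate limit.\<close>

lemma achievable_add:
  assumes a1: "achievable n d1 r1" and a2: "achievable m d2 r2"
  shows "achievable (n + m) (d1 + d2) (r1 + r2)"
proof -
  obtain Q1 f1 B1 where c1: "coding_density n Q1 f1 B1"
    and d1: "(\<integral>x. \<integral>y. f1 x y * dsum n x y \<partial>Q1 \<partial>marg n P) \<le> d1"
    and r1: "(\<integral>x. \<integral>y. f1 x y * (ln (f1 x y) + lsum n y) \<partial>Q1 \<partial>marg n P) \<le> r1"
    using a1 unfolding achievable_def by blast
  obtain Q2 f2 B2 where c2: "coding_density m Q2 f2 B2"
    and d2: "(\<integral>x. \<integral>y. f2 x y * dsum m x y \<partial>Q2 \<partial>marg m P) \<le> d2"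
    and r2: "(\<integral>x. \<integral>y. f2 x y * (ln (f2 x y) + lsum m y) \<partial>Q2 \<partial>marg m P) \<le> r2"
    using a2 unfolding achievable_def by blast
  let ?An = "blk_space n (borel :: 'a measure)" and ?Am = "blk_space m (borel :: 'a measure)" and ?A = "blk_space (n + m) (borel :: 'a measure)"
  let ?Bn = "blk_space n (borel :: 'b measure)" and ?Bm = "blk_space m (borel :: 'b measure)" and ?B = "blk_space (n + m) (borel :: 'b measure)"
  have m1[measurable]: "case_prod f1 \<in> borel_measurable (?An \<Otimes>\<^sub>M ?Bn)" and m2[measurable]: "case_prod f2 \<in> borel_measurable (?Am \<Otimes>\<^sub>M ?Bm)"
    and f1: "\<And>x y. x \<in> space ?An \<Longrightarrow> y \<in> space ?Bn \<Longrightarrow> 0 \<le> f1 x y \<and> f1 x y \<le> B1"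
    and f2: "\<And>x y. x \<in> space ?Am \<Longrightarrow> y \<in> space ?Bm \<Longrightarrow> 0 \<le> f2 x y \<and> f2 x y \<le> B2"
    and o1: "\<And>x. x \<in> space ?An \<Longrightarrow> (\<integral>y. f1 x y \<partial>Q1) = 1"
    and o2: "\<And>x. x \<in> space ?Am \<Longrightarrow> (\<integral>y. f2 x y \<partial>Q2) = 1"
    using c1 c2 unfolding coding_density_def by auto
  define Q where "Q = distr (Q1 \<Otimes>\<^sub>M Q2) ?B (merge_blocks n m)"
  let ?f1 = "\<lambda>x y. f1 (window 0 n x) (window 0 n y)" and ?f2 = "\<lambda>x y. f2 (window n m x) (window n m y)"
  define f where "f x y = ?f1 x y * ?f2 x y" for x y
  note ci = concat_integral[OF c1 c2, folded Q_def]
  have spQ: "space Q = space ?B" by (simp add: Q_def)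
  have wA: "x \<in> space ?A \<Longrightarrow> window 0 n x \<in> space ?An \<and> window n m x \<in> space ?Am" for x
    by (auto simp: blk_space_def space_PiM window_def)
  have wB: "x \<in> space ?B \<Longrightarrow> window 0 n x \<in> space ?Bn \<and> window n m x \<in> space ?Bm" for x
    by (auto simp: blk_space_def space_PiM window_def)
  have cd: "coding_density (n + m) Q f (B1 * B2)"
  proof -
    \<comment> \<open>With \<open>f1 / 2\<close> and \<open>f2 / 2\<close> the Leibniz form is the
      product density itself, so its measurability and its total mass 1/2 + 1/2 = 1 come out of
      \<open>concat_integral\<close>.\<close>
    have half1: "case_prod (\<lambda>x y. f1 x y / 2) \<in> borel_measurable (?An \<Otimes>\<^sub>M ?Bn)"
      and half2: "case_prod (\<lambda>x y. f2 x y / 2) \<in> borel_measurable (?Am \<Otimes>\<^sub>M ?Bm)"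
      unfolding split_beta' using m1 m2 by (auto simp: split_beta')
    have b1: "\<bar>f1 x y / 2\<bar> \<le> B1" if "x \<in> space ?An" "y \<in> space ?Bn" for x y using f1[OF that] by (simp add: abs_if; linarith)
    have b2: "\<bar>f2 x y / 2\<bar> \<le> B2" if "x \<in> space ?Am" "y \<in> space ?Bm" for x y using f2[OF that] by (simp add: abs_if; linarith)
    have eq: "(\<lambda>x y. ?f1 x y / 2 * ?f2 x y +
      ?f1 x y * (?f2 x y / 2)) = f"
      by (simp add: f_def fun_eq_iff)
    have "0 \<le> f x y \<and> f x y \<le> B1 * B2" if x: "x \<in> space ?A" and y: "y \<in> space ?B" for x y
    proof -
      have "0 \<le> ?f1 x y" "?f1 x y \<le> B1"
        "0 \<le> ?f2 x y" "?f2 x y \<le> B2"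
        using f1 f2 wA[OF x] wB[OF y] by auto
      then show ?thesis unfolding f_def by (intro conjI mult_nonneg_nonneg mult_mono) linarith+
    qed
    moreover have "(\<integral>y. f x y \<partial>Q) = 1" if x: "x \<in> space ?A" for x
      using ci(1)[OF half1 half2 b1 b2 x, unfolded eq] o1 o2 wA[OF x] by (simp add: f_def[abs_def])
    moreover have "case_prod f \<in> borel_measurable (?A \<Otimes>\<^sub>M ?B)"
      using ci(3)[OF half1 half2 b1 b2, unfolded eq] .
    ultimately show ?thesis using ci(4)[OF half1 half2 b1 b2] by (auto simp: coding_density_def Q_def)
  qed
  have "(\<integral>x. \<integral>y. f x y * dsum (n + m) x y \<partial>Q \<partial>marg (n + m) P)
     = (\<integral>x. \<integral>y. f1 x y * dsum n x y \<partial>Q1 \<partial>marg n P) + (\<integral>x. \<integral>y. f2 x y * dsum m x y \<partial>Q2 \<partial>marg m P)"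
  proof -
    have b1: "\<bar>f1 x y * dsum n x y\<bar> \<le> \<bar>B1\<bar> * (real n * \<rho>max)" if "x \<in> space ?An" "y \<in> space ?Bn" for x y
      unfolding abs_mult by (rule mult_mono) (use f1[OF that] dsum_nonneg dsum_le in auto)
    have b2: "\<bar>f2 x y * dsum m x y\<bar> \<le> \<bar>B2\<bar> * (real m * \<rho>max)" if "x \<in> space ?Am" "y \<in> space ?Bm" for x y
      unfolding abs_mult by (rule mult_mono) (use f2[OF that] dsum_nonneg dsum_le in auto)
    show ?thesis
      by (subst ci(2)[OF _ _ b1 b2, symmetric])
        (auto simp: f_def dsum_split distrib_left mult_ac intro!: Bochner_Integration.integral_cong)
  qed
  moreover have "(\<integral>x. \<integral>y. f x y * (ln (f x y) + lsum (n + m) y) \<partial>Q \<partial>marg (n + m) P)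
     = (\<integral>x. \<integral>y. f1 x y * (ln (f1 x y) + lsum n y) \<partial>Q1 \<partial>marg n P) + (\<integral>x. \<integral>y. f2 x y * (ln (f2 x y) + lsum m y) \<partial>Q2 \<partial>marg m P)"
  proof -
    have M1: "case_prod (\<lambda>x y. f1 x y * (ln (f1 x y) + lsum n y)) \<in> borel_measurable (?An \<Otimes>\<^sub>M ?Bn)"
      unfolding split_beta' by measurable
    have M2: "case_prod (\<lambda>x y. f2 x y * (ln (f2 x y) + lsum m y)) \<in> borel_measurable (?Am \<Otimes>\<^sub>M ?Bm)"
      unfolding split_beta' by measurable
    show ?thesis
    proof (subst ci(2)[OF M1 M2, symmetric])
      fix x y assume "x \<in> space ?An" "y \<in> space ?Bn"
      from f1[OF this] show "\<bar>f1 x y * (ln (f1 x y) + lsum n y)\<bar> \<le> x_ln_x_bound B1 + \<bar>B1\<bar> * (real n * Lmax)"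
        by (intro abs_rate_integrand_le) auto
    next
      fix x y assume "x \<in> space ?Am" "y \<in> space ?Bm"
      from f2[OF this] show "\<bar>f2 x y * (ln (f2 x y) + lsum m y)\<bar> \<le> x_ln_x_bound B2 + \<bar>B2\<bar> * (real m * Lmax)"
        by (intro abs_rate_integrand_le) auto
    next
      have "f x y * (ln (f x y) + lsum (n + m) y)
        = ?f1 x y * (ln (?f1 x y) + lsum n (window 0 n y)) * ?f2 x y
        + ?f1 x y * (?f2 x y * (ln (?f2 x y) + lsum m (window n m y)))"
        if x: "x \<in> space ?A" and y: "y \<in> space ?B" for x y
      proof -
        have "0 \<le> ?f1 x y" "0 \<le> ?f2 x y"
          using f1 f2 wA[OF x] wB[OF y] by auto
        \<comment> \<open>Where a factor vanishes both sides are 0; elsewhere the logarithm of the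
          product splits.\<close>
        then consider "?f1 x y = 0" | "?f2 x y = 0"
          | "0 < ?f1 x y" "0 < ?f2 x y"
          by linarith
        then show ?thesis
          unfolding lsum_split by cases (auto simp: f_def ln_mult algebra_simps)
      qed
      then show "(\<integral>x. \<integral>y. f x y * (ln (f x y) + lsum (n + m) y) \<partial>Q \<partial>marg (n + m) P)
        = (\<integral>x. \<integral>y. ?f1 x y * (ln (?f1 x y) + lsum n (window 0 n y)) * ?f2 x y
        + ?f1 x y * (?f2 x y * (ln (?f2 x y) + lsum m (window n m y))) \<partial>Q \<partial>marg (n + m) P)"
        by (intro Bochner_Integration.integral_cong refl) (simp_all add: spQ)
    qed
  qed
  ultimately show ?thesis
    unfolding achievable_def using cd d1 d2 r1 r2
    by (intro exI[of _ Q] exI[of _ f] exI[of _ "B1 * B2"]) auto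
qed

end

section \<open>The rate function\<close>

text \<open>Fixes one coding density so that its conditional means can be named; these functions of
  the source block are the observables to which the ergodic theorem is applied.\<close>

locale coding_kernel = coding_problem P \<rho> M \<rho>max Lmax
  for P :: "(nat \<Rightarrow> 'a::polish_space) measure" and \<rho> :: "'a \<Rightarrow> 'b::polish_space \<Rightarrow> real"
    and M :: "'b \<Rightarrow> real" and \<rho>max Lmax :: real +
  fixes m :: nat and Q :: "(nat \<Rightarrow> 'b) measure" and f :: "(nat \<Rightarrow> 'a) \<Rightarrow> (nat \<Rightarrow> 'b) \<Rightarrow> real" and B :: real
  assumes coding: "coding_density m Q f B"
begin

abbreviation source_block :: "(nat \<Rightarrow> 'a) set" where
  "source_block \<equiv> space (blk_space m borel)"

sublocale Q: prob_space Q
  using coding by (simp add: coding_density_def)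

sublocale X: prob_space "marg m P"
  by (rule prob_marg)

sublocale XQ: pair_prob_space "marg m P" Q ..

lemma sets_Q [measurable_cong]: "sets Q = sets (blk_space m borel)"
  using coding by (simp add: coding_density_def)

lemma space_Q: "space Q = space (blk_space m borel)"
  by (rule sets_eq_imp_space_eq[OF sets_Q])

lemma f_meas [measurable]: "case_prod f \<in> borel_measurable (blk_space m borel \<Otimes>\<^sub>M blk_space m borel)"
  using coding by (simp add: coding_density_def)

lemma f_range: "x \<in> source_block \<Longrightarrow> y \<in> space Q \<Longrightarrow> 0 \<le> f x y \<and> f x y \<le> B"
  using coding by (simp add: coding_density_def space_Q)

lemma f_integral: "x \<in> source_block \<Longrightarrow> (\<integral>y. f x y \<partial>Q) = 1"
  using coding by (simp add: coding_density_def)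

lemma f_section [measurable]: "x \<in> source_block \<Longrightarrow> f x \<in> borel_measurable Q"
  using measurable_Pair2[OF f_meas, of x] by simp

lemma dsum_section [measurable]: "x \<in> source_block \<Longrightarrow> dsum m x \<in> borel_measurable Q"
  using measurable_Pair2[OF dsum_meas, of x] by simp

lemma lsum_Q [measurable]: "lsum m \<in> borel_measurable Q"
  by measurable

lemma f_dsum_abs_le: "x \<in> source_block \<Longrightarrow> y \<in> space Q \<Longrightarrow> \<bar>f x y * dsum m x y\<bar> \<le> \<bar>B\<bar> * (real m * \<rho>max)"
  unfolding abs_mult by (rule mult_mono) (use f_range[of x y] dsum_nonneg dsum_le in auto)

lemma f_lsum_abs_le: "x \<in> source_block \<Longrightarrow> y \<in> space Q \<Longrightarrow> \<bar>f x y * lsum m y\<bar> \<le> \<bar>B\<bar> * (real m * Lmax)"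
  unfolding abs_mult by (rule mult_mono) (use f_range[of x y] lsum_abs_le in auto)

lemma f_ln_f_abs_le: "x \<in> source_block \<Longrightarrow> y \<in> space Q \<Longrightarrow> \<bar>f x y * ln (f x y)\<bar> \<le> x_ln_x_bound B"
  by (rule abs_x_ln_x_le_bound) (use f_range[of x y] in auto)

lemma integrable_sections:
  assumes x: "x \<in> source_block"
  shows "integrable Q (f x)" "integrable Q (\<lambda>y. f x y * dsum m x y)"
    "integrable Q (\<lambda>y. f x y * lsum m y)" "integrable Q (\<lambda>y. f x y * ln (f x y))"
proof -
  note [measurable] = f_section[OF x] dsum_section[OF x]
  show "integrable Q (f x)"
    by (rule Q.integrable_const_bound[where B=B]) (use f_range[OF x] in auto)
  show "integrable Q (\<lambda>y. f x y * dsum m x y)"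
    by (rule Q.integrable_const_bound) (use f_dsum_abs_le[OF x] in auto)
  show "integrable Q (\<lambda>y. f x y * lsum m y)"
    by (rule Q.integrable_const_bound) (use f_lsum_abs_le[OF x] in auto)
  show "integrable Q (\<lambda>y. f x y * ln (f x y))"
    by (rule Q.integrable_const_bound) (use f_ln_f_abs_le[OF x] in auto)
qed

definition dmean where "dmean x = (\<integral>y. f x y * dsum m x y \<partial>Q)"

definition lmean where "lmean x = (\<integral>y. f x y * lsum m y \<partial>Q)"

text \<open>Relative entropy with respect to \<open>Q\<close> of the conditional law with density
  \<open>f x\<close>.\<close>

definition hmean where "hmean x = (\<integral>y. f x y * ln (f x y) \<partial>Q)"

lemma means_meas [measurable]:
  "dmean \<in> borel_measurable (blk_space m borel)" "lmean \<in> borel_measurable (blk_space m borel)"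
  "hmean \<in> borel_measurable (blk_space m borel)"
  unfolding dmean_def[abs_def] lmean_def[abs_def] hmean_def[abs_def] by measurable

lemma means_abs_le:
  assumes x: "x \<in> source_block"
  shows "\<bar>dmean x\<bar> \<le> \<bar>B\<bar> * (real m * \<rho>max)" "\<bar>lmean x\<bar> \<le> \<bar>B\<bar> * (real m * Lmax)" "\<bar>hmean x\<bar> \<le> x_ln_x_bound B"
  unfolding dmean_def lmean_def hmean_def
  by (rule abs_expectation_le[OF Q.prob_space_axioms];
      use integrable_sections[OF x] f_dsum_abs_le[OF x] f_lsum_abs_le[OF x] f_ln_f_abs_le[OF x] in auto)+

lemma means_integrable: "integrable (marg m P) lmean" "integrable (marg m P) hmean"
   apply (rule X.integrable_const_bound[where B="\<bar>B\<bar> * (real m * Lmax)"]; use means_abs_le in auto)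
  apply (rule X.integrable_const_bound[where B="x_ln_x_bound B"]; use means_abs_le in auto)
  done

lemma hmean_nonneg:
  assumes x: "x \<in> source_block" shows "0 \<le> hmean x"
proof -
  have "(\<integral>y. f x y - 1 \<partial>Q) \<le> hmean x"
    unfolding hmean_def
    by (rule integral_mono) (use integrable_sections[OF x] x_ln_x_ge f_range[OF x] in auto)
  then show ?thesis using integrable_sections[OF x] f_integral[OF x] by (simp add: Q.prob_space)
qed

text \<open>Uses the mass 1 of \<open>f x\<close> rather than its upper bound, so that
  \<open>B\<close> does not appear; the lower bound common to all achievable rates rests on this
  uniformity.\<close>

lemma lmean_ge:
  assumes x: "x \<in> source_block" shows "- (real m * Lmax) \<le> lmean x"
proof -
  have "(\<integral>y. f x y * (- (real m * Lmax)) \<partial>Q) \<le> lmean x"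
    unfolding lmean_def
  proof (rule integral_mono)
    fix y assume "y \<in> space Q"
    then show "f x y * (- (real m * Lmax)) \<le> f x y * lsum m y"
      using f_range[OF x] abs_le_D2[OF lsum_abs_le[of m y]] by (intro mult_left_mono) auto
  qed (use integrable_sections[OF x] in auto)
  then show ?thesis using f_integral[OF x] by simp
qed

lemma rate_eq: "(\<integral>x. \<integral>y. f x y * (ln (f x y) + lsum m y) \<partial>Q \<partial>marg m P) = X.expectation lmean + X.expectation hmean"
proof -
  have "(\<integral>x. \<integral>y. f x y * (ln (f x y) + lsum m y) \<partial>Q \<partial>marg m P) = (\<integral>x. lmean x + hmean x \<partial>marg m P)"
    by (rule Bochner_Integration.integral_cong)
      (auto simp: lmean_def hmean_def distrib_left integrable_sections)
  then show ?thesis using means_integrable by simp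
qed

end

context coding_problem
begin

text \<open>The one-word code: \<open>Q\<close> is a point mass and f = 1, so the entropy term is 0
  and a symbol costs at most \<open>\<rho>max\<close> and \<open>Lmax\<close>. It fills the
  remainder when a block length does not divide the total length.\<close>

lemma achievable_trivial: "achievable n (real n * \<rho>max) (real n * Lmax)"
proof -
  let ?B = "blk_space n (borel :: 'b measure)"
  define y0 :: "nat \<Rightarrow> 'b" where "y0 = (\<lambda>i\<in>{..<n}. undefined)"
  have y0: "y0 \<in> space ?B" by (simp add: y0_def blk_space_def space_PiM)
  let ?Q = "return ?B y0"
  interpret Q: prob_space ?Q by (rule prob_space_return[OF y0])
  interpret PA: prob_space "marg n P" by (rule prob_marg)
  have cd: "coding_density n ?Q (\<lambda>(x :: nat \<Rightarrow> 'a) y. 1) 1"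
    using Q.prob_space by (auto simp: coding_density_def Q.prob_space_axioms)
  have dx: "dsum n x \<in> borel_measurable ?B" if "x \<in> space (blk_space n borel)" for x
    using measurable_Pair2[OF dsum_meas that] by simp
  have "(\<integral>x. \<integral>y. 1 * dsum n x y \<partial>?Q \<partial>marg n P) = (\<integral>x. dsum n x y0 \<partial>marg n P)"
    by (rule Bochner_Integration.integral_cong) (auto simp: integral_return[OF y0] dx)
  also have "\<dots> \<le> real n * \<rho>max"
    using abs_expectation_le[OF prob_marg, of "\<lambda>x. dsum n x y0" n "real n * \<rho>max"]
      measurable_Pair1[OF dsum_meas y0] dsum_nonneg dsum_le by (simp add: abs_le_iff)
  finally have 1: "(\<integral>x. \<integral>y. 1 * dsum n x y \<partial>?Q \<partial>marg n P) \<le> real n * \<rho>max" .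
  have "(\<integral>x. \<integral>y. 1 * (ln 1 + lsum n y) \<partial>?Q \<partial>marg n P) = lsum n y0"
    using PA.prob_space by (simp add: integral_return[OF y0])
  then have 2: "(\<integral>x. \<integral>y. 1 * (ln 1 + lsum n y) \<partial>?Q \<partial>marg n P) \<le> real n * Lmax"
    using lsum_abs_le[of n y0] by linarith
  show ?thesis unfolding achievable_def using cd 1 2 by blast
qed

lemma achievable_mult: "achievable n d r \<Longrightarrow> achievable (k * n) (real k * d) (real k * r)"
proof (induction k)
  case 0 then show ?case using achievable_trivial[of 0] by simp
next
  case (Suc k)
  from achievable_add[OF Suc.prems Suc.IH[OF Suc.prems]] show ?case by (simp add: algebra_simps)
qed

lemma achievableE:
  assumes "achievable n d r"
  obtains Q f B where "coding_kernel P \<rho> M \<rho>max Lmax n Q f B"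
    "(\<integral>x. \<integral>y. f x y * dsum n x y \<partial>Q \<partial>marg n P) \<le> d"
    "(\<integral>x. \<integral>y. f x y * (ln (f x y) + lsum n y) \<partial>Q \<partial>marg n P) \<le> r"
  using assms coding_problem_axioms unfolding achievable_def coding_kernel_def coding_kernel_axioms_def by blast

lemma achievable_rate_ge:
  assumes "achievable n d r" shows "- (real n * Lmax) \<le> r"
proof -
  obtain Q f B where K: "coding_kernel P \<rho> M \<rho>max Lmax n Q f B"
    and r: "(\<integral>x. \<integral>y. f x y * (ln (f x y) + lsum n y) \<partial>Q \<partial>marg n P) \<le> r"
    using assms by (rule achievableE)
  interpret K: coding_kernel P \<rho> M \<rho>max Lmax n Q f B by (rule K)
  have "- (real n * Lmax) \<le> K.X.expectation K.lmean"
    by (rule K.X.integral_ge_const[OF K.means_integrable(1)]) (auto intro!: AE_I2 K.lmean_ge)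
  moreover have "0 \<le> K.X.expectation K.hmean"
    by (rule Bochner_Integration.integral_nonneg_AE) (auto intro!: AE_I2 K.hmean_nonneg)
  ultimately show ?thesis using r unfolding K.rate_eq by linarith
qed

section \<open>Achievable pairs versus the optimal rate \<open>R_n\<close>\<close>

text \<open>A nearly optimal coupling has finite relative entropy, hence a density. Its first
  marginal makes that density a conditional one, its second marginal identifies the
  \<open>lsum\<close> term, and \<open>truncate_density\<close> makes it bounded at cost
  \<eta>.\<close>

lemma R_n_less_imp_achievable:
  assumes n: "n \<ge> 1" and D: "D \<ge> 0" and less: "R_n P \<rho> M n D < ereal r" and \<eta>: "\<eta> > 0"
  shows "achievable n (real n * D + \<eta>) (r + \<eta>)"
proof -
  let ?A = "blk_space n (borel :: 'a measure)" and ?B = "blk_space n (borel :: 'b measure)" and ?X = "marg n P"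
  from less obtain Q where pQ: "prob_space Q" and sQ[measurable_cong]: "sets Q = sets ?B"
    and Q: "I_n \<rho> n ?X Q D + ereal (\<integral>y. lsum n y \<partial>Q) < ereal r"
    unfolding R_n_def INF_less_iff lsum_def by auto
  let ?N = "?X \<Otimes>\<^sub>M Q"
  have "I_n \<rho> n ?X Q D < ereal (r - (\<integral>y. lsum n y \<partial>Q))"
    using Q by (cases "I_n \<rho> n ?X Q D") auto
  then obtain W where W: "W \<in> couplings \<rho> n ?X Q D" and H: "rel_entropy W ?N < ereal (r - (\<integral>y. lsum n y \<partial>Q))"
    unfolding I_n_def INF_less_iff by auto
  from W have pW: "prob_space W" and sW[measurable_cong]: "sets W = sets (?A \<Otimes>\<^sub>M ?B)"
    and fstW: "distr W ?A fst = ?X" and sndW: "distr W ?B snd = Q"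
    and dW: "(\<integral>\<^sup>+ w. ennreal (rho_n \<rho> n (fst w) (snd w)) \<partial>W) \<le> ennreal D"
    by (auto simp: couplings_def)
  interpret X: prob_space ?X by (rule prob_marg)
  interpret Q: prob_space Q by fact
  interpret XQ: pair_prob_space ?X Q ..
  interpret W: prob_space W by fact
  have spQ: "space Q = space ?B" using sQ by (rule sets_eq_imp_space_eq)
  have Wfin: "rel_entropy W ?N < \<infinity>" using H by (cases "rel_entropy W ?N") auto
  obtain g where g[measurable]: "g \<in> borel_measurable ?N" and g0: "\<And>z. 0 \<le> g z"
    and Wg: "W = density ?N (\<lambda>z. ennreal (g z))" and glng: "integrable ?N (\<lambda>z. g z * ln (g z))"
    and Hg: "rel_entropy W ?N = ereal (\<integral>z. g z * ln (g z) \<partial>?N)"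
    using rel_entropy_finite_density[OF XQ.P.prob_space_axioms pW Wfin] by blast
  define f where "f x y = g (x, y)" for x y
  have fm: "case_prod f \<in> borel_measurable ?N" by (simp add: f_def[abs_def])
  have d_meas[measurable]: "case_prod (dsum n) \<in> borel_measurable ?N"
    using dsum_meas by simp
  have l_meas[measurable]: "case_prod (\<lambda>x :: nat \<Rightarrow> 'a. lsum n) \<in> borel_measurable ?N"
    unfolding split_beta' by measurable
  \<comment> \<open>The integrals of the x-sections form a density of the first marginal of
    \<open>W\<close>, which is the source law, relative to the source law; hence they are 1 almost
    everywhere.\<close>
  have f1: "AE x in ?X. (\<integral>\<^sup>+y. ennreal (f x y) \<partial>Q) = 1"
  proof -
    have "density ?X (\<lambda>x. \<integral>\<^sup>+y. ennreal (f x y) \<partial>Q) = density ?X (\<lambda>_. 1)"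
    proof (rule measure_eqI)
      fix S assume "S \<in> sets (density ?X (\<lambda>x. \<integral>\<^sup>+y. ennreal (f x y) \<partial>Q))"
      then have S[measurable]: "S \<in> sets ?A" by simp
      have "emeasure ?X S = emeasure W (fst -` S \<inter> space W)"
        by (subst fstW[symmetric], rule emeasure_distr[OF _ S]) measurable
      also have "\<dots> = (\<integral>\<^sup>+z. ennreal (g z) * indicator (fst -` S \<inter> space W) z \<partial>?N)"
      proof (subst Wg, rule emeasure_density)
        have "fst \<in> measurable W ?A" by measurable
        from measurable_sets[OF this S] show "fst -` S \<inter> space W \<in> sets ?N" by (simp add: Wg)
      qed measurable
      also have "\<dots> = (\<integral>\<^sup>+z. ennreal (g z) * indicator S (fst z) \<partial>?N)"
        by (rule nn_integral_cong) (auto simp: Wg split: split_indicator)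
      also have "\<dots> = (\<integral>\<^sup>+x. \<integral>\<^sup>+y. ennreal (f x y) * indicator S x \<partial>Q \<partial>?X)"
        by (subst Q.nn_integral_fst[symmetric]) (auto simp: f_def)
      also have "\<dots> = (\<integral>\<^sup>+x. (\<integral>\<^sup>+y. ennreal (f x y) \<partial>Q) * indicator S x \<partial>?X)"
        by (rule nn_integral_cong, rule nn_integral_multc) (use measurable_Pair2[OF fm] in simp)
      finally show "emeasure (density ?X (\<lambda>x. \<integral>\<^sup>+y. ennreal (f x y) \<partial>Q)) S = emeasure (density ?X (\<lambda>_. 1)) S"
        using fm by (simp add: emeasure_density density_1)
    qed simp
    then show ?thesis by (rule X.density_unique[rotated 2]) (use fm in measurable)
  qed
  have flnf: "integrable ?N (\<lambda>(x, y). f x y * ln (f x y))" using glng by (simp add: f_def split_beta')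
  define K where "K = max (real n * \<rho>max) (real n * Lmax)"
  have dbd: "\<bar>dsum n x y\<bar> \<le> K" and lbd: "\<bar>lsum n y\<bar> \<le> K" for x y
    using dsum_nonneg[of n x y] dsum_le[of n x y] lsum_abs_le[of n y] by (auto simp: K_def)
  obtain f' B where f'm: "case_prod f' \<in> borel_measurable ?N"
    and f'B: "\<forall>x\<in>space ?X. \<forall>y\<in>space Q. 0 \<le> f' x y \<and> f' x y \<le> B" and f'1: "\<forall>x\<in>space ?X. (\<integral>y. f' x y \<partial>Q) = 1"
    and f'd: "(\<integral>x. \<integral>y. f' x y * dsum n x y \<partial>Q \<partial>?X) \<le> (\<integral>(x, y). f x y * dsum n x y \<partial>?N) + \<eta>"
    and f'r: "(\<integral>x. \<integral>y. f' x y * (ln (f' x y) + lsum n y) \<partial>Q \<partial>?X)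
       \<le> (\<integral>(x, y). f x y * ln (f x y) \<partial>?N) + (\<integral>(x, y). f x y * lsum n y \<partial>?N) + \<eta>"
    using truncate_density[OF prob_marg pQ fm _ f1 flnf d_meas l_meas dbd lbd \<eta>] g0 by (auto simp: f_def)
  have cd: "coding_density n Q f' B"
    using f'm f'B f'1 pQ sQ spQ by (auto simp: coding_density_def cong: measurable_cong_sets)
  have "(\<integral>(x, y). f x y * dsum n x y \<partial>?N) \<le> real n * D"
  proof -
    have "(\<integral>\<^sup>+z. ennreal (rho_n \<rho> n (fst z) (snd z)) \<partial>W) = (\<integral>\<^sup>+z. ennreal (g z) * ennreal (rho_n \<rho> n (fst z) (snd z)) \<partial>?N)"
      unfolding Wg by (rule nn_integral_density) (use d_meas in \<open>auto simp: rho_n_dsum split_beta'\<close>)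
    also have "\<dots> = (\<integral>\<^sup>+z. ennreal (g z * rho_n \<rho> n (fst z) (snd z)) \<partial>?N)"
      by (simp only: ennreal_mult'[OF g0])
    finally have le: "(\<integral>\<^sup>+z. ennreal (g z * rho_n \<rho> n (fst z) (snd z)) \<partial>?N) \<le> ennreal D" using dW by simp
    have "(\<integral>z. g z * rho_n \<rho> n (fst z) (snd z) \<partial>?N) = enn2real (\<integral>\<^sup>+z. ennreal (g z * rho_n \<rho> n (fst z) (snd z)) \<partial>?N)"
      using d_meas g0 dsum_nonneg by (intro integral_eq_nn_integral) (auto simp: rho_n_dsum split_beta')
    also have "\<dots> \<le> D" using le D by (simp add: enn2real_leI)
    finally have "(\<integral>z. g z * dsum n (fst z) (snd z) / real n \<partial>?N) \<le> D" by (simp add: rho_n_dsum)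
    then show ?thesis using n by (simp add: f_def split_beta' field_simps)
  qed
  moreover have "(\<integral>(x, y). f x y * lsum n y \<partial>?N) = (\<integral>y. lsum n y \<partial>Q)"
  proof -
    have "(\<integral>y. lsum n y \<partial>Q) = (\<integral>z. lsum n (snd z) \<partial>W)"
      by (subst sndW[symmetric], rule integral_distr) measurable
    also have "\<dots> = (\<integral>z. g z * lsum n (snd z) \<partial>?N)"
      unfolding Wg using g0 by (subst integral_density) auto
    finally show ?thesis by (simp add: f_def split_beta')
  qed
  moreover have "(\<integral>(x, y). f x y * ln (f x y) \<partial>?N) < r - (\<integral>y. lsum n y \<partial>Q)"
    using H Hg by (simp add: f_def split_beta')
  ultimately show ?thesis
    unfolding achievable_def using cd f'd f'r by (intro exI[of _ Q] exI[of _ f'] exI[of _ B]) auto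
qed

text \<open>Weighting the product of source law and \<open>Q\<close> by f gives a coupling whose
  output marginal Q' is the competitor in \<open>R_n\<close>; by
  \<open>marginal_rel_entropy_le\<close> its relative entropy is no larger than the one computed
  against \<open>Q\<close>.\<close>

lemma achievable_imp_R_n_le:
  assumes n: "n \<ge> 1" and a: "achievable n (real n * D) r"
  shows "R_n P \<rho> M n D \<le> ereal r"
proof -
  let ?A = "blk_space n (borel :: 'a measure)" and ?B = "blk_space n (borel :: 'b measure)" and ?X = "marg n P"
  obtain Q f B where K: "coding_kernel P \<rho> M \<rho>max Lmax n Q f B"
    and d: "(\<integral>x. \<integral>y. f x y * dsum n x y \<partial>Q \<partial>?X) \<le> real n * D"
    and r: "(\<integral>x. \<integral>y. f x y * (ln (f x y) + lsum n y) \<partial>Q \<partial>?X) \<le> r"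
    using a by (rule achievableE)
  let ?f = "\<lambda>z. f (fst z) (snd z)" and ?N = "?X \<Otimes>\<^sub>M Q"
  interpret K: coding_kernel P \<rho> M \<rho>max Lmax n Q f B by (rule K)
  note f = K.f_range and spQ = K.space_Q and [measurable_cong] = K.sets_Q
  have fm: "case_prod f \<in> borel_measurable ?N" by measurable
  have fm': "?f \<in> borel_measurable ?N" using fm by (simp add: split_beta')
  have d_meas[measurable]: "(\<lambda>z. dsum n (fst z) (snd z)) \<in> borel_measurable ?N"
    using dsum_meas by (simp add: split_beta')
  define W where "W = density ?N (\<lambda>z. ennreal (?f z))"
  have "prob_space W" "distr W ?X fst = ?X" "prob_space (distr W Q snd)"
    and H: "rel_entropy W (?X \<Otimes>\<^sub>M distr W Q snd) \<le> ereal (\<integral>z. ?f z * ln (?f z) \<partial>?N)"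
    unfolding W_def
    by (rule marginal_rel_entropy_le[OF prob_marg K.Q.prob_space_axioms fm]; use f K.f_integral in auto)+
  note W = this
  define Q' where "Q' = distr W ?B snd"
  have Q'_eq: "distr W Q snd = Q'" unfolding Q'_def by (rule distr_cong) (auto simp: K.sets_Q)
  have fstW: "distr W ?A fst = ?X" using W(2) by (subst distr_cong[where L="?X" and g=fst and K=W]) auto
  have sW[measurable_cong]: "sets W = sets (?A \<Otimes>\<^sub>M ?B)"
    unfolding W_def sets_density by (rule sets_pair_measure_cong) (auto simp: K.sets_Q)
  have i1: "integrable ?N (\<lambda>z. ?f z * dsum n (fst z) (snd z))"
    by (rule K.XQ.P.integrable_const_bound)
      (use K.f_dsum_abs_le fm' in \<open>auto intro!: AE_I2 simp: space_pair_measure\<close>)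
  have i2: "integrable ?N (\<lambda>z. ?f z * lsum n (snd z))"
    by (rule K.XQ.P.integrable_const_bound)
      (use K.f_lsum_abs_le fm' in \<open>auto intro!: AE_I2 simp: space_pair_measure\<close>)
  have i3: "integrable ?N (\<lambda>z. ?f z * ln (?f z))"
    by (rule K.XQ.P.integrable_const_bound)
      (use K.f_ln_f_abs_le fm' in \<open>auto intro!: AE_I2 simp: space_pair_measure\<close>)
  have iter: "(\<integral>x. \<integral>y. F x y \<partial>Q \<partial>?X) = (\<integral>z. F (fst z) (snd z) \<partial>?N)"
    if "integrable ?N (\<lambda>z. F (fst z) (snd z))" for F :: "(nat \<Rightarrow> 'a) \<Rightarrow> (nat \<Rightarrow> 'b) \<Rightarrow> real"
    using K.XQ.integral_fst[of F] that by (auto simp: split_beta')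
  have "(\<integral>\<^sup>+ w. ennreal (rho_n \<rho> n (fst w) (snd w)) \<partial>W) \<le> ennreal D"
  proof -
    have "(\<integral>\<^sup>+ w. ennreal (rho_n \<rho> n (fst w) (snd w)) \<partial>W) = (\<integral>\<^sup>+z. ennreal (?f z) * ennreal (rho_n \<rho> n (fst z) (snd z)) \<partial>?N)"
      unfolding W_def rho_n_dsum by (rule nn_integral_density) (use fm' in measurable)
    also have "\<dots> = (\<integral>\<^sup>+z. ennreal (?f z * dsum n (fst z) (snd z) / real n) \<partial>?N)"
      by (rule nn_integral_cong) (use f spQ in \<open>auto simp: rho_n_dsum space_pair_measure simp flip: ennreal_mult'\<close>)
    also have "\<dots> = ennreal (\<integral>z. ?f z * dsum n (fst z) (snd z) / real n \<partial>?N)"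
      by (rule nn_integral_eq_integral)
        (use i1 f spQ dsum_nonneg in \<open>auto intro!: AE_I2 simp: space_pair_measure\<close>)
    also have "\<dots> \<le> ennreal D"
      by (rule ennreal_leI) (use d iter[OF i1] n in \<open>simp add: field_simps\<close>)
    finally show ?thesis .
  qed
  then have "W \<in> couplings \<rho> n ?X Q' D"
    using W(1) sW fstW by (auto simp: couplings_def Q'_def)
  then have I: "I_n \<rho> n ?X Q' D \<le> ereal (\<integral>z. ?f z * ln (?f z) \<partial>?N)"
    unfolding I_n_def using H by (intro INF_lower2) (auto simp: Q'_eq)
  have L: "(\<integral>y. (\<Sum>i<n. ln (M (y i))) \<partial>Q') = (\<integral>z. ?f z * lsum n (snd z) \<partial>?N)"
  proof -
    have "(\<integral>y. lsum n y \<partial>Q') = (\<integral>z. lsum n (snd z) \<partial>W)"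
      unfolding Q'_def by (rule integral_distr) measurable
    also have "\<dots> = (\<integral>z. ?f z *\<^sub>R lsum n (snd z) \<partial>?N)"
      unfolding W_def by (rule integral_density) (use fm' f spQ in \<open>auto intro!: AE_I2 simp: space_pair_measure\<close>)
    finally show ?thesis by (simp add: lsum_def)
  qed
  have "Q' \<in> {Q. prob_space Q \<and> sets Q = sets ?B}"
    using W(3)[unfolded Q'_eq] by (simp add: Q'_def)
  then have "R_n P \<rho> M n D \<le> I_n \<rho> n ?X Q' D + ereal (\<integral>y. (\<Sum>i<n. ln (M (y i))) \<partial>Q')"
    unfolding R_n_def by (rule INF_lower)
  also have "\<dots> \<le> ereal (\<integral>z. ?f z * ln (?f z) \<partial>?N) + ereal (\<integral>z. ?f z * lsum n (snd z) \<partial>?N)"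
    unfolding L by (rule add_right_mono[OF I])
  also have "\<dots> = ereal (\<integral>z. ?f z * (ln (?f z) + lsum n (snd z)) \<partial>?N)"
    using i2 i3 by (simp add: distrib_left)
  also have "\<dots> \<le> ereal r"
    using r iter[of "\<lambda>x y. f x y * (ln (f x y) + lsum n y)"] i2 i3 by (simp add: distrib_left)
  finally show ?thesis .
qed

text \<open>Fekete's argument: k = j n + q, with j copies of the given code and the one-word code on
  the q < n left-over symbols. The strict slack in distortion pays for the remainder once j is
  large.\<close>

lemma R_n_eventually_le:
  assumes a: "achievable n d r" and n: "n \<ge> 1" and D: "D \<ge> 0" and d: "d < real n * D" and \<delta>: "\<delta> > 0"
  shows "\<forall>\<^sub>F k in sequentially. R_n P \<rho> M k D / ereal (real k) \<le> ereal (r / real n + \<delta>)"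
proof -
  define gap where "gap = real n * D - d"
  have gap: "gap > 0" using d by (simp add: gap_def)
  \<comment> \<open>J copies save J gap in distortion, at least the worst cost n \<rho>max of the
    remainder.\<close>
  obtain J :: nat where J: "real n * \<rho>max \<le> real J * gap"
    using reals_Archimedean3[OF gap] by (metis less_imp_le)
  \<comment> \<open>c bounds the excess rate caused by the remainder; N is chosen so that c \<le> k
    \<delta> as soon as k \<ge> N.\<close>
  define c where "c = real n * (Lmax + \<bar>r / real n\<bar>)"
  have c0: "0 \<le> c" using Lmax_nonneg by (simp add: c_def)
  obtain N :: nat where N: "c \<le> real N * \<delta>"
    using reals_Archimedean3[OF \<delta>] by (metis less_imp_le)
  show ?thesis
    unfolding eventually_sequentially
  proof (intro exI[of _ "J * n + N + 1"] allI impI)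
    fix k assume k: "J * n + N + 1 \<le> k"
    define j q where "j = k div n" and "q = k mod n"
    have kjq: "k = j * n + q" by (simp add: j_def q_def)
    have q: "q < n" using n by (simp add: q_def)
    have jJ: "J \<le> j" using k n by (simp add: j_def less_eq_div_iff_mult_less_eq)
    have ach: "achievable k (real j * d + real q * \<rho>max) (real j * r + real q * Lmax)"
      unfolding kjq by (intro achievable_add achievable_mult a achievable_trivial)
    have "real q * \<rho>max \<le> real n * \<rho>max" using q rhomax_nonneg by (intro mult_right_mono) auto
    also have "\<dots> \<le> real j * gap" using J jJ gap by (meson less_imp_le mult_right_mono of_nat_mono order_trans)
    also have "\<dots> \<le> real j * gap + real q * D" using D by simp
    finally have "real j * d + real q * \<rho>max \<le> real k * D"
      by (simp add: kjq gap_def algebra_simps)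
    with ach have ach': "achievable k (real k * D) (real j * r + real q * Lmax)"
      by (rule achievable_mono) simp
    have k1: "k \<ge> 1" using k by simp
    have "real j * r + real q * Lmax = real k * (r / real n) + real q * (Lmax - r / real n)"
      using n by (simp add: kjq field_simps)
    also have "real q * (Lmax - r / real n) \<le> c"
    proof -
      have "real q * (Lmax - r / real n) \<le> real q * (Lmax + \<bar>r / real n\<bar>)"
        by (rule mult_left_mono) (use abs_ge_minus_self[of "r / real n"] in linarith, simp)
      also have "\<dots> \<le> c"
        unfolding c_def by (rule mult_right_mono) (use q Lmax_nonneg in auto)
      finally show ?thesis .
    qed
    also have "c \<le> real k * \<delta>"
    proof -
      have "real N * \<delta> \<le> real k * \<delta>" using k \<delta> by (intro mult_right_mono) auto
      then show ?thesis using N by linarith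
    qed
    finally have "real j * r + real q * Lmax \<le> real k * (r / real n + \<delta>)" by (simp add: distrib_left)
    with achievable_imp_R_n_le[OF k1 ach'] have "R_n P \<rho> M k D \<le> ereal (real k * (r / real n + \<delta>))"
      by (meson ereal_less_eq(3) order_trans)
    then have "R_n P \<rho> M k D / ereal (real k) \<le> ereal (real k * (r / real n + \<delta>)) / ereal (real k)"
      by (rule ereal_divide_right_mono) (use k1 in simp)
    also have "\<dots> = ereal (r / real n + \<delta>)" using k1 by simp
    finally show "R_n P \<rho> M k D / ereal (real k) \<le> ereal (r / real n + \<delta>)" .
  qed
qed

lemma R_n_ge:
  assumes n: "n \<ge> 1" and D: "D \<ge> 0" shows "ereal (- Lmax) \<le> R_n P \<rho> M n D / ereal (real n)"
proof -
  have "ereal (- (real n * Lmax)) \<le> R_n P \<rho> M n D"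
  proof (rule ereal_le_real)
    fix z assume "R_n P \<rho> M n D \<le> ereal z"
    have "- (real n * Lmax) \<le> z + \<eta>" if \<eta>: "\<eta> > 0" for \<eta>
    proof -
      have "R_n P \<rho> M n D < ereal (z + \<eta> / 2)"
        using \<open>R_n P \<rho> M n D \<le> ereal z\<close> \<eta> by (simp add: order_le_less_trans)
      from R_n_less_imp_achievable[OF n D this, of "\<eta> / 2"] \<eta>
      have "achievable n (real n * D + \<eta> / 2) (z + \<eta> / 2 + \<eta> / 2)" by simp
      from achievable_rate_ge[OF this] show ?thesis by simp
    qed
    then have "- (real n * Lmax) \<le> z" by (rule field_le_epsilon)
    then show "ereal (- (real n * Lmax)) \<le> ereal z" by simp
  qed
  then have "ereal (- (real n * Lmax)) / ereal (real n) \<le> R_n P \<rho> M n D / ereal (real n)"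
    by (rule ereal_divide_right_mono) (use n in simp)
  then show ?thesis using n by simp
qed

text \<open>By contraposition, because \<open>R\<close> is a bare \<open>lim\<close> whose
  convergence is proved only later: if every \<open>R_n\<close> were infinite, the limit would exist
  and be infinite.\<close>

lemma R_finite_imp_achievable:
  assumes D: "D \<ge> 0" and R: "R P \<rho> M D < \<infinity>"
  shows "\<exists>n\<ge>1. \<exists>r. \<forall>\<eta>>0. achievable n (real n * D + \<eta>) (r + \<eta>)"
proof -
  have "\<exists>n\<ge>1. R_n P \<rho> M n D < \<infinity>"
  proof (rule ccontr)
    assume "\<not> ?thesis"
    then have "R_n P \<rho> M n D / ereal (real n) = \<infinity>" if "n \<ge> 1" for n
      using that by (auto simp: not_less)
    then have "(\<lambda>n. R_n P \<rho> M n D / ereal (real n)) \<longlonglongrightarrow> \<infinity>"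
      by (intro tendsto_eventually) (auto simp: eventually_sequentially)
    then have "R P \<rho> M D = \<infinity>" unfolding R_def by (rule limI)
    with R show False by simp
  qed
  then obtain n where n: "n \<ge> 1" "R_n P \<rho> M n D < \<infinity>" by blast
  then obtain r where "R_n P \<rho> M n D < ereal r" using ereal_dense2 by blast
  then show ?thesis using R_n_less_imp_achievable[OF n(1) D] n(1) by blast
qed

text \<open>The limit is the infimum \<alpha> of \<open>R_n / n\<close>. A code close to it may
  exceed distortion D slightly, so one code of strictly smaller distortion, obtained from some D' <
  D of finite rate, is appended to many copies of it: the saved distortion absorbs the excess, and
  the higher rate is diluted. The strict slack so gained feeds \<open>R_n_eventually_le\<close>,
  which gives convergence to \<alpha> and hence the value of \<open>R\<close>.\<close>

lemma rate_function_achievable: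
  assumes D: "ereal D > D_min P \<rho> M"
  shows "\<exists>R0. R P \<rho> M D = ereal R0 \<and> (\<forall>\<delta>>0. \<exists>m\<ge>1. \<exists>d r. achievable m d r \<and> d < real m * D \<and> r < real m * (R0 + \<delta>))"
proof -
  obtain D' where D': "D' \<ge> 0" "D' < D" "R P \<rho> M D' < \<infinity>"
    using D unfolding D_min_def Inf_less_iff by auto
  have D0: "D \<ge> 0" using D' by simp
  obtain m' r' where m': "m' \<ge> 1" and ar': "\<And>\<eta>. \<eta> > 0 \<Longrightarrow> achievable m' (real m' * D' + \<eta>) (r' + \<eta>)"
    using R_finite_imp_achievable[OF D'(1,3)] by blast
  \<comment> \<open>Half of the distortion gap between D' and D is spent on making the pair
    achievable; the other half remains as the slack g.\<close>
  define \<eta>0 where "\<eta>0 = real m' * (D - D') / 2"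
  have \<eta>0: "\<eta>0 > 0" using m' D' by (simp add: \<eta>0_def)
  define d' s' g where "d' = real m' * D' + \<eta>0" and "s' = r' + \<eta>0" and "g = real m' * D - d'"
  have a': "achievable m' d' s'" unfolding d'_def s'_def by (rule ar'[OF \<eta>0])
  have "g = \<eta>0" by (simp add: g_def d'_def \<eta>0_def field_simps)
  with \<eta>0 have g: "g > 0" by simp
  define u where "u n = R_n P \<rho> M n D / ereal (real n)" for n
  define \<alpha> where "\<alpha> = (INF n\<in>{1..}. u n)"
  have lower: "n \<ge> 1 \<Longrightarrow> \<alpha> \<le> u n" for n unfolding \<alpha>_def by (rule INF_lower) simp
  have "\<forall>\<^sub>F k in sequentially. u k \<le> ereal (s' / real m' + 1)"
    unfolding u_def by (rule R_n_eventually_le[OF a' m' D0]) (use g in \<open>simp_all add: g_def\<close>)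
  then obtain k where "k \<ge> 1" "u k \<le> ereal (s' / real m' + 1)"
    unfolding eventually_sequentially by (metis nat_le_linear)
  then have "\<alpha> \<le> ereal (s' / real m' + 1)" using lower order_trans by blast
  moreover have "ereal (- Lmax) \<le> \<alpha>"
    unfolding \<alpha>_def u_def by (rule INF_greatest) (use R_n_ge[OF _ D0] in simp)
  ultimately obtain R0 where R0: "\<alpha> = ereal R0" by (cases \<alpha>) auto
  have M1: "\<exists>m\<ge>1. \<exists>d r. achievable m d r \<and> d < real m * D \<and> r < real m * (R0 + \<delta>)" if \<delta>: "\<delta> > 0" for \<delta>
  proof -
    have "\<alpha> < ereal (R0 + \<delta> / 2)" using R0 \<delta> by simp
    then obtain n where n: "n \<ge> 1" and un: "u n < ereal (R0 + \<delta> / 2)"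
      unfolding \<alpha>_def INF_less_iff by auto
    define r0 where "r0 = real n * (R0 + \<delta> / 2)"
    have Rn: "R_n P \<rho> M n D < ereal r0"
      using un n unfolding u_def r0_def by (cases "R_n P \<rho> M n D") (auto simp: field_simps)
    have "0 < real n * \<delta> / 2" using n \<delta> by simp
    \<comment> \<open>The rate slack n \<delta> / 2 of each copy must add up to more than the
      surplus rate of the appended code plus the g / 2 lost through \<eta>.\<close>
    from reals_Archimedean3[OF this] obtain j :: nat where j: "g / 2 + s' - real m' * (R0 + \<delta>) < real j * (real n * \<delta> / 2)"
      by blast
    define J where "J = Suc j"
    have J: "g / 2 + s' - real m' * (R0 + \<delta>) < real J * (real n * \<delta> / 2)"
      using j n \<delta> by (simp add: J_def distrib_right) (smt (verit) mult_nonneg_nonneg of_nat_0_le_iff)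
    \<comment> \<open>J copies overshoot the distortion by J \<eta> = g / 2, less than the slack g
      of the appended code.\<close>
    define \<eta> where "\<eta> = g / (2 * real J)"
    have "real J > 0" by (simp add: J_def)
    then have \<eta>: "\<eta> > 0" "real J * \<eta> = g / 2" using g by (simp_all add: \<eta>_def)
    have "achievable (J * n + m') (real J * (real n * D + \<eta>) + d') (real J * (r0 + \<eta>) + s')"
      by (intro achievable_add achievable_mult a' R_n_less_imp_achievable n D0 Rn \<eta>)
    moreover have "real J * (real n * D + \<eta>) + d' < real (J * n + m') * D"
    proof -
      have "real J * (real n * D + \<eta>) + d' = real J * real n * D + real J * \<eta> + d'" by (simp add: algebra_simps)
      also have "\<dots> < real J * real n * D + g + d'" using \<eta> g by simp
      also have "\<dots> = real (J * n + m') * D" by (simp add: g_def algebra_simps)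
      finally show ?thesis .
    qed
    moreover have "real J * (r0 + \<eta>) + s' < real (J * n + m') * (R0 + \<delta>)"
    proof -
      have "real J * (r0 + \<eta>) + s' = real J * r0 + g / 2 + s'" using \<eta> by (simp add: algebra_simps)
      also have "\<dots> < real J * r0 + real J * (real n * \<delta> / 2) + real m' * (R0 + \<delta>)" using J by linarith
      also have "\<dots> = real (J * n + m') * (R0 + \<delta>)" by (simp add: r0_def algebra_simps)
      finally show ?thesis .
    qed
    ultimately show ?thesis using m' by (intro exI[of _ "J * n + m'"]) auto
  qed
  have "u \<longlonglongrightarrow> \<alpha>"
  proof (rule order_tendstoI)
    fix a assume a: "a < \<alpha>"
    show "\<forall>\<^sub>F n in sequentially. a < u n"
      unfolding eventually_sequentially by (rule exI[of _ 1]) (use lower a less_le_trans in blast)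
  next
    fix a assume "\<alpha> < a"
    then obtain e where e: "\<alpha> < ereal e" "ereal e < a" using ereal_dense2 by blast
    \<comment> \<open>Halved because \<delta> is spent twice: in the rate of the code and in the
      extension to arbitrary lengths.\<close>
    define \<delta> where "\<delta> = (e - R0) / 2"
    have \<delta>: "\<delta> > 0" using e R0 by (simp add: \<delta>_def)
    obtain m d r where m: "m \<ge> 1" "achievable m d r" "d < real m * D" "r < real m * (R0 + \<delta>)"
      using M1[OF \<delta>] by blast
    have "r / real m < R0 + \<delta>" using m by (simp add: field_simps)
    then have "ereal (r / real m + \<delta>) < a" using e \<delta>
      by (intro le_less_trans[OF _ e(2)]) (simp add: \<delta>_def field_simps)
    with R_n_eventually_le[OF m(2,1) D0 m(3) \<delta>]
    show "\<forall>\<^sub>F n in sequentially. u n < a" unfolding u_def by (auto elim!: eventually_mono)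
  qed
  then have "R P \<rho> M D = \<alpha>" unfolding R_def u_def by (rule limI)
  then show ?thesis using R0 M1 by auto
qed

end

section \<open>Codebooks\<close>

text \<open>Controls the second moment of the log-likelihood under its own density. For t \<le> 1
  the left side is the square of 2 sqrt t ln(sqrt t), whose absolute value is at most 4; for t > 1
  it increases with t.\<close>

lemma x_ln_x_squared_le:
  fixes t :: real assumes "0 \<le> t" "t \<le> B" shows "t * (ln t)\<^sup>2 \<le> 16 + \<bar>B\<bar> * (ln \<bar>B\<bar>)\<^sup>2"
proof (cases "t \<le> 1")
  case True
  have s: "0 \<le> sqrt t" "sqrt t \<le> 1" using True assms by auto
  have "t * (ln t)\<^sup>2 = (2 * (sqrt t * ln (sqrt t)))\<^sup>2"
    using assms by (cases "t = 0") (simp_all add: ln_sqrt power_mult_distrib)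
  also have "\<dots> \<le> 4\<^sup>2"
  proof -
    have "\<bar>sqrt t * ln (sqrt t)\<bar> \<le> 2 * sqrt (sqrt t)" by (rule abs_x_ln_x_le_sqrt[OF s])
    moreover have "sqrt (sqrt t) \<le> 1" using s by simp
    ultimately have "\<bar>sqrt t * ln (sqrt t)\<bar> \<le> 2" by linarith
    then show ?thesis unfolding abs_le_square_iff[symmetric] by (simp add: abs_mult)
  qed
  also have "\<dots> \<le> 16 + \<bar>B\<bar> * (ln \<bar>B\<bar>)\<^sup>2" by simp
  finally show ?thesis .
next
  case False
  then have "t * (ln t)\<^sup>2 \<le> \<bar>B\<bar> * (ln \<bar>B\<bar>)\<^sup>2"
    using assms by (intro mult_mono power_mono) auto
  then show ?thesis by simp
qed

section \<open>Layout of the blocks inside a codeword\<close>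

text \<open>The m segments of L blocks of length m occupy m m L positions; the additional m leaves
  room for the skipped symbols.\<close>

locale block_layout =
  fixes m L n :: nat
  assumes m: "m \<ge> 1" and L: "L \<ge> 1" and n: "m * m * L + m \<le> n"
begin

text \<open>One symbol is skipped after every \<open>L\<close> blocks, so block \<open>i\<close> sits at phase \<open>i div L\<close> modulo \<open>m\<close>.\<close>
definition start :: "nat \<Rightarrow> nat" where "start i = i * m + i div L"

definition pos :: "nat \<times> nat \<Rightarrow> nat" where "pos = (\<lambda>(i, j). start i + j)"

definition slots :: "(nat \<times> nat) set" where "slots = {..<m * L} \<times> {..<m}"

text \<open>Positions outside all blocks receive an arbitrary symbol. Their number does not grow
  with the layout, and each is charged the worst case in \<open>sum_embed_le\<close>.\<close>

definition embed :: "(nat \<Rightarrow> nat \<Rightarrow> 'b) \<Rightarrow> nat \<Rightarrow> 'b" where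
  "embed y = (\<lambda>t\<in>{..<n}. if t \<in> pos ` slots
     then y (fst (inv_into slots pos t)) (snd (inv_into slots pos t)) else undefined)"

lemma start_step: "i < i' \<Longrightarrow> start i + m \<le> start i'"
proof -
  assume "i < i'"
  then have "Suc i * m \<le> i' * m" "i div L \<le> i' div L" by (intro mult_le_mono1 div_le_mono; simp)+
  then show ?thesis unfolding start_def by simp
qed

lemma inj_pos: "inj_on pos slots"
proof (rule inj_onI, clarsimp simp: pos_def slots_def)
  fix i j i' j' assume "j < m" "j' < m" "start i + j = start i' + j'"
  then show "i = i' \<and> j = j'"
    using start_step[of i i'] start_step[of i' i] by (cases i i' rule: linorder_cases) auto
qed

lemma pos_less: "z \<in> slots \<Longrightarrow> pos z < n"
proof (clarsimp simp: slots_def pos_def start_def)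
  fix i j assume ij: "i < m * L" "j < m"
  have "i div L < m" using ij L by (simp add: less_mult_imp_div_less)
  moreover have "Suc i * m \<le> m * L * m" using ij by (intro mult_le_mono1) simp
  moreover have "m * L * m = m * m * L" by (simp add: ac_simps)
  ultimately show "i * m + i div L + j < n" using ij n by simp
qed

lemma sum_slots:
  fixes F :: "nat \<Rightarrow> real"
  shows "(\<Sum>t<n. F t) = (\<Sum>i<m * L. \<Sum>j<m. F (start i + j)) + sum F ({..<n} - pos ` slots)"
    and "card ({..<n} - pos ` slots) = n - m * m * L"
proof -
  have sub: "pos ` slots \<subseteq> {..<n}" using pos_less by auto
  have "(\<Sum>t<n. F t) = sum F ({..<n} - pos ` slots) + sum F (pos ` slots)"
    by (rule sum.subset_diff[OF sub]) simp
  also have "sum F (pos ` slots) = (\<Sum>z\<in>slots. F (pos z))" by (simp add: sum.reindex[OF inj_pos])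
  also have "\<dots> = (\<Sum>i<m * L. \<Sum>j<m. F (start i + j))"
    unfolding slots_def by (subst sum.cartesian_product) (simp add: pos_def split_beta')
  finally show "(\<Sum>t<n. F t) = (\<Sum>i<m * L. \<Sum>j<m. F (start i + j)) + sum F ({..<n} - pos ` slots)" by simp
  have "card (pos ` slots) = card slots" by (rule card_image[OF inj_pos])
  also have "\<dots> = m * m * L" by (simp add: slots_def card_cartesian_product ac_simps)
  finally have "card (pos ` slots) = m * m * L" .
  then show "card ({..<n} - pos ` slots) = n - m * m * L"
    using card_Diff_subset[of "pos ` slots" "{..<n}"] sub by (simp add: finite_subset[OF sub])
qed

lemma embed_pos: "i < m * L \<Longrightarrow> j < m \<Longrightarrow> embed y (start i + j) = y i j"
proof -
  assume ij: "i < m * L" "j < m"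
  then have z: "(i, j) \<in> slots" by (simp add: slots_def)
  have "pos (i, j) < n" "pos (i, j) \<in> pos ` slots" using pos_less[OF z] z by auto
  moreover have "inv_into slots pos (pos (i, j)) = (i, j)" by (rule inv_into_f_f[OF inj_pos z])
  ultimately have "embed y (pos (i, j)) = y i j" by (simp add: embed_def)
  then show ?thesis by (simp add: pos_def)
qed

lemma embed_in: "embed y \<in> {..<n} \<rightarrow>\<^sub>E UNIV"
  by (simp add: embed_def)

lemma sum_embed_le:
  fixes g :: "nat \<Rightarrow> 'b \<Rightarrow> real"
  assumes "\<And>t b. g t b \<le> G"
  shows "(\<Sum>t<n. g t (embed y t)) \<le> (\<Sum>i<m * L. \<Sum>j<m. g (start i + j) (y i j)) + real (n - m * m * L) * G"
proof -
  have "(\<Sum>t<n. g t (embed y t)) = (\<Sum>i<m * L. \<Sum>j<m. g (start i + j) (embed y (start i + j)))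
      + (\<Sum>t\<in>{..<n} - pos ` slots. g t (embed y t))"
    by (rule sum_slots(1))
  also have "(\<Sum>i<m * L. \<Sum>j<m. g (start i + j) (embed y (start i + j))) = (\<Sum>i<m * L. \<Sum>j<m. g (start i + j) (y i j))"
    by (intro sum.cong refl) (simp add: embed_pos)
  also have "(\<Sum>t\<in>{..<n} - pos ` slots. g t (embed y t)) \<le> real (n - m * m * L) * G"
    using sum_bounded_above[of "{..<n} - pos ` slots" "\<lambda>t. g t (embed y t)" G] assms
    by (simp add: sum_slots(2))
  finally show ?thesis by simp
qed

end

section \<open>Codebooks for a fixed layout\<close>

context coding_kernel
begin

text \<open>Greedy covering of the typical set \<open>A\<close>, with
  \<open>product_ball_lower_bound\<close> supplying the probability p that a random block sequence
  is good. \<open>U\<close> is the part of \<open>A\<close> left uncovered; the chosen block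
  sequences become codewords through \<open>embed\<close>.\<close>

lemma codebook_exists:
  fixes a b c :: real
  assumes lay: "block_layout m L n" and \<delta>: "\<delta> > 0"
    and large: "6 * ((real m * \<rho>max)\<^sup>2 + (real m * Lmax)\<^sup>2 + (16 + \<bar>B\<bar> * (ln \<bar>B\<bar>)\<^sup>2)) \<le> real (m * L) * \<delta>\<^sup>2"
    and c: "c \<ge> 0"
  defines "A \<equiv> {x. (\<Sum>i<m*L. dmean (window (i * m + i div L) m x)) \<le> real (m * L) * a
      \<and> (\<Sum>i<m*L. lmean (window (i * m + i div L) m x)) \<le> real (m * L) * b
      \<and> (\<Sum>i<m*L. hmean (window (i * m + i div L) m x)) \<le> real (m * L) * c}"
  shows "\<exists>C U. finite C \<and> C \<subseteq> {..<n} \<rightarrow>\<^sub>E UNIV \<and> U \<in> sets P \<and> prob U \<le> exp (- real n)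
    \<and> (\<forall>x\<in>A - U. \<exists>y\<in>C. dsum n x y \<le> real (m * L) * (a + \<delta>) + real (n - m * m * L) * \<rho>max)
    \<and> Mn M n C \<le> 3 * real n * exp (real (m * L) * (b + c + 2 * \<delta>) + real (n - m * m * L) * Lmax)"
proof -
  interpret block_layout m L n by fact
  define k where "k = m * L"
  have k0: "k > 0" using m L by (simp add: k_def)
  define w where "w i x = window (start i) m x" for i and x :: "nat \<Rightarrow> 'a"
  have w_meas[measurable]: "w i \<in> measurable P (blk_space m borel)" for i unfolding w_def by measurable
  have w_sp: "w i x \<in> source_block" for i x by (simp add: w_def window_def blk_space_def space_PiM)
  note fw = f_range[OF w_sp] and fint = integrable_sections(1)
  have A_eq: "A = {x. (\<Sum>i<k. dmean (w i x)) \<le> real k * a \<and> (\<Sum>i<k. lmean (w i x)) \<le> real k * b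
      \<and> (\<Sum>i<k. hmean (w i x)) \<le> real k * c}"
    by (simp add: A_def w_def start_def k_def)
  let ?QK = "PiM {..<k} (\<lambda>_. Q)"
  \<comment> \<open>A good pair constrains distortion and log-mass; the log-likelihood serves only
    to bound the probability of good pairs from below.\<close>
  define G where "G = {z\<in>space (P \<Otimes>\<^sub>M ?QK). (\<Sum>i<k. dsum m (w i (fst z)) (snd z i)) \<le> real k * (a + \<delta>)
      \<and> (\<Sum>i<k. lsum m (snd z i)) \<le> real k * (b + \<delta>)}"
  have pK: "prob_space ?QK" by (rule prob_space_PiM) (rule Q.prob_space_axioms)
  have A_meas: "A \<in> sets P"
  proof -
    have "{x\<in>space P. (\<Sum>i<k. dmean (w i x)) \<le> real k * a \<and> (\<Sum>i<k. lmean (w i x)) \<le> real k * b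
      \<and> (\<Sum>i<k. hmean (w i x)) \<le> real k * c} \<in> sets P" by measurable
    then show ?thesis by (simp add: A_eq P_space)
  qed
  have G_meas: "G \<in> sets (P \<Otimes>\<^sub>M ?QK)"
  proof -
    have 1: "(\<lambda>z. \<Sum>i<k. dsum m (w i (fst z)) (snd z i)) \<in> borel_measurable (P \<Otimes>\<^sub>M ?QK)"
    proof (rule borel_measurable_sum)
      fix i assume "i \<in> {..<k}"
      then have "(\<lambda>z. (w i (fst z), snd z i)) \<in> measurable (P \<Otimes>\<^sub>M ?QK) (blk_space m borel \<Otimes>\<^sub>M Q)"
        by (intro measurable_Pair measurable_compose[OF measurable_fst w_meas]
            measurable_compose[OF measurable_snd] measurable_component_singleton)
      then have "(\<lambda>z. (w i (fst z), snd z i)) \<in> measurable (P \<Otimes>\<^sub>M ?QK) (blk_space m borel \<Otimes>\<^sub>M blk_space m borel)"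
        by (simp cong: measurable_cong_sets add: sets_pair_measure_cong[OF refl sets_Q])
      from measurable_compose[OF this dsum_meas]
      show "(\<lambda>z. dsum m (w i (fst z)) (snd z i)) \<in> borel_measurable (P \<Otimes>\<^sub>M ?QK)" by simp
    qed
    have 2: "(\<lambda>z. \<Sum>i<k. lsum m (snd z i)) \<in> borel_measurable (P \<Otimes>\<^sub>M ?QK)"
      by (intro borel_measurable_sum measurable_compose[OF measurable_snd] borel_measurable_coordinate lsum_Q)
    show ?thesis unfolding G_def using 1 2 by measurable
  qed
  \<comment> \<open>On \<open>A\<close> the k block entropies add up to at most k c, so p is a
    common lower bound for all typical x.\<close>
  define p where "p = exp (- (real k * (c + \<delta>))) / 2"
  have "exp (- (real k * (c + \<delta>))) \<le> 1" using c \<delta> by simp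
  then have p01: "0 \<le> p" "p \<le> 1"
    unfolding p_def using exp_gt_zero[of "- (real k * (c + \<delta>))"] by linarith+
  define C0 where "C0 = (real m * \<rho>max)\<^sup>2 + (real m * Lmax)\<^sup>2 + (16 + \<bar>B\<bar> * (ln \<bar>B\<bar>)\<^sup>2)"
  \<comment> \<open>One criterion for three observables: for distortion and log-mass the square
    itself is bounded, by E; for the log-likelihood only its product with f is, by E'.\<close>
  have sq: "integrable Q (\<lambda>y. f z y * (e y)\<^sup>2) \<and> (\<integral>y. f z y * (e y)\<^sup>2 \<partial>Q) \<le> C0"
    if z: "z \<in> source_block" and e[measurable]: "e \<in> borel_measurable Q" and le: "\<And>y. y \<in> space Q \<Longrightarrow> f z y * (e y)\<^sup>2 \<le> f z y * E + E'"
      and EE: "E + E' \<le> C0" "0 \<le> E" for z e E E'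
  proof
    have [measurable]: "f z \<in> borel_measurable Q" by (rule f_section[OF z])
    show i: "integrable Q (\<lambda>y. f z y * (e y)\<^sup>2)"
    proof (rule Bochner_Integration.integrable_bound[where f="\<lambda>y. f z y * E + E'"])
      show "AE y in Q. norm (f z y * (e y)\<^sup>2) \<le> norm (f z y * E + E')"
      proof (rule AE_I2)
        fix y assume y: "y \<in> space Q"
        have "0 \<le> f z y * (e y)\<^sup>2" using f_range[OF z y] by simp
        then show "norm (f z y * (e y)\<^sup>2) \<le> norm (f z y * E + E')" using le[OF y] by simp
      qed
    qed (use fint[OF z] in auto)
    have "(\<integral>y. f z y * (e y)\<^sup>2 \<partial>Q) \<le> (\<integral>y. f z y * E + E' \<partial>Q)"
      by (rule integral_mono[OF i]) (use fint[OF z] le in auto)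
    also have "\<dots> = E + E'" using fint[OF z] f_integral[OF z] by (simp add: Q.prob_space)
    finally show "(\<integral>y. f z y * (e y)\<^sup>2 \<partial>Q) \<le> C0" using EE by simp
  qed
  have cover: "p \<le> measure ?QK {y\<in>space ?QK. (x, y) \<in> G}" if x: "x \<in> A" for x
  proof -
    let ?S = "{y\<in>space ?QK. (\<Sum>i<k. dsum m (w i x) (y i)) \<le> (\<Sum>i<k. dmean (w i x)) + real k * \<delta> \<and>
        (\<Sum>i<k. lsum m (y i)) \<le> (\<Sum>i<k. lmean (w i x)) + real k * \<delta>}"
    have 1: "integrable Q (\<lambda>y. f (w i x) y * (dsum m (w i x) y)\<^sup>2) \<and> (\<integral>y. f (w i x) y * (dsum m (w i x) y)\<^sup>2 \<partial>Q) \<le> C0" for i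
    proof (rule sq[OF w_sp dsum_section[OF w_sp]])
      fix y assume "y \<in> space Q"
      then have "f (w i x) y * (dsum m (w i x) y)\<^sup>2 \<le> f (w i x) y * (real m * \<rho>max)\<^sup>2"
        using fw dsum_nonneg dsum_le by (intro mult_left_mono power_mono) auto
      then show "f (w i x) y * (dsum m (w i x) y)\<^sup>2 \<le> f (w i x) y * (real m * \<rho>max)\<^sup>2 + 0" by simp
    qed (auto simp: C0_def)
    have 2: "integrable Q (\<lambda>y. f (w i x) y * (lsum m y)\<^sup>2) \<and> (\<integral>y. f (w i x) y * (lsum m y)\<^sup>2 \<partial>Q) \<le> C0" for i
    proof (rule sq[OF w_sp lsum_Q])
      fix y assume "y \<in> space Q"
      moreover have "(lsum m y)\<^sup>2 \<le> (real m * Lmax)\<^sup>2"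
        unfolding abs_le_square_iff[symmetric] using lsum_abs_le[of m y] by simp
      ultimately have "f (w i x) y * (lsum m y)\<^sup>2 \<le> f (w i x) y * (real m * Lmax)\<^sup>2"
        using fw by (intro mult_left_mono) auto
      then show "f (w i x) y * (lsum m y)\<^sup>2 \<le> f (w i x) y * (real m * Lmax)\<^sup>2 + 0" by simp
    qed (auto simp: C0_def)
    have 3: "integrable Q (\<lambda>y. f (w i x) y * (ln (f (w i x) y))\<^sup>2) \<and> (\<integral>y. f (w i x) y * (ln (f (w i x) y))\<^sup>2 \<partial>Q) \<le> C0" for i
    proof (rule sq[OF w_sp borel_measurable_ln[OF f_section[OF w_sp]]])
      fix y assume "y \<in> space Q"
      then show "f (w i x) y * (ln (f (w i x) y))\<^sup>2 \<le> f (w i x) y * 0 + (16 + \<bar>B\<bar> * (ln \<bar>B\<bar>)\<^sup>2)"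
        using x_ln_x_squared_le[of "f (w i x) y" B] fw by simp
    qed (auto simp: C0_def)
    have nn: "(\<integral>\<^sup>+y. ennreal (f (w i x) y) \<partial>Q) = 1" for i
      by (subst nn_integral_eq_integral[OF fint[OF w_sp]]) (use fw f_integral[OF w_sp] in auto)
    have "p \<le> exp (- ((\<Sum>i<k. hmean (w i x)) + real k * \<delta>)) / 2"
      using x by (simp add: p_def A_eq distrib_left)
    also have "\<dots> \<le> measure ?QK ?S"
      unfolding dmean_def lmean_def hmean_def
      by (rule product_ball_lower_bound[where C=C0, OF Q.prob_space_axioms k0 \<delta>])
        (use large f_section[OF w_sp] dsum_section[OF w_sp] lsum_Q fw 1 2 3 nn in \<open>auto simp: C0_def k_def\<close>)
    also have "\<dots> \<le> measure ?QK {y\<in>space ?QK. (x, y) \<in> G}"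
    proof (rule finite_measure.finite_measure_mono[OF prob_space.finite_measure[OF pK]])
      show "?S \<subseteq> {y\<in>space ?QK. (x, y) \<in> G}"
        using x by (auto simp: G_def A_eq space_pair_measure P_space distrib_left)
      have "Pair x -` G \<in> sets ?QK" by (rule sets_Pair1[OF G_meas])
      moreover have "Pair x -` G = {y\<in>space ?QK. (x, y) \<in> G}" by (auto simp: G_def space_pair_measure)
      ultimately show "{y\<in>space ?QK. (x, y) \<in> G} \<in> sets ?QK" by simp
    qed
    finally show ?thesis .
  qed
  \<comment> \<open>N is n / p rounded up, so that (1 - p)^N \<le> exp(- p N) \<le> exp(-
    n).\<close>
  define N where "N = nat \<lceil>2 * real n * exp (real k * (c + \<delta>))\<rceil>"
  have n1: "1 \<le> n" using n m by simp
  have N_ge: "2 * real n * exp (real k * (c + \<delta>)) \<le> real N" unfolding N_def by linarith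
  \<comment> \<open>Since n exp(k (c + \<delta>)) is at least 1, a third multiple of it absorbs the
    rounding.\<close>
  have N_le: "real N \<le> 3 * real n * exp (real k * (c + \<delta>))"
  proof -
    have "1 * 1 \<le> real n * exp (real k * (c + \<delta>))" using n1 c \<delta> by (intro mult_mono) auto
    moreover have "real N \<le> 2 * real n * exp (real k * (c + \<delta>)) + 1"
    proof -
      have "0 \<le> 2 * real n * exp (real k * (c + \<delta>))" by simp
      then show ?thesis unfolding N_def by linarith
    qed
    ultimately show ?thesis by linarith
  qed
  obtain Y where Y: "finite Y" "card Y \<le> N" "Y \<subseteq> space ?QK"
    and U: "{x\<in>A. \<forall>y\<in>Y. (x, y) \<notin> G} \<in> sets P" and PU: "prob {x\<in>A. \<forall>y\<in>Y. (x, y) \<notin> G} \<le> (1 - p) ^ N"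
    using greedy_cover[OF prob_space_axioms pK G_meas A_meas p01 cover, of N] by blast
  have "(1 - p) ^ N \<le> exp (- p) ^ N"
    using p01 exp_ge_add_one_self[of "- p"] by (intro power_mono) auto
  also have "\<dots> = exp (- (p * real N))" by (simp add: exp_of_nat_mult[symmetric])
  also have "\<dots> \<le> exp (- real n)"
  proof -
    have "p * (2 * real n * exp (real k * (c + \<delta>))) = real n * (exp (- (real k * (c + \<delta>))) * exp (real k * (c + \<delta>)))"
      by (simp add: p_def)
    also have "\<dots> = real n" by (simp add: exp_add[symmetric])
    finally have "real n \<le> p * real N" using mult_left_mono[OF N_ge p01(1)] by (simp only:)
    then show ?thesis by simp
  qed
  finally have PU': "prob {x\<in>A. \<forall>y\<in>Y. (x, y) \<notin> G} \<le> exp (- real n)" using PU by simp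
  \<comment> \<open>Words violating the mass constraint belong to no good pair, so dropping them
    loses no coverage and bounds the mass of every remaining word.\<close>
  define Y' where "Y' = {y\<in>Y. (\<Sum>i<k. lsum m (y i)) \<le> real k * (b + \<delta>)}"
  have Y': "finite Y'" "card Y' \<le> N"
    using Y card_mono[OF Y(1), of Y'] by (auto simp: Y'_def)
  define C where "C = embed ` Y'"
  have finC: "finite C" and cardC: "card C \<le> N"
    using Y' card_image_le[OF Y'(1), of embed] by (auto simp: C_def)
  have subC: "C \<subseteq> {..<n} \<rightarrow>\<^sub>E UNIV" unfolding C_def by (rule image_subsetI) (rule embed_in)
  have cov: "\<exists>y\<in>C. dsum n x y \<le> real k * (a + \<delta>) + real (n - m * m * L) * \<rho>max"
    if x: "x \<in> A - {x\<in>A. \<forall>y\<in>Y. (x, y) \<notin> G}" for x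
  proof -
    from x obtain y where y: "y \<in> Y" "(x, y) \<in> G" by auto
    have "embed y \<in> C" using y by (auto simp: C_def Y'_def G_def)
    moreover have "dsum n x (embed y) \<le> real k * (a + \<delta>) + real (n - m * m * L) * \<rho>max"
    proof -
      have "dsum n x (embed y) \<le> (\<Sum>i<m * L. \<Sum>j<m. \<rho> (x (start i + j)) (y i j)) + real (n - m * m * L) * \<rho>max"
        unfolding dsum_def by (rule sum_embed_le) (rule rho_bdd)
      also have "(\<Sum>i<m * L. \<Sum>j<m. \<rho> (x (start i + j)) (y i j)) = (\<Sum>i<k. dsum m (w i x) (y i))"
        by (simp add: dsum_def w_def window_def k_def add.commute)
      also have "\<dots> \<le> real k * (a + \<delta>)" using y by (simp add: G_def)
      finally show ?thesis by simp
    qed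
    ultimately show ?thesis by blast
  qed
  have "Mn M n C = (\<Sum>y\<in>C. exp (lsum n y))"
    unfolding Mn_def lsum_def by (simp add: exp_sum M_pos)
  also have "\<dots> \<le> real (card C) * exp (real k * (b + \<delta>) + real (n - m * m * L) * Lmax)"
  proof (rule sum_bounded_above)
    fix z assume "z \<in> C"
    then obtain y where y: "y \<in> Y'" "z = embed y" by (auto simp: C_def)
    have "lsum n z \<le> (\<Sum>i<m * L. \<Sum>j<m. ln (M (y i j))) + real (n - m * m * L) * Lmax"
      unfolding lsum_def y(2) by (rule sum_embed_le[of "\<lambda>_ b. ln (M b)"]) (rule abs_le_D1[OF logM_bdd])
    also have "(\<Sum>i<m * L. \<Sum>j<m. ln (M (y i j))) = (\<Sum>i<k. lsum m (y i))" by (simp add: lsum_def k_def)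
    also have "\<dots> \<le> real k * (b + \<delta>)" using y by (simp add: Y'_def)
    finally show "exp (lsum n z) \<le> exp (real k * (b + \<delta>) + real (n - m * m * L) * Lmax)" by simp
  qed
  also have "\<dots> \<le> (3 * real n * exp (real k * (c + \<delta>))) * exp (real k * (b + \<delta>) + real (n - m * m * L) * Lmax)"
    using cardC N_le by (intro mult_right_mono) auto
  also have "\<dots> = 3 * real n * exp (real k * (b + c + 2 * \<delta>) + real (n - m * m * L) * Lmax)"
    by (simp add: mult.assoc exp_add[symmetric] algebra_simps)
  finally show ?thesis
    using finC subC U PU' cov unfolding k_def
    by (intro exI[of _ C] exI[of _ "{x\<in>A. \<forall>y\<in>Y. (x, y) \<notin> G}"] conjI ballI)
qed

end

section \<open>Almost sure covering\<close>

text \<open>Dominated convergence for the indicators of the events.\<close>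

lemma (in prob_space) AE_eventually_imp_prob_tendsto_1:
  assumes A: "\<And>n. A n \<in> events" and ae: "AE x in M. \<forall>\<^sub>F n in sequentially. x \<in> A n"
  shows "(\<lambda>n. prob (A n)) \<longlonglongrightarrow> 1"
proof -
  have "(\<lambda>n. \<integral>x. indicator (A n) x \<partial>M) \<longlonglongrightarrow> (\<integral>x. (1::real) \<partial>M)"
  proof (rule integral_dominated_convergence[where w="\<lambda>_. 1"])
    show "AE x in M. (\<lambda>n. indicator (A n) x :: real) \<longlonglongrightarrow> 1"
      using ae
    proof eventually_elim
      fix x assume "\<forall>\<^sub>F n in sequentially. x \<in> A n"
      then show "(\<lambda>n. indicator (A n) x :: real) \<longlonglongrightarrow> 1"
        by (intro tendsto_eventually) (auto elim: eventually_mono)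
    qed
  qed (use A in \<open>auto simp: indicator_def\<close>)
  then show ?thesis using A by (simp add: prob_space)
qed

context coding_problem
begin

text \<open>For each large n the codebook comes from the largest layout fitting into n symbols. The
  gaps between d and m D and between r and m \<kappa> pay for the typicality slack, the bounded
  number of left-over symbols and the factor 3 n in the mass.\<close>

lemma covering_codebooks:
  assumes erg: "ergodic_proc P" and ach: "achievable m d r" and m: "m \<ge> 1"
    and d: "d < real m * D" and r: "r < real m * \<kappa>" and D: "D \<ge> 0"
  shows "\<exists>C :: nat \<Rightarrow> (nat \<Rightarrow> 'b) set. (\<forall>n. finite (C n) \<and> C n \<subseteq> {..<n} \<rightarrow>\<^sub>E UNIV)
    \<and> (\<forall>n\<ge>1. eln (Mn M n (C n)) / ereal (real n) \<le> ereal \<kappa>)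
    \<and> (AE x in P. \<forall>\<^sub>F n in sequentially. \<exists>y\<in>C n. dsum n x y \<le> real n * D)"
proof -
  obtain Q f B where K: "coding_kernel P \<rho> M \<rho>max Lmax m Q f B"
    and dd: "(\<integral>x. \<integral>y. f x y * dsum m x y \<partial>Q \<partial>marg m P) \<le> d"
    and rr: "(\<integral>x. \<integral>y. f x y * (ln (f x y) + lsum m y) \<partial>Q \<partial>marg m P) \<le> r"
    using ach by (rule achievableE)
  interpret K: coding_kernel P \<rho> M \<rho>max Lmax m Q f B by (rule K)
  define eu ev ew where "eu = K.X.expectation K.dmean" and "ev = K.X.expectation K.lmean"
    and "ew = K.X.expectation K.hmean"
  have eu: "eu \<le> d" using dd by (simp add: eu_def K.dmean_def[abs_def])
  have evw: "ev + ew \<le> r" using rr unfolding K.rate_eq ev_def ew_def .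
  have ew0: "0 \<le> ew"
    unfolding ew_def by (rule Bochner_Integration.integral_nonneg_AE) (auto intro!: AE_I2 K.hmean_nonneg)
  \<comment> \<open>Distortion loses 2 \<delta>, one from the ergodic average and one from the
    codebook; rate loses 4 \<delta>, two from each. At least half of either gap survives, as g1 and
    g2.\<close>
  define \<delta> where "\<delta> = min ((real m * D - d) / 4) ((real m * \<kappa> - r) / 8)"
  have \<delta>: "\<delta> > 0" using d r by (simp add: \<delta>_def)
  define g1 g2 where "g1 = real m * D - (d + 2 * \<delta>)" and "g2 = real m * \<kappa> - (r + 4 * \<delta>)"
  have g1: "g1 > 0" and g2: "g2 > 0"
  proof -
    have "\<delta> \<le> (real m * D - d) / 4" "\<delta> \<le> (real m * \<kappa> - r) / 8"
      unfolding \<delta>_def by (rule min.cobounded1, rule min.cobounded2)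
    with d r \<delta> show "g1 > 0" "g2 > 0" unfolding g1_def g2_def by (simp_all add: field_simps)
  qed
  define c0 where "c0 = real (m * m + m)"
  \<comment> \<open>For n \<ge> m this is the largest L with m m L + m \<le> n, so at most m m + m
    symbols, the constant c0, lie outside the blocks.\<close>
  define L where "L n = (n - m) div (m * m)" for n
  have L_lim: "filterlim L at_top sequentially"
    unfolding filterlim_at_top eventually_sequentially
  proof (intro allI)
    fix Z :: nat
    show "\<exists>N. \<forall>n\<ge>N. Z \<le> L n"
    proof (intro exI[of _ "Z * (m * m) + m"] allI impI)
      fix n assume "Z * (m * m) + m \<le> n"
      then show "Z \<le> L n" using m by (simp add: L_def less_eq_div_iff_mult_less_eq)
    qed
  qed
  define c1 where "c1 = 6 * ((real m * \<rho>max)\<^sup>2 + (real m * Lmax)\<^sup>2 + (16 + \<bar>B\<bar> * (ln \<bar>B\<bar>)\<^sup>2))"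
  \<comment> \<open>The second term allows for \<kappa> of either sign: the left-over symbols
    contribute at least - c0 times the absolute value of \<kappa> to n \<kappa>.\<close>
  define c2 where "c2 = c0 * Lmax + c0 * \<bar>\<kappa>\<bar>"
  define nice where "nice l \<longleftrightarrow> l \<ge> 1 \<and> c1 \<le> real (m * l) * \<delta>\<^sup>2 \<and> c0 * \<rho>max \<le> real (m * l) * g1
      \<and> ln (3 * (real m * real m * real l + c0)) + c2 \<le> real (m * l) * g2" for l
  have nice: "\<forall>\<^sub>F l in sequentially. nice l"
  proof -
    have m0: "real m > 0" using m by simp
    have e1: "\<forall>\<^sub>F l in sequentially. c \<le> real (m * l) * g" if "g > 0" for c g :: real
    proof -
      have "0 < real m * g" using that m0 by simp
      from reals_Archimedean3[OF this] obtain N where N: "c < real N * (real m * g)" by blast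
      show ?thesis unfolding eventually_sequentially
      proof (intro exI[of _ N] allI impI)
        fix l assume "N \<le> l"
        then have "real N * (real m * g) \<le> real l * (real m * g)" using that m0 by (intro mult_right_mono) auto
        then show "c \<le> real (m * l) * g" using N by (simp add: ac_simps)
      qed
    qed
    have "\<forall>\<^sub>F l in sequentially. ln (3 * (real m * real m * real l + c0)) + c2 \<le> real (m * l) * g2"
    proof -
      have a: "real m * real m > 0" using m0 by simp
      have "(\<lambda>l. (ln (3 * (real m * real m * real l + c0)) + c2) / real l) \<longlonglongrightarrow> 0"
        using a by real_asymp
      then have "\<forall>\<^sub>F l in sequentially. (ln (3 * (real m * real m * real l + c0)) + c2) / real l < real m * g2"
        by (rule order_tendstoD) (use m0 g2 in simp)
      then show ?thesis using eventually_gt_at_top[of 0]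
        by eventually_elim (simp add: field_simps)
    qed
    with e1[of "\<delta>\<^sup>2" c1] e1[OF g1, of "c0 * \<rho>max"] eventually_ge_at_top[of 1] \<delta> show ?thesis
      unfolding nice_def by (auto simp: eventually_conj_iff)
  qed
  define A where "A l = {x. (\<Sum>i<m*l. K.dmean (window (i * m + i div l) m x)) \<le> real (m * l) * (eu + \<delta>)
      \<and> (\<Sum>i<m*l. K.lmean (window (i * m + i div l) m x)) \<le> real (m * l) * (ev + \<delta>)
      \<and> (\<Sum>i<m*l. K.hmean (window (i * m + i div l) m x)) \<le> real (m * l) * (ew + \<delta>)}" for l
  have m1: "m > 0" using m by simp
  have eru: "AE x in P. \<forall>\<^sub>F l in sequentially. (\<Sum>i<m*l. K.dmean (window (i * m + i div l) m x)) \<le> real (m * l) * (eu + \<delta>)"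
    unfolding eu_def by (rule ergodic_windows[OF erg m1 \<delta> K.means_meas(1) K.means_abs_le(1)])
  have erv: "AE x in P. \<forall>\<^sub>F l in sequentially. (\<Sum>i<m*l. K.lmean (window (i * m + i div l) m x)) \<le> real (m * l) * (ev + \<delta>)"
    unfolding ev_def by (rule ergodic_windows[OF erg m1 \<delta> K.means_meas(2) K.means_abs_le(2)])
  have erw: "AE x in P. \<forall>\<^sub>F l in sequentially. (\<Sum>i<m*l. K.hmean (window (i * m + i div l) m x)) \<le> real (m * l) * (ew + \<delta>)"
    unfolding ew_def by (rule ergodic_windows[OF erg m1 \<delta> K.means_meas(3) K.means_abs_le(3)])
  from eru erv erw have AE_A: "AE x in P. \<forall>\<^sub>F l in sequentially. x \<in> A l"
    by eventually_elim (simp add: A_def eventually_conj_iff)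
  have ex: "\<exists>C U. finite C \<and> C \<subseteq> {..<n} \<rightarrow>\<^sub>E UNIV \<and> U \<in> sets P \<and> prob U \<le> exp (- real n)
      \<and> (n \<ge> 1 \<longrightarrow> eln (Mn M n C) / ereal (real n) \<le> ereal \<kappa>)
      \<and> (n \<ge> m \<and> nice (L n) \<longrightarrow> (\<forall>x\<in>A (L n) - U. \<exists>y\<in>C. dsum n x y \<le> real n * D))" for n
  proof (cases "n \<ge> m \<and> nice (L n)")
    case False
    \<comment> \<open>The empty codebook serves the finitely many remaining n: its mass is 0,
      \<open>eln\<close> sends it to -\<infinity>, and the rate bound holds.\<close>
    then show ?thesis by (intro exI[of _ "{} :: (nat \<Rightarrow> 'b) set"] exI[of _ "{} :: (nat \<Rightarrow> 'a) set"]) (auto simp: Mn_def eln_def)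
  next
    case True
    define l where "l = L n"
    have nm: "n \<ge> m" and l: "nice l" using True by (simp_all add: l_def)
    have lo: "m * m * l + m \<le> n" and hi: "n \<le> m * m * l + (m * m + m)"
    proof -
      have "n - m = m * m * l + (n - m) mod (m * m)" by (simp add: l_def L_def)
      moreover have "(n - m) mod (m * m) < m * m" using m by simp
      ultimately show "m * m * l + m \<le> n" "n \<le> m * m * l + (m * m + m)" using nm by linarith+
    qed
    have n1: "n \<ge> 1" using nm m by simp
    have lay: "block_layout m l n" using m l lo by (auto simp: block_layout_def nice_def)
    have large: "6 * ((real m * \<rho>max)\<^sup>2 + (real m * Lmax)\<^sup>2 + (16 + \<bar>B\<bar> * (ln \<bar>B\<bar>)\<^sup>2)) \<le> real (m * l) * \<delta>\<^sup>2"
      using l by (simp add: nice_def c1_def)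
    have ew\<delta>: "0 \<le> ew + \<delta>" using ew0 \<delta> by simp
    obtain C U where C: "finite C" "C \<subseteq> {..<n} \<rightarrow>\<^sub>E UNIV" and U: "U \<in> sets P" "prob U \<le> exp (- real n)"
      and cov: "\<forall>x\<in>A l - U. \<exists>y\<in>C. dsum n x y \<le> real (m * l) * (eu + \<delta> + \<delta>) + real (n - m * m * l) * \<rho>max"
      and mass: "Mn M n C \<le> 3 * real n * exp (real (m * l) * (ev + \<delta> + (ew + \<delta>) + 2 * \<delta>) + real (n - m * m * l) * Lmax)"
      using K.codebook_exists[OF lay \<delta> large ew\<delta>, of "eu + \<delta>" "ev + \<delta>"] unfolding A_def by blast
    define e where "e = real (n - m * m * l)"
    have e: "0 \<le> e" "e \<le> c0" "real n = real m * real (m * l) + e"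
    proof -
      have 1: "real (m * m * l) \<le> real n" using lo by (intro of_nat_mono) linarith
      have 2: "real n \<le> real (m * m * l) + c0" using of_nat_mono[OF hi, where 'a=real] by (simp add: c0_def)
      have 3: "e = real n - real (m * m * l)" unfolding e_def using lo by (intro of_nat_diff) linarith
      show "0 \<le> e" "e \<le> c0" using 1 2 3 by auto
      show "real n = real m * real (m * l) + e" using 3 by simp
    qed
    have dist: "real (m * l) * (eu + \<delta> + \<delta>) + e * \<rho>max \<le> real n * D"
    proof -
      have "real (m * l) * (eu + \<delta> + \<delta>) \<le> real (m * l) * (d + 2 * \<delta>)" using eu by (intro mult_left_mono) auto
      moreover have "e * \<rho>max \<le> c0 * \<rho>max" using e rhomax_nonneg by (intro mult_right_mono)
      moreover have "c0 * \<rho>max \<le> real (m * l) * g1" using l by (simp add: nice_def)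
      moreover have "real (m * l) * (d + 2 * \<delta>) + real (m * l) * g1 = real (m * l) * (real m * D)"
        by (simp add: g1_def algebra_simps)
      moreover have "real (m * l) * (real m * D) \<le> real n * D"
        using mult_right_mono[of "real m * real (m * l)" "real n" D] e D by (simp add: ac_simps)
      ultimately show ?thesis by linarith
    qed
    have rate: "eln (Mn M n C) / ereal (real n) \<le> ereal \<kappa>"
    proof (cases "Mn M n C = 0")
      case True then show ?thesis using n1 by (simp add: eln_def)
    next
      case False
      have "0 \<le> Mn M n C" unfolding Mn_def by (intro sum_nonneg prod_nonneg) (use M_pos less_imp_le in blast)
      with False have pos: "0 < Mn M n C" by simp
      let ?X = "real (m * l) * (ev + \<delta> + (ew + \<delta>) + 2 * \<delta>) + e * Lmax"
      have "ln (Mn M n C) \<le> ln (3 * real n * exp ?X)" using mass pos by (simp add: e_def)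
      also have "\<dots> = ln (3 * real n) + ?X" using n1 by (simp add: ln_mult)
      also have "\<dots> \<le> real n * \<kappa>"
      proof -
        have "ln (3 * real n) \<le> ln (3 * (real m * real m * real l + c0))"
          using e n1 by simp
        moreover have "real (m * l) * (ev + \<delta> + (ew + \<delta>) + 2 * \<delta>) \<le> real (m * l) * (r + 4 * \<delta>)"
          using evw by (intro mult_left_mono) auto
        moreover have "e * Lmax \<le> c0 * Lmax" using e Lmax_nonneg by (intro mult_right_mono)
        moreover have "ln (3 * (real m * real m * real l + c0)) + (c0 * Lmax + c0 * \<bar>\<kappa>\<bar>) \<le> real (m * l) * g2"
          using l by (simp add: nice_def c2_def)
        moreover have "real (m * l) * (r + 4 * \<delta>) + real (m * l) * g2 = real (m * l) * (real m * \<kappa>)"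
          by (simp add: g2_def algebra_simps)
        moreover have "real n * \<kappa> = real (m * l) * (real m * \<kappa>) + e * \<kappa>" using e(3) by (simp add: algebra_simps)
        moreover have "- (c0 * \<bar>\<kappa>\<bar>) \<le> e * \<kappa>"
        proof -
          have "\<bar>e * \<kappa>\<bar> \<le> c0 * \<bar>\<kappa>\<bar>" unfolding abs_mult using e by (intro mult_right_mono) auto
          then show ?thesis by linarith
        qed
        ultimately show ?thesis by linarith
      qed
      finally show ?thesis using pos n1 by (simp add: eln_def field_simps)
    qed
    have "\<forall>x\<in>A l - U. \<exists>y\<in>C. dsum n x y \<le> real n * D"
      using cov dist unfolding e_def by (meson order_trans)
    then show ?thesis using C U rate unfolding l_def by blast
  qed
  obtain C U where C: "\<And>n. finite (C n) \<and> C n \<subseteq> {..<n} \<rightarrow>\<^sub>E UNIV"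
    and U: "\<And>n. U n \<in> sets P" "\<And>n. prob (U n) \<le> exp (- real n)"
    and rate: "\<And>n. n \<ge> 1 \<Longrightarrow> eln (Mn M n (C n)) / ereal (real n) \<le> ereal \<kappa>"
    and cov: "\<And>n x. n \<ge> m \<Longrightarrow> nice (L n) \<Longrightarrow> x \<in> A (L n) \<Longrightarrow> x \<notin> U n \<Longrightarrow> \<exists>y\<in>C n. dsum n x y \<le> real n * D"
    using ex by (metis DiffI)
  \<comment> \<open>Summability of exp(- n) lets Borel-Cantelli place almost every path in only
    finitely many of the uncovered sets.\<close>
  have "summable (\<lambda>n. exp (- real n))"
  proof -
    have "summable (\<lambda>n. exp (- 1 :: real) ^ n)" by (rule summable_geometric) simp
    then show ?thesis by (simp add: exp_of_nat_mult[symmetric])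
  qed
  then have "summable (\<lambda>n. prob (U n))"
    by (rule summable_comparison_test'[where N=0]) (use U in auto)
  then have "AE x in P. \<forall>\<^sub>F n in sequentially. x \<in> space P - U n"
    by (intro borel_cantelli_AE1) (use U in \<open>auto simp: emeasure_eq_measure\<close>)
  with AE_A have "AE x in P. \<forall>\<^sub>F n in sequentially. \<exists>y\<in>C n. dsum n x y \<le> real n * D"
  proof eventually_elim
    fix x assume xA: "\<forall>\<^sub>F l in sequentially. x \<in> A l" and xU: "\<forall>\<^sub>F n in sequentially. x \<in> space P - U n"
    \<comment> \<open>Typicality holds for all large layouts l; it is transported to large n along
      \<open>L\<close>, which tends to infinity.\<close>
    have "\<forall>\<^sub>F n in sequentially. x \<in> A (L n)" "\<forall>\<^sub>F n in sequentially. nice (L n)"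
      using eventually_compose_filterlim[OF xA L_lim] eventually_compose_filterlim[OF nice L_lim] by simp_all
    with xU eventually_ge_at_top[of m] show "\<forall>\<^sub>F n in sequentially. \<exists>y\<in>C n. dsum n x y \<le> real n * D"
      by eventually_elim (use cov in auto)
  qed
  then show ?thesis using C rate by blast
qed

lemma blowup_in_sets: "finite C \<Longrightarrow> C \<subseteq> {..<n} \<rightarrow>\<^sub>E UNIV \<Longrightarrow> blowup \<rho> n C D \<in> sets (blk_space n (borel :: 'a measure))"
  unfolding blowup_def
proof (rule sets.sets_Collect_finite_Ex)
  fix y assume "y \<in> C" and C: "C \<subseteq> {..<n} \<rightarrow>\<^sub>E UNIV"
  then have y: "y \<in> space (blk_space n (borel :: 'b measure))" by (auto simp: blk_space_def space_PiM)
  have [measurable]: "(\<lambda>x. dsum n x y) \<in> borel_measurable (blk_space n borel)"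
    using measurable_Pair1[OF dsum_meas y] by simp
  show "{x \<in> space (blk_space n borel). rho_n \<rho> n x y \<le> D} \<in> sets (blk_space n (borel :: 'a measure))"
    unfolding rho_n_dsum by measurable
qed

end

theorem theorem4:
  fixes P :: "(nat \<Rightarrow> 'a::polish_space) measure"
    and \<rho> :: "'a \<Rightarrow> 'b::polish_space \<Rightarrow> real"
    and M :: "'b \<Rightarrow> real"
    and \<rho>max Lmax D \<epsilon> :: real
  assumes P_prob: "prob_space P"
    and P_sets: "sets P = sets (path_space (borel :: 'a measure))"
    and rho_meas: "(\<lambda>(x, y). \<rho> x y) \<in> borel_measurable (borel \<Otimes>\<^sub>M borel)"
    and rho_nonneg: "\<And>x y. 0 \<le> \<rho> x y"
    and M_meas: "M \<in> borel_measurable borel"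
    and M_pos: "\<And>y. 0 < M y"
    and rho_bdd: "0 \<le> \<rho>max" "\<And>x y. \<rho> x y \<le> \<rho>max"
    and logM_bdd: "\<And>y. \<bar>ln (M y)\<bar> \<le> Lmax"
    and stat: "stationary P"
    and erg: "ergodic_proc P"
    and D_gt: "ereal D > D_min P \<rho> M"
    and eps: "\<epsilon> > 0"
  shows "(\<exists>C :: nat \<Rightarrow> (nat \<Rightarrow> 'b) set.
            (\<forall>n. finite (C n) \<and> C n \<subseteq> {..<n} \<rightarrow>\<^sub>E UNIV)
          \<and> (\<forall>n\<ge>1. eln (Mn M n (C n)) / ereal (real n) \<le> R P \<rho> M D + ereal \<epsilon>)
          \<and> (\<lambda>n. measure (marg n P) (blowup \<rho> n (C n) D)) \<longlonglongrightarrow> 1)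
       \<and> (ergodic_in_blocks P \<longrightarrow>
          (\<exists>C :: nat \<Rightarrow> (nat \<Rightarrow> 'b) set.
            (\<forall>n. finite (C n) \<and> C n \<subseteq> {..<n} \<rightarrow>\<^sub>E UNIV)
          \<and> (\<forall>n\<ge>1. eln (Mn M n (C n)) / ereal (real n) \<le> R P \<rho> M D + ereal \<epsilon>)
          \<and> (AE x in P. eventually (\<lambda>n. rho_n_set \<rho> n (restrict x {..<n}) (C n) \<le> ereal D) sequentially)))"
proof -
  interpret prob_space P by fact
  interpret coding_problem P \<rho> M \<rho>max Lmax
    by unfold_locales fact+
  obtain R0 where R0: "R P \<rho> M D = ereal R0"
    and ach: "\<And>\<delta>. \<delta> > 0 \<Longrightarrow> \<exists>m\<ge>1. \<exists>d r. achievable m d r \<and> d < real m * D \<and> r < real m * (R0 + \<delta>)"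
    using rate_function_achievable[OF D_gt] by blast
  \<comment> \<open>\<epsilon> itself serves as the slack, so the codebooks are built for the rate
    \<kappa> = R0 + \<epsilon>.\<close>
  obtain m d r where m: "m \<ge> 1" "achievable m d r" "d < real m * D" "r < real m * (R0 + \<epsilon>)"
    using ach[OF eps] by blast
  have D0: "D \<ge> 0"
  proof -
    have "0 \<le> D_min P \<rho> M" unfolding D_min_def by (rule Inf_greatest) auto
    from le_less_trans[OF this D_gt] show ?thesis by simp
  qed
  obtain C where C: "\<And>n. finite (C n) \<and> C n \<subseteq> {..<n} \<rightarrow>\<^sub>E UNIV"
    and rate: "\<And>n. n \<ge> 1 \<Longrightarrow> eln (Mn M n (C n)) / ereal (real n) \<le> ereal (R0 + \<epsilon>)"
    and cov: "AE x in P. \<forall>\<^sub>F n in sequentially. \<exists>y\<in>C n. dsum n x y \<le> real n * D"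
    using covering_codebooks[OF erg m(2,1,3,4) D0] by blast
  have rest: "restrict x {..<n} = window 0 n x" for x :: "nat \<Rightarrow> 'a" and n by (simp add: window_def)
  have rho_le: "rho_n \<rho> n (window 0 n x) y \<le> D" if "dsum n x y \<le> real n * D" "n \<ge> 1" for n x y
    using that by (simp add: rho_n_dsum dsum_def window_def field_simps)
  have cov': "AE x in P. \<forall>\<^sub>F n in sequentially. \<exists>y\<in>C n. rho_n \<rho> n (window 0 n x) y \<le> D"
    using cov
  proof eventually_elim
    fix x assume "\<forall>\<^sub>F n in sequentially. \<exists>y\<in>C n. dsum n x y \<le> real n * D"
    then show "\<forall>\<^sub>F n in sequentially. \<exists>y\<in>C n. rho_n \<rho> n (window 0 n x) y \<le> D"
      using eventually_ge_at_top[of 1] by eventually_elim (use rho_le in blast)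
  qed
  have AE_set: "AE x in P. \<forall>\<^sub>F n in sequentially. rho_n_set \<rho> n (restrict x {..<n}) (C n) \<le> ereal D"
    using cov'
  proof eventually_elim
    fix x assume "\<forall>\<^sub>F n in sequentially. \<exists>y\<in>C n. rho_n \<rho> n (window 0 n x) y \<le> D"
    then show "\<forall>\<^sub>F n in sequentially. rho_n_set \<rho> n (restrict x {..<n}) (C n) \<le> ereal D"
      by eventually_elim (auto simp: rho_n_set_def rest intro: INF_lower2)
  qed
  \<comment> \<open>Almost sure eventual covering gives convergence of the covering probabilities on
    path space; the law of the first n symbols carries them over to \<open>marg n P\<close>.\<close>
  have "(\<lambda>n. prob (window 0 n -` blowup \<rho> n (C n) D \<inter> space P)) \<longlonglongrightarrow> 1"
  proof (rule AE_eventually_imp_prob_tendsto_1)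
    show "window 0 n -` blowup \<rho> n (C n) D \<inter> space P \<in> events" for n
      by (rule measurable_sets[OF window_meas blowup_in_sets]) (use C in auto)
    show "AE x in P. \<forall>\<^sub>F n in sequentially. x \<in> window 0 n -` blowup \<rho> n (C n) D \<inter> space P"
      using cov'
    proof eventually_elim
      fix x assume "\<forall>\<^sub>F n in sequentially. \<exists>y\<in>C n. rho_n \<rho> n (window 0 n x) y \<le> D"
      then show "\<forall>\<^sub>F n in sequentially. x \<in> window 0 n -` blowup \<rho> n (C n) D \<inter> space P"
        by eventually_elim (simp add: blowup_def P_space measurable_space[OF window_meas])
    qed
  qed
  moreover have "measure (marg n P) (blowup \<rho> n (C n) D) = prob (window 0 n -` blowup \<rho> n (C n) D \<inter> space P)" for n
    unfolding distr_window[of n 0, symmetric]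
    by (rule measure_distr[OF window_meas blowup_in_sets]) (use C in auto)
  ultimately have lim: "(\<lambda>n. measure (marg n P) (blowup \<rho> n (C n) D)) \<longlonglongrightarrow> 1" by simp
  show ?thesis using C rate lim AE_set by (auto simp: R0)
qed

end
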